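(* Let $X$ be a finite biquandle, $k$ a commutative unital ring, $M=(t,s,r)$ an $X$-module with coefficients in $k$, and $S\subset \mathrm{End}(X)$ a set of biquandle endomorphisms. Then the biquandle module quiver representation with respect to the data vector $(X,M,k,S)$ is an invariant of oriented classical links, of oriented virtual links, and of oriented surface-links. That is, if $D$ and $D'$ are two oriented classical link diagrams (respectively, oriented virtual link diagrams, respectively, oriented marked graph diagrams) representing equivalent oriented classical links (respectively, oriented virtual links, respectively, oriented surface-links), then the quiver representations obtained from $D$ and from $D'$ are isomorphic: there is a bijection $v\mapsto v'$ from the $X$-colorings of $D$ to the $X$-colorings of $D'$ with $(\sigma\circ v)'=\sigma\circ v'$ for all $\sigma\in S$, together with $k$-module isomorphisms $\theta_v:M_v\to M_{v'}$ such that for every arrow $v\to\sigma\circ v$ ($\sigma\in S$) with associated linear map $\phi_\sigma:M_v\to M_{\sigma\circ v}$ in the representation from $D$, and the corresponding map $\phi'_\sigma:M_{v'}\to M_{\sigma\circ v'}$ in the representation from $D'$, one has $\theta_{\sigma\circ v}\circ\phi_\sigma=\phi'_\sigma\circ\theta_v$.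
   Context: **Biquandles.** A biquandle is a set $X$ with binary operations $\underline{\triangleright},\overline{\triangleright}:X\times X\to X$ such that (i) $x\,\underline{\triangleright}\,x=x\,\overline{\triangleright}\,x$ for all $x$; (ii) for all $y$ the maps $x\mapsto x\,\overline{\triangleright}\,y$ and $x\mapsto x\,\underline{\triangleright}\,y$ are invertible, and the map $(x,y)\mapsto(y\,\overline{\triangleright}\,x,\;x\,\underline{\triangleright}\,y)$ of $X\times X$ is invertible; (iii) for all $x,y,z$: $(x\,\underline{\triangleright}\,y)\,\underline{\triangleright}\,(z\,\underline{\triangleright}\,y)=(x\,\underline{\triangleright}\,z)\,\underline{\triangleright}\,(y\,\overline{\triangleright}\,z)$, $(x\,\underline{\triangleright}\,y)\,\overline{\triangleright}\,(z\,\underline{\triangleright}\,y)=(x\,\overline{\triangleright}\,z)\,\underline{\triangleright}\,(y\,\overline{\triangleright}\,z)$, $(x\,\overline{\triangleright}\,y)\,\overline{\triangleright}\,(z\,\overline{\triangleright}\,y)=(x\,\overline{\triangleright}\,z)\,\overline{\triangleright}\,(y\,\underline{\triangleright}\,z)$. A homomorphism is a map preserving both operations; $\mathrm{End}(X)$ is the set of homomorphisms $X\to X$. **Diagrams.** Classical and virtual links are given by oriented (virtual) link diagrams up to (virtual) Reidemeister moves. An oriented surface-link is a closed oriented surface embedded in $\mathbb{R}^4$ up to ambient isotopy; it is represented by an oriented (admissible) marked graph diagram, i.e. a link diagram which may also have 4-valent marked vertices at which edge orientations alternate in/out cyclically, and two such diagrams represent equivalent oriented surface-links if and only if they are related by the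 oriented Yoshikawa moves. The semiarcs of a diagram are the pieces obtained by cutting it at all classical crossings (on both strands) and at all marked vertices; virtual crossings do not cut, and components without crossings or vertices count as one semiarc. **$X$-colorings.** An $X$-coloring $v$ of $D$ assigns an element of $X$ to each semiarc so that: at each classical crossing (of either sign), rotated so that both strands are directed upward, if the left-hand semiarc of the understrand has color $x$ and the left-hand semiarc of the overstrand has color $y$, then the right-hand semiarc of the understrand has color $x\,\underline{\triangleright}\,y$ and the right-hand semiarc of the overstrand has color $y\,\overline{\triangleright}\,x$; and at each marked vertex all four semiarcs have the same color. $X$-colorings of $D$ correspond to homomorphisms from the fundamental biquandle of the link to $X$. Write $D_v$ for $D$ colored by $v$. The image subbiquandle $\mathrm{Im}(D_v)\subset X$ is the subbiquandle generated by the colors appearing in $v$. **Biquandle modules.** An $X$-module with coefficients in $k$ is a triple of maps $t,s,r:X\times X\to k$ such that $t_{x,x}+s_{x,x}=r_{x,x}$ for all $x$; all $t_{x,y}$ and $r_{x,y}$ are units of $k$; and for all $x,y,z\in X$: $r_{y\overline{\triangleright} x,\,z\overline{\triangleright} x}\, r_{x,z}=r_{x\underline{\triangleright} y,\, z\overline{\triangleright} y}\,r_{y,z}$, $r_{x\underline{\triangleright} z,\,y\underline{\triangleright} z}\, t_{y,z}=t_{y\overline{\triangleright} x,\, z\overline{\triangleright} x}\,r_{x,y}$, $r_{x\underline{\triangleright} z,\,y\underline{\triangleright} z}\, s_{y,z}=s_{y\overline{\triangleright} x,\, z\overline{\triangleright} x}\,r_{x,z}$, $t_{x\underline{\triangleright}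 z,\,y\underline{\triangleright} z}\, t_{x,z}=t_{x\underline{\triangleright} y,\, z\overline{\triangleright} y}\,t_{x,y}$, $s_{x\underline{\triangleright} z,\,y\underline{\triangleright} z}\, t_{y,z}=t_{x\underline{\triangleright} y,\, z\overline{\triangleright} y}\,s_{x,y}$, $t_{x\underline{\triangleright} z,\,y\underline{\triangleright} z}\, s_{x,z}+s_{x\underline{\triangleright} z,\, y\underline{\triangleright} z}\,s_{y,z}=s_{x\underline{\triangleright} y,\, z\overline{\triangleright} y}\,r_{y,z}$. **Bead colorings.** Given an $X$-coloring $v$ of $D$, a bead coloring assigns an element ("bead") of $k$ to each semiarc so that at each classical crossing (of either sign), rotated so that both strands are directed upward, if the beads on the left-hand semiarcs colored $x$ (understrand) and $y$ (overstrand) are $a$ and $b$, then the bead on the right-hand understrand semiarc is $c=t_{x,y}a+s_{x,y}b$ and the bead on the right-hand overstrand semiarc is $d=r_{x,y}b$; at each marked vertex the four beads are equal. The bead colorings of $D_v$ form a $k$-submodule $M_v$ of $k^{\{\text{semiarcs of }D\}}$. **Quiver representation.** The biquandle coloring quiver of $D$ with respect to $(X,S)$ has as vertices the $X$-colorings $v$ of $D$ and, for each vertex $v$ and each $\sigma\in S$, one arrow from $v$ to $\sigma\circ v$ (the coloring obtained by applying $\sigma$ to every color). The biquandle module quiver representation with respect to $(X,M,k,S)$ assigns to each vertex $v$ the $k$-module $M_v$ and to each arrow $v\to\sigma\circ v$ the linear map $\phi_\sigma:M_v\to M_{\sigma\circ v}$ which is the identity $\mathrm{Id}$ if $t_{x,y}=t_{\sigma(x),\sigma(y)}$,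 $s_{x,y}=s_{\sigma(x),\sigma(y)}$ and $r_{x,y}=r_{\sigma(x),\sigma(y)}$ for all $x,y\in\mathrm{Im}(D_v)$ (in which case $M_v$ and $M_{\sigma\circ v}$ are the same submodule of $k^{\{\text{semiarcs}\}}$), and is $0$ otherwise. *)

theory Defs
  imports Main "HOL-Library.FuncSet"
begin

section \<open>Oriented diagrams\<close>

text \<open>
  A plane diagram in general position with respect to the height function is cut by horizontal
  lines into elementary slices, read from bottom to top. A slice \<open>(i, e)\<close> has \<open>i\<close> vertical strands
  to the left of the piece \<open>e\<close>; the number of strands to its right is determined by the level.

  \<^item> \<open>Cup b\<close> is a local minimum; its left end is directed upward iff \<open>b\<close>. \<open>Cap\<close> is a local maximum.
  \<^item> \<open>Cross c\<close> is a classical crossing; the strand from bottom left to top right is the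
    overstrand iff \<open>c\<close>.
  \<^item> \<open>Mark m\<close> is a marked vertex; its marker is vertical if \<open>m\<close>, and horizontal otherwise.

  Crossings and vertices in other positions are obtained by bending their edges with cups and caps.
\<close>

datatype piece = Cup bool | Cap | Cross bool | is_Virt: Virt | is_Mark: Mark bool

type_synonym slice = "nat \<times> piece"

text \<open>
  The orientations of the strands at a horizontal level are listed from left to right
  (\<open>True\<close> = upward). A slice transforms the list below it into the list above it, if it can be
  oriented. At a marked vertex, alternation of in and out forces the two lower edges to be
  oppositely directed, and each upper edge to be directed as the lower edge on its side.
\<close>

fun run_slice :: "slice \<Rightarrow> bool list \<Rightarrow> bool list option" where
  "run_slice (i, Cup b) w =
     (if i \<le> length w then Some (take i w @ [b, \<not> b] @ drop i w) else None)"
| "run_slice (i, Cap) w =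
     (if i + 1 < length w \<and> w ! i \<noteq> w ! (i + 1) then Some (take i w @ drop (i + 2) w) else None)"
| "run_slice (i, Cross c) w =
     (if i + 1 < length w then Some (w[i := w ! (i + 1), i + 1 := w ! i]) else None)"
| "run_slice (i, Virt) w =
     (if i + 1 < length w then Some (w[i := w ! (i + 1), i + 1 := w ! i]) else None)"
| "run_slice (i, Mark m) w =
     (if i + 1 < length w \<and> w ! i \<noteq> w ! (i + 1) then Some w else None)"

fun run :: "slice list \<Rightarrow> bool list \<Rightarrow> bool list option" where
  "run [] w = Some w"
| "run (x # D) w = Option.bind (run_slice x w) (run D)"

definition oriented_diagram :: "slice list \<Rightarrow> bool" where
  "oriented_diagram D \<longleftrightarrow> run D [] = Some []"

definition classical_diagram :: "slice list \<Rightarrow> bool" where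
  "classical_diagram D \<longleftrightarrow>
     oriented_diagram D \<and> (\<forall>x\<in>set D. \<not> is_Virt (snd x) \<and> \<not> is_Mark (snd x))"

definition virtual_diagram :: "slice list \<Rightarrow> bool" where
  "virtual_diagram D \<longleftrightarrow> oriented_diagram D \<and> (\<forall>x\<in>set D. \<not> is_Mark (snd x))"

definition marked_graph_diagram :: "slice list \<Rightarrow> bool" where
  "marked_graph_diagram D \<longleftrightarrow> oriented_diagram D \<and> (\<forall>x\<in>set D. \<not> is_Virt (snd x))"


section \<open>Moves\<close>

definition shift :: "nat \<Rightarrow> slice list \<Rightarrow> slice list" where
  "shift n L = map (\<lambda>(i, e). (n + i, e)) L"

fun in_width :: "piece \<Rightarrow> nat" where
  "in_width (Cup b) = 0"
| "in_width _ = 2"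

fun out_width :: "piece \<Rightarrow> nat" where
  "out_width Cap = 0"
| "out_width _ = 2"

text \<open>Effect of a quarter turn on a 4-valent piece.\<close>

fun quarter_turn :: "piece \<Rightarrow> piece" where
  "quarter_turn (Cross c) = Cross (\<not> c)"
| "quarter_turn (Mark m) = Mark (\<not> m)"
| "quarter_turn e = e"

definition four_valent :: "piece \<Rightarrow> bool" where
  "four_valent e \<longleftrightarrow> in_width e = 2 \<and> out_width e = 2"

text \<open>
  Replacement of a part \<open>L\<close> of a diagram by \<open>R\<close>, where \<open>L\<close> and \<open>R\<close> have the same oriented ends.
  The orientation parameters of the cups in \<open>L\<close> and \<open>R\<close> are pinned down by the conditions on \<open>run\<close>.
\<close>

definition local_change ::
  "(slice list \<Rightarrow> slice list \<Rightarrow> bool) \<Rightarrow> slice list \<Rightarrow> slice list \<Rightarrow> bool" where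
  "local_change mv D D' \<longleftrightarrow>
     (\<exists>A L R B n w w'. mv L R \<and> D = A @ shift n L @ B \<and> D' = A @ shift n R @ B \<and>
        run A [] = Some w \<and> run (shift n L) w = Some w' \<and> run (shift n R) w = Some w' \<and>
        run B w' = Some [])"

text \<open>
  Plane isotopy: cancellation of a minimum against a maximum, rotation of a crossing or vertex,
  and exchange of the heights of two distant pieces.
\<close>

inductive isotopy_move :: "slice list \<Rightarrow> slice list \<Rightarrow> bool" where
  cancel_right: "isotopy_move [(1, Cup b), (0, Cap)] []"
| cancel_left: "isotopy_move [(0, Cup b), (1, Cap)] []"
| rotate_cap: "four_valent e \<Longrightarrow>
    isotopy_move [(0, e), (1, Cap)] [(1, quarter_turn e), (0, Cap)]"
| rotate_cup: "four_valent e \<Longrightarrow>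
    isotopy_move [(1, Cup b), (0, e)] [(0, Cup b'), (1, quarter_turn e)]"
| exchange:
    "isotopy_move [(0, e), (out_width e + d, f)] [(in_width e + d, f), (0, e)]"

text \<open>
  All orientations of the strands are allowed. In the third move the side condition excludes
  exactly the triples in which each strand is over one of the other two and under the remaining
  one.
\<close>

inductive reidemeister_move :: "slice list \<Rightarrow> slice list \<Rightarrow> bool" where
  R1_right: "reidemeister_move [(1, Cup b), (0, Cross c), (1, Cap)] []"
| R1_left: "reidemeister_move [(0, Cup b), (1, Cross c), (0, Cap)] []"
| R2: "reidemeister_move [(0, Cross c), (0, Cross (\<not> c))] []"
| R3: "a = b \<or> b = c \<Longrightarrow>
    reidemeister_move [(0, Cross a), (1, Cross b), (0, Cross c)]
                      [(1, Cross c), (0, Cross b), (1, Cross a)]"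

inductive virtual_move :: "slice list \<Rightarrow> slice list \<Rightarrow> bool" where
  V1_right: "virtual_move [(1, Cup b), (0, Virt), (1, Cap)] []"
| V1_left: "virtual_move [(0, Cup b), (1, Virt), (0, Cap)] []"
| V2: "virtual_move [(0, Virt), (0, Virt)] []"
| V3: "virtual_move [(0, Virt), (1, Virt), (0, Virt)] [(1, Virt), (0, Virt), (1, Virt)]"
| V4_left: "virtual_move [(0, Virt), (1, Virt), (0, Cross c)] [(1, Cross c), (0, Virt), (1, Virt)]"
| V4_middle:
    "virtual_move [(0, Virt), (1, Cross c), (0, Virt)] [(1, Virt), (0, Cross c), (1, Virt)]"
| V4_right:
    "virtual_move [(0, Cross c), (1, Virt), (0, Virt)] [(1, Virt), (0, Virt), (1, Cross c)]"

text \<open>Two parallel strands crossing two others, the strands coming from the left being over iff \<open>c\<close>.\<close>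

definition double_crossing :: "bool \<Rightarrow> slice list" where
  "double_crossing c = [(1, Cross c), (0, Cross c), (2, Cross c), (1, Cross c)]"

text \<open>
  The Yoshikawa moves other than the Reidemeister moves. \<open>Y4\<close> moves a strand over or under a
  marked vertex, \<open>Y5\<close> flips a vertex, \<open>Y6\<close> (both marker types) cancels a vertex against a loop,
  \<open>Y7\<close> slides one band along another, and \<open>Y8\<close> passes two bands through each other.
  In \<open>Y7\<close> and \<open>Y8\<close> the two markers have to be perpendicular.
\<close>

inductive yoshikawa_move :: "slice list \<Rightarrow> slice list \<Rightarrow> bool" where
  Y4_left: "yoshikawa_move [(0, Cross c), (1, Cross c), (0, Mark m)]
                           [(1, Mark m), (0, Cross c), (1, Cross c)]"
| Y4_right: "yoshikawa_move [(1, Cross c), (0, Cross c), (1, Mark m)]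
                            [(0, Mark m), (1, Cross c), (0, Cross c)]"
| Y5: "yoshikawa_move [(0, Mark m), (0, Cross c)] [(0, Cross c), (0, Mark m)]"
| Y6_right: "yoshikawa_move [(1, Cup b), (0, Mark m), (1, Cap)] []"
| Y6_left: "yoshikawa_move [(0, Cup b), (1, Mark m), (0, Cap)] []"
| Y7: "yoshikawa_move [(0, Mark m), (1, Mark (\<not> m))] [(1, Mark (\<not> m)), (0, Mark m)]"
| Y8: "yoshikawa_move ([(0, Mark m), (2, Mark (\<not> m))] @ double_crossing c)
                      ([(0, Mark m), (2, Mark (\<not> m))] @ double_crossing (\<not> c))"

definition related_by ::
  "(slice list \<Rightarrow> bool) \<Rightarrow> (slice list \<Rightarrow> slice list \<Rightarrow> bool) \<Rightarrow> slice list \<Rightarrow> slice list \<Rightarrow> bool" where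
  "related_by K mv D D' \<longleftrightarrow>
     K D \<and> K D' \<and> equivclp (\<lambda>E E'. K E \<and> K E' \<and> local_change mv E E') D D'"

definition classical_link_equiv :: "slice list \<Rightarrow> slice list \<Rightarrow> bool" where
  "classical_link_equiv =
     related_by classical_diagram (\<lambda>L R. isotopy_move L R \<or> reidemeister_move L R)"

definition virtual_link_equiv :: "slice list \<Rightarrow> slice list \<Rightarrow> bool" where
  "virtual_link_equiv =
     related_by virtual_diagram
       (\<lambda>L R. isotopy_move L R \<or> reidemeister_move L R \<or> virtual_move L R)"

text \<open>
  The two resolutions of a marked graph diagram: \<open>resolve True\<close> smooths every vertex along its
  marker, \<open>resolve False\<close> across it. The list \<open>w\<close> holds the orientations below the diagram.
\<close>

fun resolve :: "bool \<Rightarrow> bool list \<Rightarrow> slice list \<Rightarrow> slice list" where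
  "resolve along w [] = []"
| "resolve along w ((i, e) # D) =
     (case e of
        Mark m \<Rightarrow> if m = along then [] else [(i, Cap), (i, Cup (w ! i))]
      | _ \<Rightarrow> [(i, e)])
     @ resolve along (the (run_slice (i, e) w)) D"

definition trivial_link :: "slice list \<Rightarrow> bool" where
  "trivial_link D \<longleftrightarrow>
     (\<exists>D'. classical_link_equiv D D' \<and> (\<forall>x\<in>set D'. snd x = Cap \<or> (\<exists>b. snd x = Cup b)))"

definition admissible :: "slice list \<Rightarrow> bool" where
  "admissible D \<longleftrightarrow>
     marked_graph_diagram D \<and> (\<forall>along. trivial_link (resolve along [] D))"

definition surface_link_equiv :: "slice list \<Rightarrow> slice list \<Rightarrow> bool" where
  "surface_link_equiv D D' \<longleftrightarrow>
     admissible D \<and> admissible D' \<and>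
     related_by marked_graph_diagram
       (\<lambda>L R. isotopy_move L R \<or> reidemeister_move L R \<or> yoshikawa_move L R) D D'"


section \<open>Semiarcs\<close>

text \<open>
  The horizontal level below the slice number \<open>l\<close> is level \<open>l\<close>; \<open>(l, p)\<close> is the point where strand
  number \<open>p\<close> meets it. A semiarc is represented by the set of its points.
\<close>

type_synonym point = "nat \<times> nat"

type_synonym semiarc = "point set"

definition level :: "slice list \<Rightarrow> nat \<Rightarrow> bool list" where
  "level D l = the (run (take l D) [])"

definition points :: "slice list \<Rightarrow> point set" where
  "points D = {(l, p). l \<le> length D \<and> p < length (level D l)}"

text \<open>Points joined within one slice without passing a classical crossing or a marked vertex.\<close>

definition joined :: "slice list \<Rightarrow> (point \<times> point) set" where
  "joined D =
     {((l, p), (l + 1, p)) | l p. l < length D \<and> p < fst (D ! l)}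
   \<union> {((l, p + in_width e), (l + 1, p + out_width e)) | l p i e.
        l < length D \<and> D ! l = (i, e) \<and> i \<le> p \<and> p + in_width e < length (level D l)}
   \<union> {((l + 1, i), (l + 1, i + 1)) | l i b. l < length D \<and> D ! l = (i, Cup b)}
   \<union> {((l, i), (l, i + 1)) | l i. l < length D \<and> D ! l = (i, Cap)}
   \<union> {((l, i), (l + 1, i + 1)) | l i. l < length D \<and> D ! l = (i, Virt)}
   \<union> {((l, i + 1), (l + 1, i)) | l i. l < length D \<and> D ! l = (i, Virt)}"

definition same_semiarc :: "slice list \<Rightarrow> (point \<times> point) set" where
  "same_semiarc D = (joined D \<union> (joined D)\<inverse>)\<^sup>* \<inter> points D \<times> points D"

definition semiarcs :: "slice list \<Rightarrow> semiarc set" where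
  "semiarcs D = points D // same_semiarc D"

definition semiarc_of :: "slice list \<Rightarrow> point \<Rightarrow> semiarc" where
  "semiarc_of D p = same_semiarc D `` {p}"

text \<open>
  For every classical crossing, the left and right semiarcs of the understrand followed by the
  left and right semiarcs of the overstrand, after rotating both strands to point upward.
  Rotation invariantly, the left-hand semiarc of a strand is the one to the left of the other
  strand. Below, \<open>\<alpha>\<close> is the strand joining SW and NE, \<open>\<beta>\<close> the strand joining SE and NW, and
  \<open>w ! i\<close>, \<open>w ! (i + 1)\<close> tell whether \<open>\<alpha>\<close>, \<open>\<beta>\<close> are directed upward.
\<close>

definition crossing_ends ::
  "slice list \<Rightarrow> nat \<Rightarrow> nat \<Rightarrow> bool \<Rightarrow> semiarc \<times> semiarc \<times> semiarc \<times> semiarc" where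
  "crossing_ends D l i c =
     (let sw = semiarc_of D (l, i); se = semiarc_of D (l, i + 1);
          nw = semiarc_of D (l + 1, i); ne = semiarc_of D (l + 1, i + 1);
          w = level D l;
          (\<alpha>_left, \<alpha>_right) = (if w ! (i + 1) then (sw, ne) else (ne, sw));
          (\<beta>_left, \<beta>_right) = (if w ! i then (nw, se) else (se, nw))
      in if c then (\<beta>_left, \<beta>_right, \<alpha>_left, \<alpha>_right) else (\<alpha>_left, \<alpha>_right, \<beta>_left, \<beta>_right))"

definition crossings :: "slice list \<Rightarrow> (semiarc \<times> semiarc \<times> semiarc \<times> semiarc) set" where
  "crossings D = {crossing_ends D l i c | l i c. l < length D \<and> D ! l = (i, Cross c)}"

definition marked_vertices :: "slice list \<Rightarrow> (semiarc \<times> semiarc \<times> semiarc \<times> semiarc) set" where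
  "marked_vertices D =
     {(semiarc_of D (l, i), semiarc_of D (l, i + 1),
       semiarc_of D (l + 1, i), semiarc_of D (l + 1, i + 1)) | l i m.
        l < length D \<and> D ! l = (i, Mark m)}"


section \<open>Biquandles and biquandle modules\<close>

text \<open>\<open>un x y\<close> and \<open>ov x y\<close> are the operations with underlined and overlined triangle.\<close>

definition biquandle :: "'a set \<Rightarrow> ('a \<Rightarrow> 'a \<Rightarrow> 'a) \<Rightarrow> ('a \<Rightarrow> 'a \<Rightarrow> 'a) \<Rightarrow> bool" where
  "biquandle X un ov \<longleftrightarrow>
     (\<forall>x\<in>X. \<forall>y\<in>X. un x y \<in> X \<and> ov x y \<in> X) \<and>
     (\<forall>x\<in>X. un x x = ov x x) \<and>
     (\<forall>y\<in>X. bij_betw (\<lambda>x. ov x y) X X \<and> bij_betw (\<lambda>x. un x y) X X) \<and>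
     bij_betw (\<lambda>(x, y). (ov y x, un x y)) (X \<times> X) (X \<times> X) \<and>
     (\<forall>x\<in>X. \<forall>y\<in>X. \<forall>z\<in>X.
        un (un x y) (un z y) = un (un x z) (ov y z) \<and>
        ov (un x y) (un z y) = un (ov x z) (ov y z) \<and>
        ov (ov x y) (ov z y) = ov (ov x z) (un y z))"

text \<open>Endomorphisms are extensional functions, so that each one is represented exactly once.\<close>

definition biquandle_End ::
  "'a set \<Rightarrow> ('a \<Rightarrow> 'a \<Rightarrow> 'a) \<Rightarrow> ('a \<Rightarrow> 'a \<Rightarrow> 'a) \<Rightarrow> ('a \<Rightarrow> 'a) set" where
  "biquandle_End X un ov =
     {\<sigma> \<in> X \<rightarrow>\<^sub>E X. \<forall>x\<in>X. \<forall>y\<in>X. \<sigma> (un x y) = un (\<sigma> x) (\<sigma> y) \<and> \<sigma> (ov x y) = ov (\<sigma> x) (\<sigma> y)}"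

text \<open>
  Commutative unital rings are rendered by the sort of \<open>comm_ring\<close> and \<open>comm_monoid_mult\<close>;
  \<open>comm_ring_1\<close> would exclude the zero ring.
\<close>

definition is_ring_unit :: "'k::{comm_ring, comm_monoid_mult} \<Rightarrow> bool" where
  "is_ring_unit a \<longleftrightarrow> (\<exists>b. a * b = 1)"

definition biquandle_module ::
  "'a set \<Rightarrow> ('a \<Rightarrow> 'a \<Rightarrow> 'a) \<Rightarrow> ('a \<Rightarrow> 'a \<Rightarrow> 'a) \<Rightarrow>
   ('a \<Rightarrow> 'a \<Rightarrow> 'k::{comm_ring, comm_monoid_mult}) \<Rightarrow> ('a \<Rightarrow> 'a \<Rightarrow> 'k) \<Rightarrow> ('a \<Rightarrow> 'a \<Rightarrow> 'k) \<Rightarrow> bool" where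
  "biquandle_module X un ov t s r \<longleftrightarrow>
     (\<forall>x\<in>X. t x x + s x x = r x x) \<and>
     (\<forall>x\<in>X. \<forall>y\<in>X. is_ring_unit (t x y) \<and> is_ring_unit (r x y)) \<and>
     (\<forall>x\<in>X. \<forall>y\<in>X. \<forall>z\<in>X.
        r (ov y x) (ov z x) * r x z = r (un x y) (ov z y) * r y z \<and>
        r (un x z) (un y z) * t y z = t (ov y x) (ov z x) * r x y \<and>
        r (un x z) (un y z) * s y z = s (ov y x) (ov z x) * r x z \<and>
        t (un x z) (un y z) * t x z = t (un x y) (ov z y) * t x y \<and>
        s (un x z) (un y z) * t y z = t (un x y) (ov z y) * s x y \<and>
        t (un x z) (un y z) * s x z + s (un x z) (un y z) * s y z = s (un x y) (ov z y) * r y z)"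


section \<open>Colorings and the quiver representation\<close>

definition colorings ::
  "'a set \<Rightarrow> ('a \<Rightarrow> 'a \<Rightarrow> 'a) \<Rightarrow> ('a \<Rightarrow> 'a \<Rightarrow> 'a) \<Rightarrow> slice list \<Rightarrow> (semiarc \<Rightarrow> 'a) set" where
  "colorings X un ov D =
     {v \<in> semiarcs D \<rightarrow>\<^sub>E X.
        (\<forall>(ul, ur, ol, orr)\<in>crossings D. v ur = un (v ul) (v ol) \<and> v orr = ov (v ol) (v ul)) \<and>
        (\<forall>(e1, e2, e3, e4)\<in>marked_vertices D. v e1 = v e2 \<and> v e2 = v e3 \<and> v e3 = v e4)}"

definition recolor :: "slice list \<Rightarrow> ('a \<Rightarrow> 'a) \<Rightarrow> (semiarc \<Rightarrow> 'a) \<Rightarrow> (semiarc \<Rightarrow> 'a)" where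
  "recolor D \<sigma> v = compose (semiarcs D) \<sigma> v"

definition image_subbiquandle ::
  "'a set \<Rightarrow> ('a \<Rightarrow> 'a \<Rightarrow> 'a) \<Rightarrow> ('a \<Rightarrow> 'a \<Rightarrow> 'a) \<Rightarrow> slice list \<Rightarrow> (semiarc \<Rightarrow> 'a) \<Rightarrow> 'a set" where
  "image_subbiquandle X un ov D v =
     \<Inter> {Y. Y \<subseteq> X \<and> biquandle Y un ov \<and> v ` semiarcs D \<subseteq> Y}"

text \<open>
  The module of functions from the semiarcs to the ring is represented by the functions on
  \<open>semiarc\<close> that vanish outside \<open>semiarcs D\<close>, with pointwise operations.
\<close>

definition bead_colorings ::
  "('a \<Rightarrow> 'a \<Rightarrow> 'k::{comm_ring, comm_monoid_mult}) \<Rightarrow> ('a \<Rightarrow> 'a \<Rightarrow> 'k) \<Rightarrow> ('a \<Rightarrow> 'a \<Rightarrow> 'k) \<Rightarrow>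
   slice list \<Rightarrow> (semiarc \<Rightarrow> 'a) \<Rightarrow> (semiarc \<Rightarrow> 'k) set" where
  "bead_colorings t s r D v =
     {f. (\<forall>e. e \<notin> semiarcs D \<longrightarrow> f e = 0) \<and>
         (\<forall>(ul, ur, ol, orr)\<in>crossings D.
            f ur = t (v ul) (v ol) * f ul + s (v ul) (v ol) * f ol \<and>
            f orr = r (v ul) (v ol) * f ol) \<and>
         (\<forall>(e1, e2, e3, e4)\<in>marked_vertices D. f e1 = f e2 \<and> f e2 = f e3 \<and> f e3 = f e4)}"

definition arrow_map ::
  "'a set \<Rightarrow> ('a \<Rightarrow> 'a \<Rightarrow> 'a) \<Rightarrow> ('a \<Rightarrow> 'a \<Rightarrow> 'a) \<Rightarrow>
   ('a \<Rightarrow> 'a \<Rightarrow> 'k::{comm_ring, comm_monoid_mult}) \<Rightarrow> ('a \<Rightarrow> 'a \<Rightarrow> 'k) \<Rightarrow> ('a \<Rightarrow> 'a \<Rightarrow> 'k) \<Rightarrow>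
   slice list \<Rightarrow> (semiarc \<Rightarrow> 'a) \<Rightarrow> ('a \<Rightarrow> 'a) \<Rightarrow> (semiarc \<Rightarrow> 'k) \<Rightarrow> (semiarc \<Rightarrow> 'k)" where
  "arrow_map X un ov t s r D v \<sigma> f =
     (if \<forall>x\<in>image_subbiquandle X un ov D v. \<forall>y\<in>image_subbiquandle X un ov D v.
           t x y = t (\<sigma> x) (\<sigma> y) \<and> s x y = s (\<sigma> x) (\<sigma> y) \<and> r x y = r (\<sigma> x) (\<sigma> y)
      then f else (\<lambda>_. 0))"

definition module_iso ::
  "(semiarc \<Rightarrow> 'k::{comm_ring, comm_monoid_mult}) set \<Rightarrow> (semiarc \<Rightarrow> 'k) set \<Rightarrow>
   ((semiarc \<Rightarrow> 'k) \<Rightarrow> (semiarc \<Rightarrow> 'k)) \<Rightarrow> bool" where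
  "module_iso M N \<theta> \<longleftrightarrow>
     bij_betw \<theta> M N \<and>
     (\<forall>f\<in>M. \<forall>g\<in>M. \<theta> (\<lambda>e. f e + g e) = (\<lambda>e. \<theta> f e + \<theta> g e)) \<and>
     (\<forall>a. \<forall>f\<in>M. \<theta> (\<lambda>e. a * f e) = (\<lambda>e. a * \<theta> f e))"

end

theory Submission
  imports Defs
begin

text \<open>
  The idea is to treat beads as part of the colors. A biquandle module over \<open>X\<close> with coefficients in \<open>k\<close>
  is the same as a biquandle structure on \<open>X \<times> k\<close> that is affine in the beads
  (\<open>biquandle_with_beads\<close>), and a bead coloring over \<open>v\<close> is a lift of \<open>v\<close> to a coloring by
  \<open>X \<times> k\<close> (\<open>colorings_with_beads\<close>). The theorem thus becomes a statement about colorings by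
  arbitrary biquandles: equivalent diagrams have naturally isomorphic coloring functors
  (\<open>link_equiv_naturally_isomorphic\<close>).

  Naturality supplies all parts of the quiver representation. The forgetful map \<open>X \<times> k \<rightarrow> X\<close> shows that
  bead colorings over \<open>v\<close> go to bead colorings over its image; addition \<open>X \<times> k \<times> k \<rightarrow> X \<times> k\<close> and
  multiplication by scalars give linearity; inclusions of subbiquandles show that the image subbiquandle
  of a coloring does not change; and an endomorphism that preserves the coefficients on the image
  subbiquandle extends to beads, which gives commutation with the arrows.

  For a single move, a coloring of the closed diagram is read level by level. Given the colors at the
  bottom and the top of the replaced part, both sides of the move admit a coloring in the same
  cases, and at most one (\<open>locally_equivalent\<close>). Keeping the colors outside and replacing the unique filling
  is a bijection whose description does not mention the biquandle, so it is natural.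

  The local statement rests on the fact that two adjacent ends of a crossing determine the other two. The
  first Reidemeister move follows from \<open>switch_diagonal\<close>. The third one is the exchange laws
  when all strands point upward; rotating the picture and conjugating by a crossing lead to all
  other orientations and crossing types (\<open>slides_always\<close>). When a strand passes a
  marked vertex or two bands pass through each other, strands are met in antiparallel pairs of equal
  color, and the two crossings with such a pair are mirror images.
\<close>

section \<open>The coloring rule at a crossing\<close>

text \<open>
  The coloring rule at a crossing, as a relation between the colors of its four ends. The strand
  \<open>\<alpha>\<close> joins \<open>sw\<close> to \<open>ne\<close> and is directed upward iff \<open>a\<close>; \<open>\<beta>\<close> joins \<open>se\<close> to \<open>nw\<close> and is directed
  upward iff \<open>b\<close>; \<open>\<alpha>\<close> is the overstrand iff \<open>c\<close>.
\<close>

definition crossing_rel ::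
  "('a \<Rightarrow> 'a \<Rightarrow> 'a) \<Rightarrow> ('a \<Rightarrow> 'a \<Rightarrow> 'a) \<Rightarrow> bool \<Rightarrow> bool \<Rightarrow> bool \<Rightarrow> 'a \<Rightarrow> 'a \<Rightarrow> 'a \<Rightarrow> 'a \<Rightarrow> bool" where
  "crossing_rel un ov c a b sw se nw ne \<longleftrightarrow>
     (let (\<alpha>l, \<alpha>r) = (if b then (sw, ne) else (ne, sw));
          (\<beta>l, \<beta>r) = (if a then (nw, se) else (se, nw))
      in if c then \<beta>r = un \<beta>l \<alpha>l \<and> \<alpha>r = ov \<alpha>l \<beta>l else \<alpha>r = un \<alpha>l \<beta>l \<and> \<beta>r = ov \<beta>l \<alpha>l)"

text \<open>
  The rule refers only to the two sides of each strand. It is therefore invariant under rotations, and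
  under reflections combined with the reversal of both strands, as each of these exchanges the
  sides. These symmetries replace most case distinctions on orientations below.
\<close>

lemma crossing_rel_quarter_turn:
  "crossing_rel un ov c a b sw se nw ne \<longleftrightarrow> crossing_rel un ov (\<not> c) b (\<not> a) se ne sw nw"
  by (auto simp: crossing_rel_def)

lemma crossing_rel_upside_down:
  "crossing_rel un ov c a b sw se nw ne \<longleftrightarrow> crossing_rel un ov (\<not> c) b a nw ne sw se"
  by (auto simp: crossing_rel_def)

text \<open>
  Reversing a strand exchanges the two sides of the other one. Hence a strand crossing two
  antiparallel strands of one color meets a crossing and then its mirror image.
\<close>

lemma crossing_rel_reverse_\<alpha>:
  "crossing_rel un ov c a b sw se nw ne \<longleftrightarrow> crossing_rel un ov c (\<not> a) b sw nw se ne"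
  by (auto simp: crossing_rel_def)

lemma crossing_rel_reverse_\<beta>:
  "crossing_rel un ov c a b sw se nw ne \<longleftrightarrow> crossing_rel un ov c a (\<not> b) ne se nw sw"
  by (auto simp: crossing_rel_def)

locale biquandle_on =
  fixes X :: "'a set" and un ov :: "'a \<Rightarrow> 'a \<Rightarrow> 'a"
  assumes bq: "biquandle X un ov"
begin

abbreviation "xrel \<equiv> crossing_rel un ov"

lemma un_closed: "x \<in> X \<Longrightarrow> y \<in> X \<Longrightarrow> un x y \<in> X"
  and ov_closed: "x \<in> X \<Longrightarrow> y \<in> X \<Longrightarrow> ov x y \<in> X"
  and diagonal: "x \<in> X \<Longrightarrow> un x x = ov x x"
  using bq unfolding biquandle_def by blast+

lemma un_inj: "un x y = un x' y \<Longrightarrow> x \<in> X \<Longrightarrow> x' \<in> X \<Longrightarrow> y \<in> X \<Longrightarrow> x = x'"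
  and un_surj: "z \<in> X \<Longrightarrow> y \<in> X \<Longrightarrow> \<exists>x\<in>X. z = un x y"
  and ov_inj: "ov x y = ov x' y \<Longrightarrow> x \<in> X \<Longrightarrow> x' \<in> X \<Longrightarrow> y \<in> X \<Longrightarrow> x = x'"
  and ov_surj: "z \<in> X \<Longrightarrow> y \<in> X \<Longrightarrow> \<exists>x\<in>X. z = ov x y"
proof -
  have bij: "bij_betw (\<lambda>x. un x y) X X" "bij_betw (\<lambda>x. ov x y) X X" if "y \<in> X" for y
    using bq that unfolding biquandle_def by blast+
  show "un x y = un x' y \<Longrightarrow> x \<in> X \<Longrightarrow> x' \<in> X \<Longrightarrow> y \<in> X \<Longrightarrow> x = x'"
    using bij(1)[of y] by (auto simp: bij_betw_def dest: inj_onD)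
  show "ov x y = ov x' y \<Longrightarrow> x \<in> X \<Longrightarrow> x' \<in> X \<Longrightarrow> y \<in> X \<Longrightarrow> x = x'"
    using bij(2)[of y] by (auto simp: bij_betw_def dest: inj_onD)
  show "z \<in> X \<Longrightarrow> y \<in> X \<Longrightarrow> \<exists>x\<in>X. z = un x y" "z \<in> X \<Longrightarrow> y \<in> X \<Longrightarrow> \<exists>x\<in>X. z = ov x y"
    using bij[of y] unfolding bij_betw_def by blast+
qed

lemma switch_inj:
  assumes "un x y = un x' y'" "ov y x = ov y' x'" "x \<in> X" "y \<in> X" "x' \<in> X" "y' \<in> X"
  shows "x = x' \<and> y = y'"
proof -
  have "inj_on (\<lambda>(x, y). (ov y x, un x y)) (X \<times> X)"
    using bq unfolding biquandle_def bij_betw_def by blast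
  from inj_onD[OF this, of "(x, y)" "(x', y')"] assms show ?thesis by simp
qed

lemma switch_surj:
  assumes "p \<in> X" "q \<in> X"
  shows "\<exists>x\<in>X. \<exists>y\<in>X. p = un x y \<and> q = ov y x"
proof -
  have "(\<lambda>(x, y). (ov y x, un x y)) ` (X \<times> X) = X \<times> X"
    using bq unfolding biquandle_def bij_betw_def by blast
  with assms have "(q, p) \<in> (\<lambda>(x, y). (ov y x, un x y)) ` (X \<times> X)" by simp
  thus ?thesis by auto
qed

lemma exchange1: "x \<in> X \<Longrightarrow> y \<in> X \<Longrightarrow> z \<in> X \<Longrightarrow> un (un x y) (un z y) = un (un x z) (ov y z)"
  and exchange2: "x \<in> X \<Longrightarrow> y \<in> X \<Longrightarrow> z \<in> X \<Longrightarrow> ov (un x y) (un z y) = un (ov x z) (ov y z)"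
  and exchange3: "x \<in> X \<Longrightarrow> y \<in> X \<Longrightarrow> z \<in> X \<Longrightarrow> ov (ov x y) (ov z y) = ov (ov x z) (un y z)"
  using bq unfolding biquandle_def by blast+

text \<open>
  This is what the first Reidemeister move needs. In a finite biquandle it follows by counting from
  the injectivity of the diagonal map, but the biquandles with beads used later may be infinite. The
  exchange laws at \<open>(p, x, p)\<close> and \<open>(x, p, x)\<close> show instead that \<open>p\<close> and \<open>x\<close> have the same square,
  and the switch map is injective.
\<close>

lemma switch_diagonal:
  assumes "un p x = ov x p" "p \<in> X" "x \<in> X"
  shows "p = x"
proof -
  define y where "y = un p x"
  have y: "y = un p x" "y = ov x p" "y \<in> X"
    using assms un_closed[of p x] by (auto simp: y_def)
  have "un (un p p) y = un y y"
    using exchange1[of p x p] assms y by metis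
  hence p: "un p p = y" using un_inj un_closed y assms by metis
  have "ov (ov x x) y = ov y y"
    using exchange3[of x p x] assms y by metis
  hence x: "ov x x = y" using ov_inj ov_closed y assms by metis
  show ?thesis
    using switch_inj[of p p x x] p x diagonal[of p] diagonal[of x] assms by metis
qed

lemma diagonal_surj: "y \<in> X \<Longrightarrow> \<exists>x\<in>X. y = un x x"
  using switch_surj[of y y] switch_diagonal by metis

lemma diagonal_inj: "un x x = un y y \<Longrightarrow> x \<in> X \<Longrightarrow> y \<in> X \<Longrightarrow> x = y"
  using switch_inj[of x x y y] diagonal by metis

text \<open>
  Two adjacent ends of a crossing determine the other two: depending on the orientations this is
  the bijectivity of one of the operations or of the switch map. By rotation it is enough to go
  from bottom to top.
\<close>

lemma crossing_up_ex:
  assumes "x \<in> X" "y \<in> X"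
  shows "\<exists>p\<in>X. \<exists>q\<in>X. xrel c a b x y p q"
proof -
  note facts = un_closed ov_closed un_surj[of x y] un_surj[of y x] ov_surj[of x y] ov_surj[of y x]
    switch_surj[of x y] switch_surj[of y x]
  show ?thesis
    by (cases a; cases b; cases c; simp add: crossing_rel_def; use assms facts in blast)
qed

lemma crossing_up_unique:
  assumes "xrel c a b x y p q" "xrel c a b x y p' q'"
    "x \<in> X" "y \<in> X" "p \<in> X" "q \<in> X" "p' \<in> X" "q' \<in> X"
  shows "p = p' \<and> q = q'"
  using assms
  by (cases a; cases b; cases c; simp add: crossing_rel_def; metis un_inj ov_inj switch_inj)

lemma crossing_down_ex:
  assumes "p \<in> X" "q \<in> X"
  shows "\<exists>x\<in>X. \<exists>y\<in>X. xrel c a b x y p q"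
  using crossing_up_ex[OF assms] crossing_rel_upside_down by metis

lemma crossing_down_unique:
  assumes "xrel c a b x y p q" "xrel c a b x' y' p q"
    "x \<in> X" "y \<in> X" "p \<in> X" "q \<in> X" "x' \<in> X" "y' \<in> X"
  shows "x = x' \<and> y = y'"
  using assms crossing_up_unique crossing_rel_upside_down by metis

lemma crossing_left_unique:
  assumes "xrel c a b x y p q" "xrel c a b x' y p' q"
    "x \<in> X" "y \<in> X" "p \<in> X" "q \<in> X" "x' \<in> X" "p' \<in> X"
  shows "x = x' \<and> p = p'"
  using assms crossing_up_unique crossing_rel_quarter_turn by metis

lemma crossing_right_unique:
  assumes "xrel c a b x y p q" "xrel c a b x y' p q'"
    "x \<in> X" "y \<in> X" "p \<in> X" "q \<in> X" "y' \<in> X" "q' \<in> X"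
  shows "y = y' \<and> q = q'"
  using assms crossing_down_unique crossing_rel_quarter_turn by metis

lemma kink_unique:
  assumes "xrel c a a x y p y" "x \<in> X" "y \<in> X" "p \<in> X"
  shows "p = x"
  using assms by (cases a; cases c; simp add: crossing_rel_def; metis switch_diagonal diagonal)

section \<open>The third Reidemeister move\<close>

text \<open>
  The two sides of the third Reidemeister move as relations between the bottom colors \<open>x\<close>, \<open>y\<close>, \<open>z\<close>
  and the top colors \<open>m\<close>, \<open>n\<close>, \<open>v\<close>. Strand \<open>j\<close> counts from the left at the bottom and is directed
  upward iff \<open>wj\<close>; the booleans \<open>a\<close>, \<open>b\<close>, \<open>c\<close> belong to the pairs 12, 13, 23 of strands.
\<close>

definition lower_triangle where
  "lower_triangle a b c w1 w2 w3 x y z m n v \<longleftrightarrow>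
     (\<exists>p\<in>X. \<exists>q\<in>X. \<exists>u\<in>X. xrel a w1 w2 x y p q \<and> xrel b w1 w3 q z u v \<and> xrel c w2 w3 p u m n)"

definition upper_triangle where
  "upper_triangle a b c w1 w2 w3 x y z m n v \<longleftrightarrow>
     (\<exists>p\<in>X. \<exists>q\<in>X. \<exists>u\<in>X. xrel c w2 w3 y z p q \<and> xrel b w1 w3 x p m u \<and> xrel a w1 w2 u q n v)"

definition slides where
  "slides a b c w1 w2 w3 \<longleftrightarrow>
     (\<forall>x\<in>X. \<forall>y\<in>X. \<forall>z\<in>X. \<forall>m\<in>X. \<forall>n\<in>X. \<forall>v\<in>X.
        lower_triangle a b c w1 w2 w3 x y z m n v \<longleftrightarrow> upper_triangle a b c w1 w2 w3 x y z m n v)"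

text \<open>
  With all strands directed upward and this type of crossings, the outer ends of the lower triangle are
  expressed by \<open>x\<close>, \<open>m\<close> and the color \<open>p\<close> of the middle part of strand 2. That they fit the
  upper triangle is the content of the three exchange laws.
\<close>

lemma slides_all_up: "slides False False False True True True"
proof -
  have "(\<exists>p\<in>X. \<exists>q\<in>X. \<exists>u\<in>X. (q = un x p \<and> y = ov p x) \<and> (v = un q u \<and> z = ov u q) \<and>
           (n = un p m \<and> u = ov m p)) \<longleftrightarrow>
        (\<exists>p\<in>X. \<exists>q\<in>X. \<exists>u\<in>X. (q = un y p \<and> z = ov p y) \<and> (u = un x m \<and> p = ov m x) \<and>
           (v = un u n \<and> q = ov n u))" (is "?L \<longleftrightarrow> ?R")
    if X: "x \<in> X" "y \<in> X" "z \<in> X" "m \<in> X" "n \<in> X" "v \<in> X" for x y z m n v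
  proof
    assume ?L
    then obtain p where p: "p \<in> X" "y = ov p x" "v = un (un x p) (ov m p)"
      "z = ov (ov m p) (un x p)" "n = un p m" by blast
    have "un y (ov m x) = ov n (un x m)" "z = ov (ov m x) y" "v = un (un x m) n"
      using p exchange2[of p m x] exchange3[of m x p] exchange1[of x m p] X by simp_all
    moreover have "ov m x \<in> X" "un y (ov m x) \<in> X" "un x m \<in> X"
      using X un_closed ov_closed by auto
    ultimately show ?R using X by blast
  next
    assume ?R
    then have R: "un y (ov m x) = ov n (un x m)" "z = ov (ov m x) y" "v = un (un x m) n" by auto
    obtain p where p: "p \<in> X" "n = un p m" using un_surj X by blast
    have "un (ov p x) (ov m x) = un y (ov m x)"
      using R(1) exchange2[of p m x] p X by simp
    hence y: "y = ov p x" using un_inj ov_closed X p by metis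
    have "v = un (un x p) (ov m p)" "z = ov (ov m p) (un x p)"
      using p y R exchange3[of m x p] exchange1[of x m p] X by simp_all
    moreover have "ov m p \<in> X" "un x p \<in> X" using X p un_closed ov_closed by auto
    ultimately show ?L using p y by blast
  qed
  thus ?thesis
    by (simp add: slides_def lower_triangle_def upper_triangle_def crossing_rel_def)
qed

text \<open>
  Turning the six boundary points of a triangle by one step exchanges the two sides of the move: strand
  1 becomes the third strand, with reversed direction.
\<close>

lemma lower_triangle_rotate:
  "lower_triangle a b c w1 w2 w3 x y z m n v =
   upper_triangle c (\<not> a) (\<not> b) w2 w3 (\<not> w1) y z v x m n"
  unfolding lower_triangle_def upper_triangle_def
  by (simp only: crossing_rel_quarter_turn[of un ov a w1 w2]
      crossing_rel_quarter_turn[of un ov b w1 w3]) blast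

lemma upper_triangle_rotate:
  "upper_triangle a b c w1 w2 w3 x y z m n v =
   lower_triangle c (\<not> a) (\<not> b) w2 w3 (\<not> w1) y z v x m n"
  unfolding lower_triangle_def upper_triangle_def
  by (simp only: crossing_rel_quarter_turn[of un ov a w1 w2]
      crossing_rel_quarter_turn[of un ov b w1 w3]) blast

lemma slides_rotate:
  "slides a b c w1 w2 w3 \<longleftrightarrow> slides c (\<not> a) (\<not> b) w2 w3 (\<not> w1)"
  unfolding slides_def lower_triangle_rotate[of a b c w1 w2 w3]
    upper_triangle_rotate[of a b c w1 w2 w3] by blast

text \<open>
  Compose both sides of the move with the inverse crossing of strands 1 and 2, below and above.
  After cancelling by uniqueness at these crossings, the two sides have exchanged their roles and the
  strands 1 and 2 their places. This reaches the orientations in which the triangle is coherently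
  directed, which no rotation of the upward case reaches.
\<close>

lemma slides_swap_left:
  assumes "slides a b c w1 w2 w3"
  shows "slides (\<not> a) c b w2 w1 w3"
  unfolding slides_def
proof (intro ballI)
  fix x y z m n v assume X: "x \<in> X" "y \<in> X" "z \<in> X" "m \<in> X" "n \<in> X" "v \<in> X"
  \<comment> \<open>the inverse crossing of strands 1 and 2, attached at the bottom and at the top\<close>
  obtain x' y' where xy: "x' \<in> X" "y' \<in> X" "xrel a w1 w2 x' y' x y"
    using crossing_down_ex X by metis
  obtain n' v' where nv: "n' \<in> X" "v' \<in> X" "xrel a w1 w2 n v n' v'"
    using crossing_up_ex X by metis
  have xy': "xrel (\<not> a) w2 w1 x y x' y'" and nv': "xrel (\<not> a) w2 w1 n' v' n v"
    using xy nv crossing_rel_upside_down by metis+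
  have "lower_triangle (\<not> a) c b w2 w1 w3 x y z m n v \<longleftrightarrow>
      (\<exists>u\<in>X. xrel c w2 w3 y' z u v \<and> xrel b w1 w3 x' u m n)"
    unfolding lower_triangle_def using crossing_up_unique[OF xy'] xy xy' X by metis
  also have "\<dots> \<longleftrightarrow> upper_triangle a b c w1 w2 w3 x' y' z m n' v'"
    unfolding upper_triangle_def using crossing_down_unique[OF nv(3)] nv X by metis
  also have "\<dots> \<longleftrightarrow> lower_triangle a b c w1 w2 w3 x' y' z m n' v'"
    using assms X xy nv unfolding slides_def by blast
  also have "\<dots> \<longleftrightarrow> (\<exists>u\<in>X. xrel b w1 w3 y z u v' \<and> xrel c w2 w3 x u m n')"
    unfolding lower_triangle_def using crossing_up_unique[OF xy(3)] xy X by metis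
  also have "\<dots> \<longleftrightarrow> upper_triangle (\<not> a) c b w2 w1 w3 x y z m n v"
    unfolding upper_triangle_def using crossing_down_unique[OF nv'] nv nv' X by metis
  finally show "lower_triangle (\<not> a) c b w2 w1 w3 x y z m n v =
    upper_triangle (\<not> a) c b w2 w1 w3 x y z m n v" .
qed

text \<open>
  The same for strands 2 and 3, obtained by rotating, swapping and rotating back.
\<close>

lemma slides_swap_right:
  "slides a b c w1 w2 w3 \<Longrightarrow> slides b a (\<not> c) w1 w3 w2"
  using slides_swap_left[of c "\<not> a" "\<not> b" w2 w3 "\<not> w1"] slides_rotate by simp

lemma slides_upwards:
  assumes "a = b \<or> b = c"
  shows "slides a b c True True True"
proof -
  have FFF: "slides False False False True True True" by (rule slides_all_up)
  have TFF: "slides True False False True True True" using slides_swap_left[OF FFF] by simp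
  have FFT: "slides False False True True True True" using slides_swap_right[OF FFF] by simp
  have FTT: "slides False True True True True True" using slides_swap_right[OF TFF] by simp
  have TTF: "slides True True False True True True" using slides_swap_left[OF FFT] by simp
  have TTT: "slides True True True True True True" using slides_swap_right[OF TTF] by simp
  show ?thesis using assms FFF TFF FFT FTT TTF TTT by (cases a; cases b; cases c; simp)
qed

text \<open>
  Rotation takes the upward orientation through the six orientations that are not alternating; a
  swap leads from there to the two alternating ones, which rotation exchanges.
\<close>

lemma slides_always:
  assumes "a = b \<or> b = c"
  shows "slides a b c w1 w2 w3"
proof -
  \<comment> \<open>rotation preserves the set of admissible triples \<open>a\<close>, \<open>b\<close>, \<open>c\<close>\<close>
  have rot: "slides a b c w1 w2 w3"
    if "\<And>a b c. a = b \<or> b = c \<Longrightarrow> slides a b c w2 w3 (\<not> w1)" "a = b \<or> b = c"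
    for a b c w1 w2 w3
    using that(1)[of c "\<not> a" "\<not> b"] that(2) slides_rotate[of a b c w1 w2 w3] by auto
  note TTT = slides_upwards
  have FTT: "slides a b c False True True" if "a = b \<or> b = c" for a b c
    by (rule rot) (use TTT that in auto)
  have FFT: "slides a b c False False True" if "a = b \<or> b = c" for a b c
    by (rule rot) (use FTT that in auto)
  have FFF: "slides a b c False False False" if "a = b \<or> b = c" for a b c
    by (rule rot) (use FFT that in auto)
  have TFF: "slides a b c True False False" if "a = b \<or> b = c" for a b c
    by (rule rot) (use FFF that in auto)
  have TTF: "slides a b c True True False" if "a = b \<or> b = c" for a b c
    by (rule rot) (use TFF that in auto)
  have TFT: "slides a b c True False True" if "a = b \<or> b = c" for a b c
    using slides_swap_right[OF TTF[of b a "\<not> c"]] that by auto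
  have FTF: "slides a b c False True False" if "a = b \<or> b = c" for a b c
    by (rule rot) (use TFT that in auto)
  show ?thesis
    using assms TTT FTT FFT FFF TFF TTF TFT FTF by (cases w1; cases w2; cases w3; simp)
qed

section \<open>Kinks and marked vertices\<close>

text \<open>
  The color of the loop of a kink is either the square of the strand color or its inverse under
  squaring, depending on the direction.
\<close>

lemma kink_ex:
  assumes "x \<in> X"
  shows "\<exists>y\<in>X. xrel c a a x y x y"
  using assms diagonal diagonal_surj[of x] un_closed[of x x]
  by (cases a; cases c; simp add: crossing_rel_def; metis)

lemma kink_loop_unique:
  assumes "xrel c a a x y x y" "xrel c a a x y' x y'" "x \<in> X" "y \<in> X" "y' \<in> X"
  shows "y = y'"
  using assms diagonal_inj[of y y'] by (cases a; cases c; simp add: crossing_rel_def)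

text \<open>
  A strand crosses two antiparallel strands on its way past a marked vertex. Their colors agree on
  one side of the strand iff they agree on the other, since the second crossing is the mirror image
  of the first.
\<close>

lemma parallel_strands_left:
  assumes "xrel c a b x y p q" "xrel c a (\<not> b) q z u v"
    and "x \<in> X" "y \<in> X" "p \<in> X" "q \<in> X" "z \<in> X" "u \<in> X" "v \<in> X"
  shows "y = z \<longleftrightarrow> p = u"
  using assms crossing_rel_reverse_\<beta>[of un ov c a "\<not> b" q z u v]
    crossing_left_unique[of c a b x y p q v u] crossing_down_unique[of c a b x y p q v z]
  by auto

lemma parallel_strands_right:
  assumes "xrel c a b x y p q" "xrel c (\<not> a) b z p m u"
    and "x \<in> X" "y \<in> X" "p \<in> X" "q \<in> X" "z \<in> X" "u \<in> X" "m \<in> X"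
  shows "x = z \<longleftrightarrow> q = u"
  using assms crossing_rel_reverse_\<alpha>[of un ov c "\<not> a" b z p m u]
    crossing_right_unique[of c a b x y p q m u] crossing_down_unique[of c a b x y p q z m]
  by auto

text \<open>
  Antiparallel strands that have the same color before they cross have a common color, possibly another one,
  afterwards; this is again the diagonal property.
\<close>

lemma vertex_flip:
  assumes "xrel c a (\<not> a) x y p q" "x \<in> X" "y \<in> X" "p \<in> X" "q \<in> X"
  shows "x = y \<longleftrightarrow> p = q"
  using assms by (cases a; cases c; simp add: crossing_rel_def; metis switch_diagonal diagonal)

end

section \<open>Colored runs\<close>

text \<open>
  A coloring is read from bottom to top as a sequence of lists of colors, one list for each level. In
  contrast to semiarcs, levels decompose along slices, so a local move can be studied in isolation.
\<close>

fun step :: "('a \<Rightarrow> 'a \<Rightarrow> 'a) \<Rightarrow> ('a \<Rightarrow> 'a \<Rightarrow> 'a) \<Rightarrow> slice \<Rightarrow> bool list \<Rightarrow> 'a list \<Rightarrow> 'a list \<Rightarrow> bool" where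
  "step un ov (i, Cup b) w xs ys \<longleftrightarrow> (\<exists>x. ys = take i xs @ [x, x] @ drop i xs)"
| "step un ov (i, Cap) w xs ys \<longleftrightarrow> xs ! i = xs ! (i + 1) \<and> ys = take i xs @ drop (i + 2) xs"
| "step un ov (i, Cross c) w xs ys \<longleftrightarrow>
     (\<exists>p q. crossing_rel un ov c (w ! i) (w ! (i + 1)) (xs ! i) (xs ! (i + 1)) p q \<and>
        ys = xs[i := p, i + 1 := q])"
| "step un ov (i, Virt) w xs ys \<longleftrightarrow> ys = xs[i := xs ! (i + 1), i + 1 := xs ! i]"
| "step un ov (i, Mark m) w xs ys \<longleftrightarrow> xs ! i = xs ! (i + 1) \<and> ys = xs"

text \<open>
  The lists \<open>css\<close> are the levels above the slices; the bottom level \<open>xs\<close> is not among them, so that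
  runs of stacked tangles concatenate.
\<close>

fun colored_run ::
  "'a set \<Rightarrow> ('a \<Rightarrow> 'a \<Rightarrow> 'a) \<Rightarrow> ('a \<Rightarrow> 'a \<Rightarrow> 'a) \<Rightarrow> slice list \<Rightarrow> bool list \<Rightarrow>
   'a list \<Rightarrow> 'a list list \<Rightarrow> 'a list \<Rightarrow> bool" where
  "colored_run X un ov [] w xs css ys \<longleftrightarrow> css = [] \<and> ys = xs"
| "colored_run X un ov (x # D) w xs css ys \<longleftrightarrow>
     (\<exists>zs css'. css = zs # css' \<and> set zs \<subseteq> X \<and> step un ov x w xs zs \<and>
        colored_run X un ov D (the (run_slice x w)) zs css' ys)"

lemma step_length:
  assumes "step un ov x w xs ys" "run_slice x w = Some w'" "length xs = length w"
  shows "length ys = length w'"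
proof (cases x)
  case (Pair i e)
  with assms show ?thesis by (cases e) (auto split: if_splits)
qed

lemma run_append: "run (A @ B) w = Option.bind (run A w) (run B)"
  by (induction A arbitrary: w) (auto split: bind_splits)

lemma colored_run_length:
  "colored_run X un ov D w xs css ys \<Longrightarrow> run D w = Some w' \<Longrightarrow> length xs = length w \<Longrightarrow>
   length css = length D \<and> length ys = length w'"
  by (induction D arbitrary: w xs css) (auto split: bind_splits dest!: step_length)

lemma colored_run_closed:
  "colored_run X un ov D w xs css ys \<Longrightarrow> set xs \<subseteq> X \<Longrightarrow> set ys \<subseteq> X"
  by (induction D arbitrary: w xs css) auto

lemma colored_run_append:
  assumes "run A w = Some w'"
  shows "colored_run X un ov (A @ B) w xs css ys \<longleftrightarrow>
    (\<exists>css1 css2 zs. css = css1 @ css2 \<and> colored_run X un ov A w xs css1 zs \<and>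
       colored_run X un ov B w' zs css2 ys)"
  using assms
proof (induction A arbitrary: w xs css)
  case Nil
  thus ?case by auto
next
  case (Cons x A)
  then obtain w1 where "run_slice x w = Some w1" "run A w1 = Some w'"
    by (auto split: bind_splits)
  with Cons.IH[of w1] have "colored_run X un ov ((x # A) @ B) w xs css ys \<longleftrightarrow>
    (\<exists>cs css1 css2 zs. css = cs # css1 @ css2 \<and> set cs \<subseteq> X \<and> step un ov x w xs cs \<and>
       colored_run X un ov A w1 cs css1 zs \<and> colored_run X un ov B w' zs css2 ys)"
    by simp blast
  also have "\<dots> \<longleftrightarrow> (\<exists>css1 css2 zs. css = css1 @ css2 \<and>
      colored_run X un ov (x # A) w xs css1 zs \<and> colored_run X un ov B w' zs css2 ys)"
    using \<open>run_slice x w = Some w1\<close> by simp (metis append_Cons)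
  finally show ?case .
qed

fun fits :: "nat \<Rightarrow> slice list \<Rightarrow> bool" where
  "fits m [] \<longleftrightarrow> True"
| "fits m ((i, e) # L) \<longleftrightarrow> i + in_width e \<le> m \<and> fits (m + out_width e - in_width e) L"

lemma run_slice_length:
  "run_slice (i, e) w = Some w' \<Longrightarrow> length w' = length w + out_width e - in_width e"
  by (cases e) (auto split: if_splits)

lemma run_slice_frame:
  assumes "i + in_width e \<le> length w"
  shows "run_slice (length u + i, e) (u @ w @ v) = map_option (\<lambda>w'. u @ w' @ v) (run_slice (i, e) w)"
  using assms by (cases e) (auto simp: nth_append list_update_append)

lemma run_frame:
  assumes "fits (length w) L"
  shows "run (shift (length u) L) (u @ w @ v) = map_option (\<lambda>w'. u @ w' @ v) (run L w)"
  using assms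
proof (induction L arbitrary: w)
  case Nil
  thus ?case by (simp add: shift_def)
next
  case (Cons x L)
  obtain i e where x: "x = (i, e)" by fastforce
  show ?case
  proof (cases "run_slice (i, e) w")
    case None
    thus ?thesis using Cons.prems x run_slice_frame[of i e w u v] by (simp add: shift_def)
  next
    case (Some w1)
    have "fits (length w1) L" using Cons.prems x run_slice_length[OF Some] by simp
    thus ?thesis
      using Cons.prems Cons.IH[of w1] x run_slice_frame[of i e w u v] Some
      by (simp add: shift_def)
  qed
qed

lemma step_frame:
  assumes "i + in_width e \<le> length w" "length xs = length w" "length ps = length u"
  shows "step un ov (length u + i, e) (u @ w @ v) (ps @ xs @ qs) zs \<longleftrightarrow>
    (\<exists>ys. zs = ps @ ys @ qs \<and> step un ov (i, e) w xs ys)"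
  using assms by (cases e) (auto simp: nth_append list_update_append)

text \<open>
  Strands to the left and right of a tangle keep their colors. A move performed inside a large diagram is
  thereby reduced to the same move on its own strands.
\<close>

lemma colored_run_frame:
  assumes "fits (length w) L" "run L w = Some w'" "length xs = length w"
    "length ps = length u" "set ps \<subseteq> X" "set qs \<subseteq> X"
  shows "colored_run X un ov (shift (length u) L) (u @ w @ v) (ps @ xs @ qs) css zs \<longleftrightarrow>
    (\<exists>css' ys. css = map (\<lambda>y. ps @ y @ qs) css' \<and> zs = ps @ ys @ qs \<and>
       colored_run X un ov L w xs css' ys)"
  using assms
proof (induction L arbitrary: w xs css)
  case Nil
  thus ?case by (auto simp: shift_def)
next
  case (Cons x L)
  obtain i e where x: "x = (i, e)" by fastforce
  obtain w1 where w1: "run_slice (i, e) w = Some w1" "run L w1 = Some w'"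
    using Cons.prems x by (auto split: bind_splits)
  have fit: "i + in_width e \<le> length w" "fits (length w1) L"
    using Cons.prems x run_slice_length[OF w1(1)] by auto
  have IH: "colored_run X un ov (shift (length u) L) (u @ w1 @ v) (ps @ ys @ qs) css zs \<longleftrightarrow>
    (\<exists>css' ys'. css = map (\<lambda>y. ps @ y @ qs) css' \<and> zs = ps @ ys' @ qs \<and>
       colored_run X un ov L w1 ys css' ys')" if "step un ov (i, e) w xs ys" for ys css
    using Cons.IH[OF fit(2) w1(2)] step_length[OF that w1(1)] Cons.prems by simp
  have run1: "run_slice (length u + i, e) (u @ w @ v) = Some (u @ w1 @ v)"
    using run_slice_frame[OF fit(1)] w1 by simp
  have shift: "shift (length u) (x # L) = (length u + i, e) # shift (length u) L"
    by (simp add: shift_def x)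
  have "colored_run X un ov (shift (length u) (x # L)) (u @ w @ v) (ps @ xs @ qs) css zs \<longleftrightarrow>
    (\<exists>ys css'. css = (ps @ ys @ qs) # css' \<and> set ys \<subseteq> X \<and> step un ov (i, e) w xs ys \<and>
       colored_run X un ov (shift (length u) L) (u @ w1 @ v) (ps @ ys @ qs) css' zs)"
    unfolding shift using Cons.prems fit
    by (simp add: run1 step_frame) (auto simp: run1)
  also have "\<dots> \<longleftrightarrow> (\<exists>css' ys. css = map (\<lambda>y. ps @ y @ qs) css' \<and> zs = ps @ ys @ qs \<and>
       colored_run X un ov (x # L) w xs css' ys)"
    (is "?A \<longleftrightarrow> ?B")
  proof
    assume ?A
    then obtain ys css' where 1: "css = (ps @ ys @ qs) # css'" "set ys \<subseteq> X" "step un ov (i, e) w xs ys"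
      "colored_run X un ov (shift (length u) L) (u @ w1 @ v) (ps @ ys @ qs) css' zs" by blast
    with IH obtain cs ys' where 2: "css' = map (\<lambda>y. ps @ y @ qs) cs" "zs = ps @ ys' @ qs"
       "colored_run X un ov L w1 ys cs ys'" by blast
    show ?B
      by (rule exI[of _ "ys # cs"], rule exI[of _ ys']) (use 1 2 x w1 in simp)
  next
    assume ?B
    then obtain ys cs ys' where "css = map (\<lambda>y. ps @ y @ qs) (ys # cs)" "zs = ps @ ys' @ qs"
      "set ys \<subseteq> X" "step un ov (i, e) w xs ys" "colored_run X un ov L w1 ys cs ys'"
      using x w1 by auto
    thus ?A using IH by auto
  qed
  finally show ?case .
qed

context biquandle_on begin

section \<open>Fillings of tangles\<close>

abbreviation "crun \<equiv> colored_run X un ov"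

text \<open>
  With prescribed colors at the bottom and the top, the two tangles can be colored in the same cases, and in
  at most one way. Uniqueness is what later makes the bijection of colorings natural and linear
  without a formula for it.
\<close>

definition same_fillings where
  "same_fillings L R w \<longleftrightarrow>
     (\<forall>xs ys. length xs = length w \<longrightarrow> set xs \<subseteq> X \<longrightarrow>
        ((\<exists>css. crun L w xs css ys) \<longleftrightarrow> (\<exists>css. crun R w xs css ys)) \<and>
        (\<forall>css css'. crun L w xs css ys \<longrightarrow> crun L w xs css' ys \<longrightarrow> css = css') \<and>
        (\<forall>css css'. crun R w xs css ys \<longrightarrow> crun R w xs css' ys \<longrightarrow> css = css'))"

lemma same_fillingsI:
  assumes "\<And>xs ys css. length xs = length w \<Longrightarrow> set xs \<subseteq> X \<Longrightarrow> crun L w xs css ys \<Longrightarrow>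
      \<exists>css. crun R w xs css ys"
    and "\<And>xs ys css. length xs = length w \<Longrightarrow> set xs \<subseteq> X \<Longrightarrow> crun R w xs css ys \<Longrightarrow>
      \<exists>css. crun L w xs css ys"
    and "\<And>xs ys css css'. length xs = length w \<Longrightarrow> set xs \<subseteq> X \<Longrightarrow>
      crun L w xs css ys \<Longrightarrow> crun L w xs css' ys \<Longrightarrow> css = css'"
    and "\<And>xs ys css css'. length xs = length w \<Longrightarrow> set xs \<subseteq> X \<Longrightarrow>
      crun R w xs css ys \<Longrightarrow> crun R w xs css' ys \<Longrightarrow> css = css'"
  shows "same_fillings L R w"
  using assms unfolding same_fillings_def by blast

lemma doubleton_conv: "length w = 2 \<longleftrightarrow> (\<exists>x y. w = [x, y])"
  and tripleton_conv: "length w = 3 \<longleftrightarrow> (\<exists>x y z. w = [x, y, z])"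
  by (auto simp: length_Suc_conv eval_nat_numeral)

lemma crun_Cup:
  assumes "i \<le> length w" "set xs \<subseteq> X"
  shows "crun ((i, Cup b) # L) w xs css ys \<longleftrightarrow>
    (\<exists>x\<in>X. \<exists>css'. css = (take i xs @ [x, x] @ drop i xs) # css' \<and>
      crun L (take i w @ [b, \<not> b] @ drop i w) (take i xs @ [x, x] @ drop i xs) css' ys)"
  using assms set_take_subset[of i xs] set_drop_subset[of i xs] by fastforce

lemma crun_Cap:
  assumes "i + 1 < length w" "w ! i \<noteq> w ! (i + 1)" "set xs \<subseteq> X"
  shows "crun ((i, Cap) # L) w xs css ys \<longleftrightarrow> xs ! i = xs ! (i + 1) \<and>
    (\<exists>css'. css = (take i xs @ drop (i + 2) xs) # css' \<and>
      crun L (take i w @ drop (i + 2) w) (take i xs @ drop (i + 2) xs) css' ys)"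
  using assms set_take_subset[of i xs] set_drop_subset[of "i + 2" xs] by fastforce

lemma crun_Cross:
  assumes "i + 1 < length w" "set xs \<subseteq> X" "length xs = length w"
  shows "crun ((i, Cross c) # L) w xs css ys \<longleftrightarrow>
    (\<exists>p\<in>X. \<exists>q\<in>X. xrel c (w ! i) (w ! (i + 1)) (xs ! i) (xs ! (i + 1)) p q \<and>
      (\<exists>css'. css = xs[i := p, i + 1 := q] # css' \<and>
        crun L (w[i := w ! (i + 1), i + 1 := w ! i]) (xs[i := p, i + 1 := q]) css' ys))"
proof -
  have "set (xs[i := p, i + 1 := q]) \<subseteq> X \<longleftrightarrow> p \<in> X \<and> q \<in> X" for p q
  proof
    assume *: "set (xs[i := p, i + 1 := q]) \<subseteq> X"
    have "xs[i := p, i + 1 := q] ! i = p" "xs[i := p, i + 1 := q] ! (i + 1) = q"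
      using assms by auto
    moreover have "i < length (xs[i := p, i + 1 := q])" "i + 1 < length (xs[i := p, i + 1 := q])"
      using assms by auto
    ultimately show "p \<in> X \<and> q \<in> X" using * nth_mem by (metis subsetD)
  next
    assume "p \<in> X \<and> q \<in> X"
    thus "set (xs[i := p, i + 1 := q]) \<subseteq> X"
      using assms by (meson order_trans set_update_subsetI)
  qed
  thus ?thesis using assms(1) by simp blast
qed

lemma crun_Virt:
  assumes "i + 1 < length w" "set xs \<subseteq> X" "length xs = length w"
  shows "crun ((i, Virt) # L) w xs css ys \<longleftrightarrow>
    (\<exists>css'. css = xs[i := xs ! (i + 1), i + 1 := xs ! i] # css' \<and>
      crun L (w[i := w ! (i + 1), i + 1 := w ! i]) (xs[i := xs ! (i + 1), i + 1 := xs ! i]) css' ys)"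
proof -
  have "set (xs[i := xs ! (i + 1), i + 1 := xs ! i]) \<subseteq> X"
    using assms by (simp add: set_swap)
  thus ?thesis using assms(1) by auto
qed

lemma crun_Mark:
  assumes "i + 1 < length w" "w ! i \<noteq> w ! (i + 1)" "set xs \<subseteq> X"
  shows "crun ((i, Mark m) # L) w xs css ys \<longleftrightarrow>
    xs ! i = xs ! (i + 1) \<and> (\<exists>css'. css = xs # css' \<and> crun L w xs css' ys)"
  using assms by auto

lemmas crun_simps = crun_Cup crun_Cap crun_Cross crun_Virt crun_Mark

lemma step_determined:
  assumes "step un ov x w xs ys" "step un ov x w xs ys'" "\<And>b. snd x \<noteq> Cup b"
    "run_slice x w = Some w'" "length xs = length w" "set xs \<subseteq> X" "set ys \<subseteq> X" "set ys' \<subseteq> X"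
  shows "ys = ys'"
proof -
  obtain i e where x: "x = (i, e)" by fastforce
  show ?thesis
  proof (cases e)
    case (Cross c)
    obtain p q p' q' where
      1: "xrel c (w ! i) (w ! (i + 1)) (xs ! i) (xs ! (i + 1)) p q" "ys = xs[i := p, i + 1 := q]" and
      2: "xrel c (w ! i) (w ! (i + 1)) (xs ! i) (xs ! (i + 1)) p' q'" "ys' = xs[i := p', i + 1 := q']"
      using assms(1,2) x Cross by auto
    have i: "i + 1 < length xs" using assms x Cross by (auto split: if_splits)
    have mem: "p \<in> X" "q \<in> X" if "set (xs[i := p, i + 1 := q]) \<subseteq> X" for p q
      using i that nth_mem[of i "xs[i := p, i + 1 := q]"] nth_mem[of "i + 1" "xs[i := p, i + 1 := q]"]
      by auto
    have "xs ! i \<in> X" "xs ! (i + 1) \<in> X" using i assms(6) by auto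
    thus ?thesis
      using crossing_up_unique[OF 1(1) 2(1)] mem[of p q] mem[of p' q'] 1 2 assms(7,8) by auto
  qed (use assms x in auto)
qed

text \<open>
  Only a minimum introduces a color that is not determined by the colors below it.
\<close>

lemma crun_determined:
  assumes "crun L w xs css ys" "crun L w xs css' ys'" "\<And>i b. (i, Cup b) \<notin> set L"
    "run L w = Some w'" "length xs = length w" "set xs \<subseteq> X"
  shows "css = css'"
  using assms
proof (induction L arbitrary: w xs css css')
  case (Cons x L)
  obtain w1 where w1: "run_slice x w = Some w1" "run L w1 = Some w'"
    using Cons.prems by (auto split: bind_splits)
  obtain zs cs where 1: "css = zs # cs" "set zs \<subseteq> X" "step un ov x w xs zs" "crun L w1 zs cs ys"
    using Cons.prems(1) w1 by auto
  obtain zs' cs' where 2: "css' = zs' # cs'" "set zs' \<subseteq> X" "step un ov x w xs zs'" "crun L w1 zs' cs' ys'"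
    using Cons.prems(2) w1 by auto
  have "snd x \<noteq> Cup b" for b using Cons.prems(3)[of "fst x" b] by (metis list.set_intros(1) prod.collapse)
  hence z: "zs = zs'" using step_determined[OF 1(3) 2(3)] w1 Cons.prems 1 2 by blast
  have "cs = cs'"
    using Cons.IH[of w1 zs cs cs'] 1 2 z w1 Cons.prems step_length[OF 1(3) w1(1)] by auto
  thus ?case using 1 2 z by simp
qed simp

lemma same_fillings_cupless:
  assumes "\<And>xs ys. length xs = length w \<Longrightarrow> set xs \<subseteq> X \<Longrightarrow>
      (\<exists>css. crun L w xs css ys) \<longleftrightarrow> (\<exists>css. crun R w xs css ys)"
    and "\<And>i b. (i, Cup b) \<notin> set L" "\<And>i b. (i, Cup b) \<notin> set R"
    and "run L w = Some w'" "run R w = Some w'"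
  shows "same_fillings L R w"
  unfolding same_fillings_def
proof (intro allI impI conjI)
  fix xs ys assume xs: "length xs = length w" "set xs \<subseteq> X"
  show "(\<exists>css. crun L w xs css ys) \<longleftrightarrow> (\<exists>css. crun R w xs css ys)" using assms(1) xs .
  show "css = css'" if "crun L w xs css ys" "crun L w xs css' ys" for css css'
    by (rule crun_determined[OF that assms(2,4) xs])
  show "css = css'" if "crun R w xs css ys" "crun R w xs css' ys" for css css'
    by (rule crun_determined[OF that assms(3,5) xs])
qed

lemma ex_bex_swap: "(\<exists>css. \<exists>p\<in>X. P css p) \<longleftrightarrow> (\<exists>p\<in>X. \<exists>css. P css p)"
  and ex_Cons_eliminate: "(\<exists>css. \<exists>css'. css = a # css' \<and> Q css') \<longleftrightarrow> (\<exists>css'. Q css')"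
  by blast+

lemmas filling_simps = eval_nat_numeral crun_simps ex_bex_swap ex_Cons_eliminate

lemma R2_iff:
  assumes "x \<in> X" "y \<in> X"
  shows "(\<exists>css. crun [(0, Cross c), (0, Cross (\<not> c))] [w1, w2] [x, y] css ys) \<longleftrightarrow>
    (\<exists>css. crun [] [w1, w2] [x, y] css ys)"
proof -
  have "xrel (\<not> c) w2 w1 p q u v \<longleftrightarrow> xrel c w1 w2 u v p q" for p q u v
    using crossing_rel_upside_down by metis
  thus ?thesis
    using assms crossing_up_ex[OF assms, of c w1 w2] crossing_down_unique[of c w1 w2 x y _ _]
    apply (simp add: eval_nat_numeral crun_simps del: colored_run.simps(2) cong: conj_cong)
    by metis
qed

lemma R3_iff:
  assumes "x \<in> X" "y \<in> X" "z \<in> X" "a = b \<or> b = c"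
  shows "(\<exists>css. crun [(0, Cross a), (1, Cross b), (0, Cross c)] [w1, w2, w3] [x, y, z] css ys) \<longleftrightarrow>
    (\<exists>css. crun [(1, Cross c), (0, Cross b), (1, Cross a)] [w1, w2, w3] [x, y, z] css ys)"
proof -
  have "(\<exists>css. crun [(0, Cross a), (1, Cross b), (0, Cross c)] [w1, w2, w3] [x, y, z] css ys) \<longleftrightarrow>
    (\<exists>m\<in>X. \<exists>n\<in>X. \<exists>v\<in>X. ys = [m, n, v] \<and> lower_triangle a b c w1 w2 w3 x y z m n v)"
    unfolding lower_triangle_def using assms
    apply (simp add: eval_nat_numeral crun_simps del: colored_run.simps(2) cong: conj_cong)
    by blast
  also have "\<dots> \<longleftrightarrow> (\<exists>m\<in>X. \<exists>n\<in>X. \<exists>v\<in>X. ys = [m, n, v] \<and> upper_triangle a b c w1 w2 w3 x y z m n v)"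
    using slides_always[OF assms(4)] assms unfolding slides_def by metis
  also have "\<dots> \<longleftrightarrow> 
    (\<exists>css. crun [(1, Cross c), (0, Cross b), (1, Cross a)] [w1, w2, w3] [x, y, z] css ys)"
    unfolding upper_triangle_def using assms
    apply (simp add: eval_nat_numeral crun_simps del: colored_run.simps(2) cong: conj_cong)
    by blast
  finally show ?thesis .
qed

lemma Y4_left_iff:
  assumes "x \<in> X" "y \<in> X" "z \<in> X" 
  shows "(\<exists>css. crun [(0, Cross c), (1, Cross c), (0, Mark m)] [w1, w2, \<not> w2] [x, y, z] css ys) \<longleftrightarrow>
    (\<exists>css. crun [(1, Mark m), (0, Cross c), (1, Cross c)] [w1, w2, \<not> w2] [x, y, z] css ys)"
  using assms
  apply (simp add: filling_simps del: colored_run.simps(2) cong: conj_cong)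
  using parallel_strands_left by blast

lemma Y4_right_iff:
  assumes "x \<in> X" "y \<in> X" "z \<in> X" 
  shows "(\<exists>css. crun [(1, Cross c), (0, Cross c), (1, Mark m)] [w1, \<not> w1, w3] [x, y, z] css ys) \<longleftrightarrow>
    (\<exists>css. crun [(0, Mark m), (1, Cross c), (0, Cross c)] [w1, \<not> w1, w3] [x, y, z] css ys)"
  using assms
  apply (simp add: filling_simps del: colored_run.simps(2) cong: conj_cong)
  using parallel_strands_right[of c "\<not> w1", simplified] by blast

lemma Y5_iff:
  assumes "x \<in> X" "y \<in> X"
  shows "(\<exists>css. crun [(0, Mark m), (0, Cross c)] [w1, \<not> w1] [x, y] css ys) \<longleftrightarrow>
    (\<exists>css. crun [(0, Cross c), (0, Mark m)] [w1, \<not> w1] [x, y] css ys)"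
  using assms
  apply (simp add: filling_simps del: colored_run.simps(2) cong: conj_cong)
  by (metis vertex_flip)

lemma Y7_iff:
  assumes "x \<in> X" "y \<in> X" "z \<in> X" 
  shows "(\<exists>css. crun [(0, Mark m), (1, Mark m')] [w1, \<not> w1, w1] [x, y, z] css ys) \<longleftrightarrow>
    (\<exists>css. crun [(1, Mark m'), (0, Mark m)] [w1, \<not> w1, w1] [x, y, z] css ys)"
  using assms
  by (simp add: eval_nat_numeral crun_simps del: colored_run.simps(2) cong: conj_cong) blast

text \<open>
  Two antiparallel strands of color \<open>x\<close> pass two antiparallel strands of color \<open>z\<close>. What the first strand
  of a pair does to a strand that it crosses is undone by the second, so all four strands come out with their
  original colors. The outcome is the same whether the first pair passes over or under.
\<close>

lemma double_crossing_run:
  assumes "x \<in> X" "z \<in> X"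
  shows "(\<exists>css. crun (double_crossing c) [b, \<not> b, d, \<not> d] [x, x, z, z] css ys) \<longleftrightarrow> ys = [z, z, x, x]"
proof -
  obtain p q where pq: "p \<in> X" "q \<in> X" "xrel c (\<not> b) d x z p q" using crossing_up_ex assms by metis
  have pq': "xrel c b d x p z q" "xrel c (\<not> b) (\<not> d) q z p x" "xrel c b (\<not> d) q p z x"
    using pq(3) by (auto simp: crossing_rel_def)
  have u: "xrel c (\<not> b) d x z p' q' \<longleftrightarrow> p' = p \<and> q' = q"
     "xrel c b d x p p' q' \<longleftrightarrow> p' = z \<and> q' = q"
     "xrel c (\<not> b) (\<not> d) q z p' q' \<longleftrightarrow> p' = p \<and> q' = x"
     "xrel c b (\<not> d) q p p' q' \<longleftrightarrow> p' = z \<and> q' = x" if "p' \<in> X" "q' \<in> X" for p' q'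
    using crossing_up_unique pq pq' assms that by metis+
  show ?thesis
    using assms pq(1,2) u
    by (simp add: double_crossing_def eval_nat_numeral crun_simps del: colored_run.simps(2) cong: conj_cong)
qed

lemma Y8_iff:
  assumes "x \<in> X" "y \<in> X" "z \<in> X" "u \<in> X" 
  shows "(\<exists>css. crun ([(0, Mark m), (2, Mark m')] @ double_crossing c) [b, \<not> b, d, \<not> d] [x, y, z, u] css ys)
    \<longleftrightarrow> x = y \<and> z = u \<and> ys = [z, z, x, x]"
  using assms double_crossing_run[OF assms(1,3), of c b d ys]
  by (auto simp add: eval_nat_numeral crun_simps double_crossing_run[symmetric] del: colored_run.simps(2) cong: conj_cong)

section \<open>Moves with loops, rotations, virtual crossings and exchanges\<close>

lemma same_fillings_strand:
  assumes "\<And>x. x \<in> X \<Longrightarrow> \<exists>css0. \<forall>css ys. crun L [a] [x] css ys \<longleftrightarrow> css = css0 \<and> ys = [x]"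
  shows "same_fillings L [] [a]"
  unfolding same_fillings_def
proof (intro allI impI conjI)
  fix xs ys assume "length xs = length [a]" "set xs \<subseteq> X"
  then obtain x where x: "x \<in> X" "xs = [x]" by (auto simp: length_Suc_conv)
  then obtain css0 where css0: "\<And>css ys. crun L [a] [x] css ys \<longleftrightarrow> css = css0 \<and> ys = [x]"
    using assms by metis
  show "(\<exists>css. crun L [a] xs css ys) \<longleftrightarrow> (\<exists>css. crun [] [a] xs css ys)" using x css0 by auto
  show "css = css'" if "crun L [a] xs css ys" "crun L [a] xs css' ys" for css css'
    using that x css0 by auto
  show "css = css'" if "crun [] [a] xs css ys" "crun [] [a] xs css' ys" for css css'
    using that by simp
qed

lemma kink_iff:
  assumes "x \<in> X"
  shows "\<exists>y\<in>X. \<forall>p\<in>X. \<forall>z\<in>X. xrel c a a x z p z \<longleftrightarrow> z = y \<and> p = x"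
proof -
  obtain y where "y \<in> X" "xrel c a a x y x y" using kink_ex assms by blast
  thus ?thesis using kink_unique kink_loop_unique assms by metis
qed

lemma kink_right_removal: "same_fillings [(1, Cup b), (0, Cross c), (1, Cap)] [] [b]"
proof (rule same_fillings_strand)
  fix x assume x: "x \<in> X"
  obtain y where y: "y \<in> X" "\<And>p z. p \<in> X \<Longrightarrow> z \<in> X \<Longrightarrow> xrel c b b x z p z \<longleftrightarrow> z = y \<and> p = x"
    using kink_iff[OF x, of c b] by auto
  have "crun [(1, Cup b), (0, Cross c), (1, Cap)] [b] [x] css ys \<longleftrightarrow>
      css = [[x, y, y], [x, y, y], [x]] \<and> ys = [x]" for css ys
    using x y by (auto simp: filling_simps simp del: colored_run.simps(2) cong: conj_cong)
  thus "\<exists>css0. \<forall>css ys. crun [(1, Cup b), (0, Cross c), (1, Cap)] [b] [x] css ys \<longleftrightarrow>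
      css = css0 \<and> ys = [x]" by blast
qed

lemma kink_left_removal: "same_fillings [(0, Cup b), (1, Cross c), (0, Cap)] [] [\<not> b]"
proof (rule same_fillings_strand)
  fix x assume x: "x \<in> X"
  have rev: "xrel c (\<not> b) (\<not> b) z x z p \<longleftrightarrow> xrel c b b p z x z" for z p
    by (auto simp: crossing_rel_def)
  obtain y where y: "y \<in> X" "\<And>p z. p \<in> X \<Longrightarrow> z \<in> X \<Longrightarrow> xrel c b b x z p z \<longleftrightarrow> z = y \<and> p = x"
    using kink_iff[OF x, of c b] by auto
  hence "xrel c b b p z x z \<longleftrightarrow> z = y \<and> p = x" if "p \<in> X" "z \<in> X" for p z
    using that x kink_unique by metis
  hence "crun [(0, Cup b), (1, Cross c), (0, Cap)] [\<not> b] [x] css ys \<longleftrightarrow>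
      css = [[y, y, x], [y, y, x], [x]] \<and> ys = [x]" for css ys
    using x y(1) by (auto simp: filling_simps rev simp del: colored_run.simps(2) cong: conj_cong)
  thus "\<exists>css0. \<forall>css ys. crun [(0, Cup b), (1, Cross c), (0, Cap)] [\<not> b] [x] css ys \<longleftrightarrow>
      css = css0 \<and> ys = [x]" by blast
qed

lemma loops:
  shows "same_fillings [(1, Cup b), (0, Cap)] [] [\<not> b]"
    and "same_fillings [(0, Cup b), (1, Cap)] [] [b]"
    and "same_fillings [(1, Cup b), (0, Virt), (1, Cap)] [] [b]"
    and "same_fillings [(0, Cup b), (1, Virt), (0, Cap)] [] [\<not> b]"
    and "same_fillings [(1, Cup b), (0, Mark m), (1, Cap)] [] [\<not> b]"
    and "same_fillings [(0, Cup b), (1, Mark m), (0, Cap)] [] [b]"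
  by (rule same_fillings_strand, rule_tac exI, intro allI,
      fastforce simp: filling_simps simp del: colored_run.simps(2) cong: conj_cong)+

lemma rotate_cap_iff:
  assumes "x \<in> X" "y \<in> X" "z \<in> X"
  shows "(\<exists>css. crun [(0, Cross c), (1, Cap)] [w1, w2, \<not> w1] [x, y, z] css ys) \<longleftrightarrow>
      (\<exists>css. crun [(1, Cross (\<not> c)), (0, Cap)] [w1, w2, \<not> w1] [x, y, z] css ys)"
    and "(\<exists>css. crun [(0, Virt), (1, Cap)] [w1, w2, \<not> w1] [x, y, z] css ys) \<longleftrightarrow>
      (\<exists>css. crun [(1, Virt), (0, Cap)] [w1, w2, \<not> w1] [x, y, z] css ys)"
    and "(\<exists>css. crun [(0, Mark m), (1, Cap)] [w1, \<not> w1, w1] [x, y, z] css ys) \<longleftrightarrow>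
      (\<exists>css. crun [(1, Mark m'), (0, Cap)] [w1, \<not> w1, w1] [x, y, z] css ys)"
  using assms crossing_rel_quarter_turn[of un ov c w1 w2 x y _ z]
  by (auto simp: filling_simps simp del: colored_run.simps(2) cong: conj_cong)

lemma rotated_cup_fillings:
  shows "same_fillings [(1, Cup b), (0, Cross c)] [(0, Cup b), (1, Cross (\<not> c))] [w1]"
    and "same_fillings [(1, Cup b), (0, Virt)] [(0, Cup b), (1, Virt)] [w1]"
    and "same_fillings [(1, Cup (\<not> w1)), (0, Mark m)] [(0, Cup w1), (1, Mark m')] [w1]"
proof -
  have rot: "xrel c w1 b x y p q \<longleftrightarrow> xrel (\<not> c) (\<not> b) w1 p x q y" for x y p q
    by (auto simp: crossing_rel_def)
  show "same_fillings [(1, Cup b), (0, Cross c)] [(0, Cup b), (1, Cross (\<not> c))] [w1]"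
    by (rule same_fillingsI)
      (auto simp: length_Suc_conv filling_simps rot simp del: colored_run.simps(2) cong: conj_cong)
  show "same_fillings [(1, Cup b), (0, Virt)] [(0, Cup b), (1, Virt)] [w1]"
    "same_fillings [(1, Cup (\<not> w1)), (0, Mark m)] [(0, Cup w1), (1, Mark m')] [w1]"
    by (rule same_fillingsI;
      auto simp: length_Suc_conv filling_simps simp del: colored_run.simps(2) cong: conj_cong)+
qed

lemma virtual_iff:
  assumes "x \<in> X" "y \<in> X" "z \<in> X"
  shows "(\<exists>css. crun [(0, Virt), (0, Virt)] [w1, w2] [x, y] css ys) \<longleftrightarrow>
      (\<exists>css. crun [] [w1, w2] [x, y] css ys)"
    and "(\<exists>css. crun [(0, Virt), (1, Virt), (0, Virt)] [w1, w2, w3] [x, y, z] css ys) \<longleftrightarrow>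
      (\<exists>css. crun [(1, Virt), (0, Virt), (1, Virt)] [w1, w2, w3] [x, y, z] css ys)"
    and "(\<exists>css. crun [(0, Virt), (1, Virt), (0, Cross c)] [w1, w2, w3] [x, y, z] css ys) \<longleftrightarrow>
      (\<exists>css. crun [(1, Cross c), (0, Virt), (1, Virt)] [w1, w2, w3] [x, y, z] css ys)"
    and "(\<exists>css. crun [(0, Virt), (1, Cross c), (0, Virt)] [w1, w2, w3] [x, y, z] css ys) \<longleftrightarrow>
      (\<exists>css. crun [(1, Virt), (0, Cross c), (1, Virt)] [w1, w2, w3] [x, y, z] css ys)"
    and "(\<exists>css. crun [(0, Cross c), (1, Virt), (0, Virt)] [w1, w2, w3] [x, y, z] css ys) \<longleftrightarrow>
      (\<exists>css. crun [(1, Virt), (0, Virt), (1, Cross c)] [w1, w2, w3] [x, y, z] css ys)"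
  using assms by (auto simp: filling_simps simp del: colored_run.simps(2) cong: conj_cong)

text \<open>
  Distant pieces act on disjoint blocks of strands, and the frame property makes their effects independent.
\<close>

lemma exchange_fillings:
  assumes "length w = in_width e + d + in_width f"
    and "run [(0, e), (out_width e + d, f)] w = Some w'"
  shows "same_fillings [(0, e), (out_width e + d, f)] [(in_width e + d, f), (0, e)] w"
proof -
  define u m v where "u = take (in_width e) w" and "m = take d (drop (in_width e) w)"
    and "v = drop (in_width e + d) w"
  have w: "w = u @ m @ v" "length u = in_width e" "length m = d" "length v = in_width f"
    using assms(1) by (auto simp: u_def m_def v_def) (metis append_take_drop_id add.commute drop_drop)
  have e_frame: "run_slice (0, e) (u @ r) = map_option (\<lambda>u'. u' @ r) (run_slice (0, e) u)" for r
    using run_slice_frame[of 0 e u "[]" r] w by simp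
  have f_frame: "run_slice (length r + 0, f) (r @ v @ []) = map_option (\<lambda>v'. r @ v' @ []) (run_slice (0, f) v)"
    for r by (rule run_slice_frame) (use w in simp)
  obtain u' where u': "run_slice (0, e) u = Some u'"
    using assms(2) w e_frame[of "m @ v"] by (auto split: bind_splits)
  have len_u': "length u' = out_width e" using run_slice_length[OF u'] w by simp
  have "run_slice (out_width e + d, f) (u' @ m @ v) \<noteq> None"
    using assms(2) w e_frame[of "m @ v"] u' by (auto split: bind_splits)
  then obtain v' where v': "run_slice (0, f) v = Some v'"
    using f_frame[of "u' @ m"] len_u' w by auto
  have runs: "run_slice (0, e) w = Some (u' @ m @ v)"
    "run_slice (in_width e + d, f) w = Some (u @ m @ v')"
    using e_frame[of "m @ v"] f_frame[of "u @ m"] u' v' w by auto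
  have L: "crun [(0, e), (out_width e + d, f)] w (a @ n @ b) css ys \<longleftrightarrow>
      (\<exists>a' b'. set a' \<subseteq> X \<and> set b' \<subseteq> X \<and> step un ov (0, e) u a a' \<and> step un ov (0, f) v b b' \<and>
         css = [a' @ n @ b, a' @ n @ b'] \<and> ys = a' @ n @ b')"
    and R: "crun [(in_width e + d, f), (0, e)] w (a @ n @ b) css ys \<longleftrightarrow>
      (\<exists>a' b'. set a' \<subseteq> X \<and> set b' \<subseteq> X \<and> step un ov (0, e) u a a' \<and> step un ov (0, f) v b b' \<and>
         css = [a @ n @ b', a' @ n @ b'] \<and> ys = a' @ n @ b')"
    if "length a = length u" "length n = d" "length b = length v"
      "set a \<subseteq> X" "set b \<subseteq> X" "set n \<subseteq> X" for a n b css ys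
  proof -
    have e_step: "step un ov (0, e) (u @ r) (a @ s) zs \<longleftrightarrow> (\<exists>a'. zs = a' @ s \<and> step un ov (0, e) u a a')"
      for r s zs
      using step_frame[of 0 e u a "[]" "[]" un ov r s] w that by simp
    have f_step: "step un ov (length r + 0, f) (r @ v @ []) (s @ b @ []) zs \<longleftrightarrow>
        (\<exists>b'. zs = s @ b' @ [] \<and> step un ov (0, f) v b b')" if "length s = length r" for r s zs
      by (rule step_frame) (use w that \<open>length b = length v\<close> in auto)
    have a': "length a' = out_width e" if "step un ov (0, e) u a a'" for a'
      using step_length[OF that u'] len_u' \<open>length a = length u\<close> by simp
    have e1: "step un ov (0, e) w (a @ n @ b) zs \<longleftrightarrow> (\<exists>a'. zs = a' @ n @ b \<and> step un ov (0, e) u a a')" for zs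
      using e_step[of "m @ v" "n @ b"] w by simp
    have f1: "step un ov (out_width e + d, f) (u' @ m @ v) (a' @ n @ b) zs \<longleftrightarrow>
        (\<exists>b'. zs = a' @ n @ b' \<and> step un ov (0, f) v b b')" if "length a' = out_width e" for a' zs
      using f_step[of "a' @ n" "u' @ m"] len_u' w \<open>length n = d\<close> that by simp
    have f2: "step un ov (in_width e + d, f) w (a @ n @ b) zs \<longleftrightarrow>
        (\<exists>b'. zs = a @ n @ b' \<and> step un ov (0, f) v b b')" for zs
      using f_step[of "a @ n" "u @ m"] w that by simp
    have e2: "step un ov (0, e) (u @ m @ v') (a @ n @ b') zs \<longleftrightarrow>
        (\<exists>a'. zs = a' @ n @ b' \<and> step un ov (0, e) u a a')" for b' zs
      using e_step[of "m @ v'" "n @ b'"] by simp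
    show "crun [(0, e), (out_width e + d, f)] w (a @ n @ b) css ys \<longleftrightarrow>
      (\<exists>a' b'. set a' \<subseteq> X \<and> set b' \<subseteq> X \<and> step un ov (0, e) u a a' \<and> step un ov (0, f) v b b' \<and>
         css = [a' @ n @ b, a' @ n @ b'] \<and> ys = a' @ n @ b')" (is "?l \<longleftrightarrow> ?r")
    proof
      assume ?l
      then obtain zs1 zs2 where 1: "css = [zs1, zs2]" "set zs1 \<subseteq> X" "set zs2 \<subseteq> X" "ys = zs2"
        "step un ov (0, e) w (a @ n @ b) zs1" "step un ov (out_width e + d, f) (u' @ m @ v) zs1 zs2"
        by (auto simp: runs simp del: step.simps)
      then obtain a' where 2: "zs1 = a' @ n @ b" "step un ov (0, e) u a a'" using e1 by blast
      then obtain b' where "zs2 = a' @ n @ b'" "step un ov (0, f) v b b'" using f1[OF a'] 1 by blast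
      thus ?r using 1 2 by (intro exI[of _ a'] exI[of _ b']) simp
    next
      assume ?r
      then obtain a' b' where 1: "set a' \<subseteq> X" "set b' \<subseteq> X" "step un ov (0, e) u a a'"
        "step un ov (0, f) v b b'" "css = [a' @ n @ b, a' @ n @ b']" "ys = a' @ n @ b'" by blast
      hence "step un ov (0, e) w (a @ n @ b) (a' @ n @ b)"
        "step un ov (out_width e + d, f) (u' @ m @ v) (a' @ n @ b) (a' @ n @ b')"
        using e1 f1[OF a'] by blast+
      thus ?l using 1 that by (simp add: runs del: step.simps)
    qed
    show "crun [(in_width e + d, f), (0, e)] w (a @ n @ b) css ys \<longleftrightarrow>
      (\<exists>a' b'. set a' \<subseteq> X \<and> set b' \<subseteq> X \<and> step un ov (0, e) u a a' \<and> step un ov (0, f) v b b' \<and>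
         css = [a @ n @ b', a' @ n @ b'] \<and> ys = a' @ n @ b')" (is "?l \<longleftrightarrow> ?r")
    proof
      assume ?l
      then obtain zs1 zs2 where 1: "css = [zs1, zs2]" "set zs1 \<subseteq> X" "set zs2 \<subseteq> X" "ys = zs2"
        "step un ov (in_width e + d, f) w (a @ n @ b) zs1" "step un ov (0, e) (u @ m @ v') zs1 zs2"
        by (auto simp: runs simp del: step.simps)
      then obtain b' where 2: "zs1 = a @ n @ b'" "step un ov (0, f) v b b'" using f2 by blast
      then obtain a' where "zs2 = a' @ n @ b'" "step un ov (0, e) u a a'" using e2 1 by blast
      thus ?r using 1 2 by (intro exI[of _ a'] exI[of _ b']) simp
    next
      assume ?r
      then obtain a' b' where 1: "set a' \<subseteq> X" "set b' \<subseteq> X" "step un ov (0, e) u a a'"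
        "step un ov (0, f) v b b'" "css = [a @ n @ b', a' @ n @ b']" "ys = a' @ n @ b'" by blast
      hence "step un ov (in_width e + d, f) w (a @ n @ b) (a @ n @ b')"
        "step un ov (0, e) (u @ m @ v') (a @ n @ b') (a' @ n @ b')"
        using e2 f2 by blast+
      thus ?l using 1 that by (simp add: runs del: step.simps)
    qed
  qed
  have split: "\<exists>a n b. xs = a @ n @ b \<and> length a = length u \<and> length n = d \<and> length b = length v \<and>
      set a \<subseteq> X \<and> set b \<subseteq> X \<and> set n \<subseteq> X" if xs: "length xs = length w" "set xs \<subseteq> X" for xs
  proof -
    define a n b where "a = take (in_width e) xs" and "n = take d (drop (in_width e) xs)"
      and "b = drop (in_width e + d) xs"
    have "xs = a @ n @ b"
      by (auto simp: a_def n_def b_def) (metis append_take_drop_id add.commute drop_drop)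
    moreover have "length a = length u" "length n = d" "length b = length v"
      using xs w by (auto simp: a_def n_def b_def)
    ultimately show ?thesis using xs(2) by fastforce
  qed
  have len: "length a' = length u'" if "step un ov (0, e) u a a'" "length a = length u" for a a'
    using step_length[OF that(1) u' that(2)] .
  show ?thesis
    unfolding same_fillings_def
  proof (intro allI impI)
    fix xs ys assume "length xs = length w" "set xs \<subseteq> X"
    from split[OF this] obtain a n b where xs: "xs = a @ n @ b" "length a = length u" "length n = d"
      "length b = length v" "set a \<subseteq> X" "set b \<subseteq> X" "set n \<subseteq> X" by blast
    note LR = L[OF xs(2-)] R[OF xs(2-)]
    show "((\<exists>css. crun [(0, e), (out_width e + d, f)] w xs css ys) \<longleftrightarrow>
        (\<exists>css. crun [(in_width e + d, f), (0, e)] w xs css ys)) \<and>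
      (\<forall>css css'. crun [(0, e), (out_width e + d, f)] w xs css ys \<longrightarrow>
        crun [(0, e), (out_width e + d, f)] w xs css' ys \<longrightarrow> css = css') \<and>
      (\<forall>css css'. crun [(in_width e + d, f), (0, e)] w xs css ys \<longrightarrow>
        crun [(in_width e + d, f), (0, e)] w xs css' ys \<longrightarrow> css = css')"
      unfolding xs(1) LR
    proof (intro conjI allI impI, goal_cases)
      case 1
      show ?case by blast
    next
      case (2 css css')
      then obtain a1 b1 a2 b2 where "step un ov (0, e) u a a1" "step un ov (0, e) u a a2"
        "css = [a1 @ n @ b, a1 @ n @ b1]" "css' = [a2 @ n @ b, a2 @ n @ b2]"
        "ys = a1 @ n @ b1" "ys = a2 @ n @ b2" by blast
      thus ?case using len[OF _ xs(2)] by (metis append_eq_append_conv)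
    next
      case (3 css css')
      then obtain a1 b1 a2 b2 where "step un ov (0, e) u a a1" "step un ov (0, e) u a a2"
        "css = [a @ n @ b1, a1 @ n @ b1]" "css' = [a @ n @ b2, a2 @ n @ b2]"
        "ys = a1 @ n @ b1" "ys = a2 @ n @ b2" by blast
      thus ?case using len[OF _ xs(2)] by (metis append_eq_append_conv)
    qed
  qed
qed

section \<open>Local equivalence of the two sides of a move\<close>

lemma same_fillings_cupless2:
  assumes "\<And>x y ys. x \<in> X \<Longrightarrow> y \<in> X \<Longrightarrow>
      (\<exists>css. crun L [w1, w2] [x, y] css ys) \<longleftrightarrow> (\<exists>css. crun R [w1, w2] [x, y] css ys)"
    and "\<And>i b. (i, Cup b) \<notin> set L" "\<And>i b. (i, Cup b) \<notin> set R"
    and "run L [w1, w2] = Some w'" "run R [w1, w2] = Some w'"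
  shows "same_fillings L R [w1, w2]"
proof (rule same_fillings_cupless[OF _ assms(2-)])
  fix xs ys assume "length xs = length [w1, w2]" "set xs \<subseteq> X"
  then obtain x y where "xs = [x, y]" "x \<in> X" "y \<in> X" by (auto simp: length_Suc_conv)
  thus "(\<exists>css. crun L [w1, w2] xs css ys) \<longleftrightarrow> (\<exists>css. crun R [w1, w2] xs css ys)"
    using assms(1) by blast
qed

lemma same_fillings_cupless3:
  assumes "\<And>x y z ys. x \<in> X \<Longrightarrow> y \<in> X \<Longrightarrow> z \<in> X \<Longrightarrow>
      (\<exists>css. crun L [w1, w2, w3] [x, y, z] css ys) \<longleftrightarrow> (\<exists>css. crun R [w1, w2, w3] [x, y, z] css ys)"
    and "\<And>i b. (i, Cup b) \<notin> set L" "\<And>i b. (i, Cup b) \<notin> set R"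
    and "run L [w1, w2, w3] = Some w'" "run R [w1, w2, w3] = Some w'"
  shows "same_fillings L R [w1, w2, w3]"
proof (rule same_fillings_cupless[OF _ assms(2-)])
  fix xs ys assume "length xs = length [w1, w2, w3]" "set xs \<subseteq> X"
  then obtain x y z where "xs = [x, y, z]" "x \<in> X" "y \<in> X" "z \<in> X" by (auto simp: length_Suc_conv)
  thus "(\<exists>css. crun L [w1, w2, w3] xs css ys) \<longleftrightarrow> (\<exists>css. crun R [w1, w2, w3] xs css ys)"
    using assms(1) by blast
qed

lemma same_fillings_cupless4:
  assumes "\<And>x y z u ys. x \<in> X \<Longrightarrow> y \<in> X \<Longrightarrow> z \<in> X \<Longrightarrow> u \<in> X \<Longrightarrow>
      (\<exists>css. crun L [w1, w2, w3, w4] [x, y, z, u] css ys) \<longleftrightarrow>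
      (\<exists>css. crun R [w1, w2, w3, w4] [x, y, z, u] css ys)"
    and "\<And>i b. (i, Cup b) \<notin> set L" "\<And>i b. (i, Cup b) \<notin> set R"
    and "run L [w1, w2, w3, w4] = Some w'" "run R [w1, w2, w3, w4] = Some w'"
  shows "same_fillings L R [w1, w2, w3, w4]"
proof (rule same_fillings_cupless[OF _ assms(2-)])
  fix xs ys assume "length xs = length [w1, w2, w3, w4]" "set xs \<subseteq> X"
  then obtain x y z u where "xs = [x, y, z, u]" "x \<in> X" "y \<in> X" "z \<in> X" "u \<in> X"
    by (auto simp: length_Suc_conv)
  thus "(\<exists>css. crun L [w1, w2, w3, w4] xs css ys) \<longleftrightarrow> (\<exists>css. crun R [w1, w2, w3, w4] xs css ys)"
    using assms(1) by blast
qed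

text \<open>
  The number \<open>m\<close> is the number of strands on which the move takes place. The third condition
  recovers it inside a larger diagram: if both sides can be oriented there, at least \<open>m\<close> strands
  are present to the right of the first \<open>n\<close>.
\<close>

definition locally_equivalent where
  "locally_equivalent m L R \<longleftrightarrow>
     fits m L \<and> fits m R \<and>
     (\<forall>n w w'. run (shift n L) w = Some w' \<longrightarrow> run (shift n R) w = Some w' \<longrightarrow> n + m \<le> length w) \<and>
     (\<forall>w w'. length w = m \<longrightarrow> run L w = Some w' \<longrightarrow> run R w = Some w' \<longrightarrow> same_fillings L R w)"

lemma locally_equivalentI:
  assumes "fits m L" "fits m R"
    and "\<And>n w w'. run (shift n L) w = Some w' \<Longrightarrow> run (shift n R) w = Some w' \<Longrightarrow> n + m \<le> length w"
    and "\<And>w w'. length w = m \<Longrightarrow> run L w = Some w' \<Longrightarrow> run R w = Some w' \<Longrightarrow> same_fillings L R w"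
  shows "locally_equivalent m L R"
  using assms unfolding locally_equivalent_def by blast

lemma bind_eq_SomeE:
  assumes "Option.bind a f = Some y" obtains x where "a = Some x" "f x = Some y"
  using assms by (cases a) auto

lemmas width_simps = shift_def eval_nat_numeral

lemma isotopy_locally_equivalent:
  assumes "isotopy_move L R"
  shows "\<exists>m. locally_equivalent m L R"
  using assms
proof cases
  case (cancel_right b)
  have "locally_equivalent 1 L R"
  proof (rule locally_equivalentI)
    fix w w' assume "length w = 1" "run L w = Some w'"
    then have "w = [\<not> b]" unfolding cancel_right by (auto simp: length_Suc_conv split: if_splits)
    thus "same_fillings L R w" using loops cancel_right by simp
  qed (auto simp: cancel_right width_simps split: if_splits elim!: bind_eq_SomeE)
  thus ?thesis ..
next
  case (cancel_left b)
  have "locally_equivalent 1 L R"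
  proof (rule locally_equivalentI)
    fix w w' assume "length w = 1" "run L w = Some w'"
    then have "w = [b]" unfolding cancel_left by (auto simp: length_Suc_conv split: if_splits)
    thus "same_fillings L R w" using loops cancel_left by simp
  qed (auto simp: cancel_left width_simps split: if_splits elim!: bind_eq_SomeE)
  thus ?thesis ..
next
  case (rotate_cap e)
  have "locally_equivalent 3 L R"
  proof (rule locally_equivalentI)
    fix w w' assume w: "length w = 3" and L: "run L w = Some w'" and R: "run R w = Some w'"
    obtain w1 w2 w3 where w: "w = [w1, w2, w3]" using w by (auto simp: tripleton_conv)
    show "same_fillings L R w"
    proof (cases e)
      case (Cross c)
      have "w3 = (\<not> w1)" using L unfolding w rotate_cap Cross by (auto split: if_splits)
      thus ?thesis unfolding w rotate_cap Cross quarter_turn.simps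
        by (intro same_fillings_cupless3) (use rotate_cap_iff(1) L R w rotate_cap Cross in auto)
    next
      case Virt
      have "w3 = (\<not> w1)" using L unfolding w rotate_cap Virt by (auto split: if_splits)
      thus ?thesis unfolding w rotate_cap Virt quarter_turn.simps
        by (intro same_fillings_cupless3) (use rotate_cap_iff(2) L R w rotate_cap Virt in auto)
    next
      case (Mark m)
      have "w3 = w1 \<and> w2 = (\<not> w1)" using L unfolding w rotate_cap Mark by (auto split: if_splits)
      thus ?thesis unfolding w rotate_cap Mark quarter_turn.simps
        by (intro same_fillings_cupless3) (use rotate_cap_iff(3) L R w rotate_cap Mark in auto)
    qed (use rotate_cap in \<open>auto simp: four_valent_def\<close>)
  qed (use rotate_cap in \<open>cases e; auto simp: width_simps four_valent_def split: if_splits elim!: bind_eq_SomeE\<close>)+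
  thus ?thesis ..
next
  case (rotate_cup e b b')
  have "locally_equivalent 1 L R"
  proof (rule locally_equivalentI)
    fix w w' assume w: "length w = 1" and L: "run L w = Some w'" and R: "run R w = Some w'"
    obtain w1 where w: "w = [w1]" using w by (auto simp: length_Suc_conv)
    show "same_fillings L R w"
    proof (cases e)
      case (Cross c)
      have "b' = b" using L R unfolding w rotate_cup Cross by (auto split: if_splits)
      thus ?thesis unfolding w rotate_cup Cross using rotated_cup_fillings(1) by simp
    next
      case Virt
      have "b' = b" using L R unfolding w rotate_cup Virt by (auto split: if_splits)
      thus ?thesis unfolding w rotate_cup Virt using rotated_cup_fillings(2) by simp
    next
      case (Mark m)
      have "b = (\<not> w1) \<and> b' = w1" using L R unfolding w rotate_cup Mark by (auto split: if_splits)
      thus ?thesis unfolding w rotate_cup Mark using rotated_cup_fillings(3) by simp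
    qed (use rotate_cup in \<open>auto simp: four_valent_def\<close>)
  qed (use rotate_cup in \<open>cases e; auto simp: width_simps four_valent_def split: if_splits elim!: bind_eq_SomeE\<close>)+
  thus ?thesis ..
next
  case (exchange e d f)
  have "locally_equivalent (in_width e + d + in_width f) L R"
  proof (rule locally_equivalentI)
    fix n w w' assume "run (shift n R) w = Some w'"
    thus "n + (in_width e + d + in_width f) \<le> length w" unfolding exchange
      by (cases f) (auto simp: shift_def split: if_splits elim!: bind_eq_SomeE)
  qed (use exchange exchange_fillings in auto)
  thus ?thesis ..
qed

lemma reidemeister_locally_equivalent:
  assumes "reidemeister_move L R"
  shows "\<exists>m. locally_equivalent m L R"
  using assms
proof cases
  case (R1_right b c)
  have "locally_equivalent 1 L R"
  proof (rule locally_equivalentI)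
    fix w w' assume "length w = 1" "run L w = Some w'"
    then have "w = [b]" unfolding R1_right by (auto simp: length_Suc_conv eval_nat_numeral split: if_splits)
    thus "same_fillings L R w" using kink_right_removal R1_right by simp
  qed (auto simp: R1_right width_simps split: if_splits elim!: bind_eq_SomeE)
  thus ?thesis ..
next
  case (R1_left b c)
  have "locally_equivalent 1 L R"
  proof (rule locally_equivalentI)
    fix w w' assume "length w = 1" "run L w = Some w'"
    then have "w = [\<not> b]" unfolding R1_left by (auto simp: length_Suc_conv eval_nat_numeral split: if_splits)
    thus "same_fillings L R w" using kink_left_removal R1_left by simp
  qed (auto simp: R1_left width_simps split: if_splits elim!: bind_eq_SomeE)
  thus ?thesis ..
next
  case (R2 c)
  have "locally_equivalent 2 L R"
  proof (rule locally_equivalentI)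
    fix w w' assume w: "length w = 2" and L: "run L w = Some w'" and R: "run R w = Some w'"
    obtain w1 w2 where w: "w = [w1, w2]" using w by (auto simp: doubleton_conv)
    show "same_fillings L R w" unfolding w R2
      by (rule same_fillings_cupless2, rule R2_iff, assumption+) (use L R w R2 in auto)
  qed (auto simp: R2 width_simps split: if_splits elim!: bind_eq_SomeE)
  thus ?thesis ..
next
  case (R3 a b c)
  have "locally_equivalent 3 L R"
  proof (rule locally_equivalentI)
    fix w w' assume w: "length w = 3" and L: "run L w = Some w'" and R: "run R w = Some w'"
    obtain w1 w2 w3 where w: "w = [w1, w2, w3]" using w by (auto simp: tripleton_conv)
    show "same_fillings L R w" unfolding w R3(1,2)
      by (intro same_fillings_cupless3) (use R3_iff L R w R3 in auto)
  qed (auto simp: R3 width_simps split: if_splits elim!: bind_eq_SomeE)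
  thus ?thesis ..
qed

lemma virtual_locally_equivalent:
  assumes "virtual_move L R"
  shows "\<exists>m. locally_equivalent m L R"
  using assms
proof cases
  case (V1_right b)
  have "locally_equivalent 1 L R"
  proof (rule locally_equivalentI)
    fix w w' assume "length w = 1" "run L w = Some w'"
    then have "w = [b]" unfolding V1_right by (auto simp: length_Suc_conv eval_nat_numeral split: if_splits)
    thus "same_fillings L R w" using loops V1_right by simp
  qed (auto simp: V1_right width_simps split: if_splits elim!: bind_eq_SomeE)
  thus ?thesis ..
next
  case (V1_left b)
  have "locally_equivalent 1 L R"
  proof (rule locally_equivalentI)
    fix w w' assume "length w = 1" "run L w = Some w'"
    then have "w = [\<not> b]" unfolding V1_left by (auto simp: length_Suc_conv eval_nat_numeral split: if_splits)
    thus "same_fillings L R w" using loops V1_left by simp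
  qed (auto simp: V1_left width_simps split: if_splits elim!: bind_eq_SomeE)
  thus ?thesis ..
next
  case V2
  have "locally_equivalent 2 L R"
  proof (rule locally_equivalentI)
    fix w w' assume w: "length w = 2" and L: "run L w = Some w'" and R: "run R w = Some w'"
    obtain w1 w2 where w: "w = [w1, w2]" using w by (auto simp: doubleton_conv)
    show "same_fillings L R w" unfolding w V2
      by (intro same_fillings_cupless2) (use virtual_iff(1) L R w V2 in auto)
  qed (auto simp: V2 width_simps split: if_splits elim!: bind_eq_SomeE)
  thus ?thesis ..
next
  case V3
  have "locally_equivalent 3 L R"
  proof (rule locally_equivalentI)
    fix w w' assume w: "length w = 3" and L: "run L w = Some w'" and R: "run R w = Some w'"
    obtain w1 w2 w3 where w: "w = [w1, w2, w3]" using w by (auto simp: tripleton_conv)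
    show "same_fillings L R w" unfolding w V3
      by (intro same_fillings_cupless3) (use virtual_iff(2) L R w V3 in auto)
  qed (auto simp: V3 width_simps split: if_splits elim!: bind_eq_SomeE)
  thus ?thesis ..
next
  case (V4_left c)
  have "locally_equivalent 3 L R"
  proof (rule locally_equivalentI)
    fix w w' assume w: "length w = 3" and L: "run L w = Some w'" and R: "run R w = Some w'"
    obtain w1 w2 w3 where w: "w = [w1, w2, w3]" using w by (auto simp: tripleton_conv)
    show "same_fillings L R w" unfolding w V4_left
      by (intro same_fillings_cupless3) (use virtual_iff(3) L R w V4_left in auto)
  qed (auto simp: V4_left width_simps split: if_splits elim!: bind_eq_SomeE)
  thus ?thesis ..
next
  case (V4_middle c)
  have "locally_equivalent 3 L R"
  proof (rule locally_equivalentI)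
    fix w w' assume w: "length w = 3" and L: "run L w = Some w'" and R: "run R w = Some w'"
    obtain w1 w2 w3 where w: "w = [w1, w2, w3]" using w by (auto simp: tripleton_conv)
    show "same_fillings L R w" unfolding w V4_middle
      by (intro same_fillings_cupless3) (use virtual_iff(4) L R w V4_middle in auto)
  qed (auto simp: V4_middle width_simps split: if_splits elim!: bind_eq_SomeE)
  thus ?thesis ..
next
  case (V4_right c)
  have "locally_equivalent 3 L R"
  proof (rule locally_equivalentI)
    fix w w' assume w: "length w = 3" and L: "run L w = Some w'" and R: "run R w = Some w'"
    obtain w1 w2 w3 where w: "w = [w1, w2, w3]" using w by (auto simp: tripleton_conv)
    show "same_fillings L R w" unfolding w V4_right
      by (intro same_fillings_cupless3) (use virtual_iff(5) L R w V4_right in auto)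
  qed (auto simp: V4_right width_simps split: if_splits elim!: bind_eq_SomeE)
  thus ?thesis ..
qed
lemma yoshikawa_locally_equivalent:
  assumes "yoshikawa_move L R"
  shows "\<exists>m. locally_equivalent m L R"
  using assms
proof cases
  case (Y4_left c m)
  have "locally_equivalent 3 L R"
  proof (rule locally_equivalentI)
    fix w w' assume w: "length w = 3" and L: "run L w = Some w'" and R: "run R w = Some w'"
    obtain w1 w2 w3 where w: "w = [w1, w2, w3]" using w by (auto simp: tripleton_conv)
    have "w3 = (\<not> w2)" using L R unfolding w Y4_left by (auto split: if_splits)
    thus "same_fillings L R w" unfolding w Y4_left
      by (intro same_fillings_cupless3) (use Y4_left_iff L R w Y4_left in \<open>auto\<close>)
  qed (auto simp: Y4_left width_simps split: if_splits elim!: bind_eq_SomeE)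
  thus ?thesis ..
next
  case (Y4_right c m)
  have "locally_equivalent 3 L R"
  proof (rule locally_equivalentI)
    fix w w' assume w: "length w = 3" and L: "run L w = Some w'" and R: "run R w = Some w'"
    obtain w1 w2 w3 where w: "w = [w1, w2, w3]" using w by (auto simp: tripleton_conv)
    have "w2 = (\<not> w1)" using L R unfolding w Y4_right by (auto split: if_splits)
    thus "same_fillings L R w" unfolding w Y4_right
      by (intro same_fillings_cupless3) (use Y4_right_iff L R w Y4_right in \<open>auto\<close>)
  qed (auto simp: Y4_right width_simps split: if_splits elim!: bind_eq_SomeE)
  thus ?thesis ..
next
  case (Y5 m c)
  have "locally_equivalent 2 L R"
  proof (rule locally_equivalentI)
    fix w w' assume w: "length w = 2" and L: "run L w = Some w'" and R: "run R w = Some w'"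
    obtain w1 w2 where w: "w = [w1, w2]" using w by (auto simp: doubleton_conv)
    have "w2 = (\<not> w1)" using L R unfolding w Y5 by (auto split: if_splits)
    thus "same_fillings L R w" unfolding w Y5
      by (intro same_fillings_cupless2) (use Y5_iff L R w Y5 in \<open>auto\<close>)
  qed (auto simp: Y5 width_simps split: if_splits elim!: bind_eq_SomeE)
  thus ?thesis ..
next
  case (Y6_right b m)
  have "locally_equivalent 1 L R"
  proof (rule locally_equivalentI)
    fix w w' assume "length w = 1" "run L w = Some w'"
    then have "w = [\<not> b]" unfolding Y6_right by (auto simp: length_Suc_conv eval_nat_numeral split: if_splits)
    thus "same_fillings L R w" using loops Y6_right by simp
  qed (auto simp: Y6_right width_simps split: if_splits elim!: bind_eq_SomeE)
  thus ?thesis ..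
next
  case (Y6_left b m)
  have "locally_equivalent 1 L R"
  proof (rule locally_equivalentI)
    fix w w' assume "length w = 1" "run L w = Some w'"
    then have "w = [b]" unfolding Y6_left by (auto simp: length_Suc_conv eval_nat_numeral split: if_splits)
    thus "same_fillings L R w" using loops Y6_left by simp
  qed (auto simp: Y6_left width_simps split: if_splits elim!: bind_eq_SomeE)
  thus ?thesis ..
next
  case (Y7 m)
  have "locally_equivalent 3 L R"
  proof (rule locally_equivalentI)
    fix w w' assume w: "length w = 3" and L: "run L w = Some w'" and R: "run R w = Some w'"
    obtain w1 w2 w3 where w: "w = [w1, w2, w3]" using w by (auto simp: tripleton_conv)
    have "w2 = (\<not> w1) \<and> w3 = w1" using L R unfolding w Y7 by (auto split: if_splits)
    thus "same_fillings L R w" unfolding w Y7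
      by (intro same_fillings_cupless3) (use Y7_iff L R w Y7 in \<open>auto\<close>)
  qed (auto simp: Y7 width_simps split: if_splits elim!: bind_eq_SomeE)
  thus ?thesis ..
next
  case (Y8 m c)
  have "locally_equivalent 4 L R"
  proof (rule locally_equivalentI)
    fix w w' assume w: "length w = 4" and L: "run L w = Some w'" and R: "run R w = Some w'"
    obtain w1 w2 w3 w4 where w: "w = [w1, w2, w3, w4]" using w by (auto simp: length_Suc_conv eval_nat_numeral)
    have ori: "w2 = (\<not> w1)" "w4 = (\<not> w3)" using L unfolding w Y8
      by (auto simp: eval_nat_numeral double_crossing_def split: if_splits elim!: bind_eq_SomeE)
    show "same_fillings L R w"
      unfolding w
    proof (rule same_fillings_cupless4)
      fix x y z u ys assume "x \<in> X" "y \<in> X" "z \<in> X" "u \<in> X"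
      thus "(\<exists>css. crun L [w1, w2, w3, w4] [x, y, z, u] css ys) \<longleftrightarrow>
          (\<exists>css. crun R [w1, w2, w3, w4] [x, y, z, u] css ys)"
        unfolding ori Y8 by (simp only: Y8_iff)
    qed (use L R w Y8 in \<open>auto simp: double_crossing_def\<close>)
  qed (auto simp: Y8 width_simps double_crossing_def split: if_splits elim!: bind_eq_SomeE)
  thus ?thesis ..
qed
end

section \<open>The effect of a move on closed diagrams\<close>

lemma colored_run_last: "colored_run X un ov D w xs css ys \<Longrightarrow> ys = last (xs # css)"
  by (induction D arbitrary: w xs css) auto

definition biquandle_hom where
  "biquandle_hom X un ov X' un' ov' h \<longleftrightarrow>
     (\<forall>x\<in>X. h x \<in> X') \<and>
     (\<forall>x\<in>X. \<forall>y\<in>X. h (un x y) = un' (h x) (h y) \<and> h (ov x y) = ov' (h x) (h y))"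

lemma crossing_rel_map:
  assumes "biquandle_hom X un ov X' un' ov' h" "crossing_rel un ov c a b x y p q"
    "x \<in> X" "y \<in> X" "p \<in> X" "q \<in> X"
  shows "crossing_rel un' ov' c a b (h x) (h y) (h p) (h q)"
  using assms by (cases a; cases b; cases c) (auto simp: crossing_rel_def biquandle_hom_def)

lemma step_map:
  assumes h: "biquandle_hom X un ov X' un' ov' h" and "step un ov x w xs ys" "run_slice x w = Some w'"
    "length xs = length w" "set xs \<subseteq> X" "set ys \<subseteq> X"
  shows "step un' ov' x w (map h xs) (map h ys)"
proof -
  obtain i e where x: "x = (i, e)" by fastforce
  show ?thesis
  proof (cases e)
    case (Cross c)
    have i: "i + 1 < length xs" using assms x Cross by (auto split: if_splits)
    from assms(2) obtain p q where pq: "ys = xs[i := p, i + 1 := q]"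
      "crossing_rel un ov c (w ! i) (w ! (i + 1)) (xs ! i) (xs ! (i + 1)) p q"
      using x Cross by auto
    have "ys ! i = p" "ys ! (i + 1) = q" "length ys = length xs" using pq i by auto
    hence "p \<in> X" "q \<in> X" using i assms(6) nth_mem by (metis add_lessD1 subsetD)+
    moreover have "xs ! i \<in> X" "xs ! (i + 1) \<in> X" using i assms(5) by auto
    ultimately have "crossing_rel un' ov' c (w ! i) (w ! (i + 1)) (h (xs ! i)) (h (xs ! (i + 1))) (h p) (h q)"
      using crossing_rel_map[OF h] pq by blast
    thus ?thesis unfolding x Cross step.simps
      by (intro exI[of _ "h p"] exI[of _ "h q"]) (use pq i in \<open>auto simp: map_update\<close>)
  qed (use assms x in \<open>auto simp: take_map drop_map map_update split: if_splits\<close>)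
qed

lemma colored_run_map:
  assumes "biquandle_hom X un ov X' un' ov' h" "colored_run X un ov D w xs css ys"
    "run D w = Some w'" "length xs = length w" "set xs \<subseteq> X"
  shows "colored_run X' un' ov' D w (map h xs) (map (map h) css) (map h ys)"
  using assms(2-)
proof (induction D arbitrary: w xs css)
  case (Cons x D)
  obtain w1 where w1: "run_slice x w = Some w1" "run D w1 = Some w'"
    using Cons.prems by (auto split: bind_splits)
  obtain zs cs where 1: "css = zs # cs" "set zs \<subseteq> X" "step un ov x w xs zs"
    "colored_run X un ov D w1 zs cs ys" using Cons.prems(1) w1 by auto
  have "set (map h zs) \<subseteq> X'" using 1(2) assms(1) by (auto simp: biquandle_hom_def)
  moreover have "step un' ov' x w (map h xs) (map h zs)"
    using step_map[OF assms(1) 1(3) w1(1)] Cons.prems 1 by blast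
  moreover have "colored_run X' un' ov' D w1 (map h zs) (map (map h) cs) (map h ys)"
    using Cons.IH[OF 1(4) w1(2)] step_length[OF 1(3) w1(1)] Cons.prems 1 by auto
  ultimately show ?case using 1 w1 by auto
qed simp

definition closed_runs where
  "closed_runs X un ov D = {css. colored_run X un ov D [] [] css []}"

context biquandle_on begin

text \<open>
  Transfer of uniqueness and existence of fillings from the strands of the move to a whole level.
\<close>

lemma shifted_fillings:
  assumes eq: "locally_equivalent m L R"
    and L: "run (shift n L) w = Some w'" and R: "run (shift n R) w = Some w'"
    and xs: "length xs = length w" "set xs \<subseteq> X"
  shows "(\<exists>css. crun (shift n L) w xs css ys) \<longleftrightarrow> (\<exists>css. crun (shift n R) w xs css ys)"
    and "crun (shift n L) w xs css ys \<Longrightarrow> crun (shift n L) w xs css' ys \<Longrightarrow> css = css'"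
    and "crun (shift n R) w xs css ys \<Longrightarrow> crun (shift n R) w xs css' ys \<Longrightarrow> css = css'"
proof -
  have fit: "fits m L" "fits m R" and len: "n + m \<le> length w"
    using eq L R unfolding locally_equivalent_def by blast+
  define u a v where "u = take n w" and "a = take m (drop n w)" and "v = drop (n + m) w"
  define ps zs qs where "ps = take n xs" and "zs = take m (drop n xs)" and "qs = drop (n + m) xs"
  have w: "w = u @ a @ v" "length u = n" "length a = m"
    using len by (auto simp: u_def a_def v_def) (metis append_take_drop_id add.commute drop_drop)
  have x: "xs = ps @ zs @ qs" "length ps = n" "length zs = m"
    using len xs by (auto simp: ps_def zs_def qs_def) (metis append_take_drop_id add.commute drop_drop)
  hence sub: "set ps \<subseteq> X" "set zs \<subseteq> X" "set qs \<subseteq> X" using xs(2) by auto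
  obtain b where b: "run L a = Some b" "w' = u @ b @ v"
    using L run_frame[of a L u v] fit(1) w by (cases "run L a") auto
  have b': "run R a = Some b"
    using R run_frame[of a R u v] fit(2) w b by (cases "run R a") auto
  have same: "same_fillings L R a"
    using eq w(3) b(1) b' unfolding locally_equivalent_def by blast
  have Lx: "crun (shift n L) w xs css ys \<longleftrightarrow>
      (\<exists>cs zs'. css = map (\<lambda>y. ps @ y @ qs) cs \<and> ys = ps @ zs' @ qs \<and> crun L a zs cs zs')" for css ys
    unfolding w(1) x(1) w(2)[symmetric] using fit b w x sub by (intro colored_run_frame) auto
  have Rx: "crun (shift n R) w xs css ys \<longleftrightarrow>
      (\<exists>cs zs'. css = map (\<lambda>y. ps @ y @ qs) cs \<and> ys = ps @ zs' @ qs \<and> crun R a zs cs zs')" for css ys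
    unfolding w(1) x(1) w(2)[symmetric] using fit b' w x sub by (intro colored_run_frame) auto
  have zs: "length zs = length a" using w x by simp
  have s: "(\<exists>css. crun L a zs css ys) \<longleftrightarrow> (\<exists>css. crun R a zs css ys)"
     "crun L a zs css ys \<Longrightarrow> crun L a zs css' ys \<Longrightarrow> css = css'"
     "crun R a zs css ys \<Longrightarrow> crun R a zs css' ys \<Longrightarrow> css = css'" for css css' ys
    using same zs sub(2) unfolding same_fillings_def by blast+
  show "(\<exists>css. crun (shift n L) w xs css ys) \<longleftrightarrow> (\<exists>css. crun (shift n R) w xs css ys)"
    unfolding Lx Rx using s(1) by blast
  show "crun (shift n L) w xs css ys \<Longrightarrow> crun (shift n L) w xs css' ys \<Longrightarrow> css = css'"
    unfolding Lx using s(2) by force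
  show "crun (shift n R) w xs css ys \<Longrightarrow> crun (shift n R) w xs css' ys \<Longrightarrow> css = css'"
    unfolding Rx using s(3) by force
qed

end

text \<open>
  The graph of the bijection induced by a move: nothing changes on the levels of the common parts,
  including the two levels that bound the replaced part. The relation mentions neither the
  biquandle nor its operations, and this is the reason for naturality.
\<close>

definition agree_outside :: "nat \<Rightarrow> nat \<Rightarrow> 'a list list \<Rightarrow> 'a list list \<Rightarrow> bool" where
  "agree_outside k l css css' \<longleftrightarrow>
     (\<exists>ca cl cl' cb. css = ca @ cl @ cb \<and> css' = ca @ cl' @ cb \<and> length ca = k \<and> length cb = l \<and>
        last ([] # ca @ cl) = last ([] # ca @ cl'))"

lemma agree_outside_sym: "agree_outside k l css css' \<longleftrightarrow> agree_outside k l css' css"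
  unfolding agree_outside_def by metis

lemma agree_outside_map:
  assumes "agree_outside k l css css'"
  shows "agree_outside k l (map (map h) css) (map (map h) css')"
proof -
  obtain ca cl cl' cb where 1: "css = ca @ cl @ cb" "css' = ca @ cl' @ cb" "length ca = k" "length cb = l"
    "last ([] # ca @ cl) = last ([] # ca @ cl')" using assms unfolding agree_outside_def by blast
  have last: "last ([] # map (map h) cs) = map h (last ([] # cs))" for cs
    by (simp add: last_map)
  show ?thesis unfolding agree_outside_def
    by (rule exI[of _ "map (map h) ca"], rule exI[of _ "map (map h) cl"],
        rule exI[of _ "map (map h) cl'"], rule exI[of _ "map (map h) cb"])
      (use 1 last[of "ca @ cl"] last[of "ca @ cl'"] in auto)
qed

context biquandle_on begin

text \<open>
  The run is cut at the two levels that bound the replaced part; the filling in between is exchanged for the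
  unique one of the other tangle.
\<close>

lemma replace_filling:
  assumes fill: "\<And>xs ys. length xs = length w \<Longrightarrow> set xs \<subseteq> X \<Longrightarrow> \<exists>css. crun L w xs css ys \<Longrightarrow>
      \<exists>!css. crun R w xs css ys"
    and A: "run A [] = Some w" and L: "run L w = Some w'" and R: "run R w = Some w'"
    and B: "run B w' = Some []"
    and css: "css \<in> closed_runs X un ov (A @ L @ B)"
  shows "\<exists>!css'. css' \<in> closed_runs X un ov (A @ R @ B) \<and> agree_outside (length A) (length B) css css'"
proof -
  have L': "crun (A @ L @ B) [] [] css [] \<longleftrightarrow> (\<exists>ca cl cb xs ys. css = ca @ cl @ cb \<and> crun A [] [] ca xs \<and>
     crun L w xs cl ys \<and> crun B w' ys cb [])" for css
    by (simp only: colored_run_append[OF A, of X un ov "L @ B"] colored_run_append[OF L, of X un ov B])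
      blast
  have R': "crun (A @ R @ B) [] [] css [] \<longleftrightarrow> (\<exists>ca cl cb xs ys. css = ca @ cl @ cb \<and> crun A [] [] ca xs \<and>
     crun R w xs cl ys \<and> crun B w' ys cb [])" for css
    by (simp only: colored_run_append[OF A, of X un ov "R @ B"] colored_run_append[OF R, of X un ov B])
      blast
  obtain ca cl cb xs ys where 1: "css = ca @ cl @ cb" "crun A [] [] ca xs" "crun L w xs cl ys"
    "crun B w' ys cb []" using css L' unfolding closed_runs_def by blast
  have xs: "length xs = length w" "length ca = length A" "set xs \<subseteq> X"
    using colored_run_length[OF 1(2) A] colored_run_closed[OF 1(2)] by auto
  have ys: "length cl = length L" "length ys = length w'" using colored_run_length[OF 1(3) L xs(1)] by auto
  have cb: "length cb = length B" using colored_run_length[OF 1(4) B ys(2)] by auto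
  have last: "xs = last ([] # ca)" "ys = last (xs # cl)"
    using colored_run_last[OF 1(2)] colored_run_last[OF 1(3)] by auto
  obtain cl' where cl': "crun R w xs cl' ys" and uniq: "\<And>c. crun R w xs c ys \<Longrightarrow> c = cl'"
    using fill[OF xs(1,3)] 1(3) by blast
  \<comment> \<open>the level below the replaced part is \<open>xs\<close>, even if the part before it is empty\<close>
  have l: "last ([] # ca @ cs) = last (xs # cs)" for cs using last(1) by simp
  show ?thesis
  proof (rule ex1I[of _ "ca @ cl' @ cb"], intro conjI)
    show "ca @ cl' @ cb \<in> closed_runs X un ov (A @ R @ B)"
      unfolding closed_runs_def using R' 1 cl' by blast
    show "agree_outside (length A) (length B) css (ca @ cl' @ cb)"
      unfolding agree_outside_def using 1(1) xs(2) cb l last(2) colored_run_last[OF cl'] by metis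
  next
    fix css' assume *: "css' \<in> closed_runs X un ov (A @ R @ B) \<and> agree_outside (length A) (length B) css css'"
    then obtain ca2 cl2 cb2 xs2 ys2 where 2: "css' = ca2 @ cl2 @ cb2" "crun A [] [] ca2 xs2"
      "crun R w xs2 cl2 ys2" "crun B w' ys2 cb2 []" using R' unfolding closed_runs_def by blast
    have len2: "length xs2 = length w" "length ca2 = length A" "length cl2 = length R" "length ys2 = length w'"
      "length cb2 = length B"
      using colored_run_length[OF 2(2) A] colored_run_length[OF 2(3) R] colored_run_length[OF 2(4) B] by auto
    obtain ca3 cl3 cl3' cb3 where 3: "css = ca3 @ cl3 @ cb3" "css' = ca3 @ cl3' @ cb3"
      "length ca3 = length A" "length cb3 = length B" "last ([] # ca3 @ cl3) = last ([] # ca3 @ cl3')"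
      using * unfolding agree_outside_def by blast
    have a: "ca3 = ca" "ca3 = ca2" using 1(1) 2(1) 3 xs(2) len2 by (metis append_eq_append_conv)+
    have b: "cl3 = cl" "cb3 = cb" "cl3' = cl2" "cb3 = cb2"
      using 1(1) 2(1) 3 a cb len2 by auto
    have "xs2 = xs" using last(1) colored_run_last[OF 2(2)] a by simp
    moreover have "ys2 = ys"
      using 3(5) colored_run_last[OF 2(3)] last a b l calculation by metis
    ultimately have "cl2 = cl'" using uniq 2(3) by blast
    thus "css' = ca @ cl' @ cb" using 2(1) a b by simp
  qed
qed

theorem local_change_closed_runs:
  assumes "locally_equivalent m L R"
    and "run A [] = Some w" "run (shift n L) w = Some w'" "run (shift n R) w = Some w'" "run B w' = Some []"
  shows "css \<in> closed_runs X un ov (A @ shift n L @ B) \<Longrightarrow>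
      \<exists>!css'. css' \<in> closed_runs X un ov (A @ shift n R @ B) \<and> agree_outside (length A) (length B) css css'"
    and "css' \<in> closed_runs X un ov (A @ shift n R @ B) \<Longrightarrow>
      \<exists>!css. css \<in> closed_runs X un ov (A @ shift n L @ B) \<and> agree_outside (length A) (length B) css css'"
proof -
  note S = shifted_fillings[OF assms(1,3,4)]
  show "css \<in> closed_runs X un ov (A @ shift n L @ B) \<Longrightarrow>
      \<exists>!css'. css' \<in> closed_runs X un ov (A @ shift n R @ B) \<and> agree_outside (length A) (length B) css css'"
    by (rule replace_filling[OF _ assms(2-5)]) (use S in blast)
  show "css' \<in> closed_runs X un ov (A @ shift n R @ B) \<Longrightarrow>
      \<exists>!css. css \<in> closed_runs X un ov (A @ shift n L @ B) \<and> agree_outside (length A) (length B) css css'"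
    unfolding agree_outside_sym[of _ _ _ css']
    by (rule replace_filling[OF _ assms(2,4,3,5)]) (use S in blast)
qed

end

section \<open>Colorings of semiarcs as colored runs\<close>

text \<open>
  The conditions on the right are those imposed by the definitions of semiarcs and of colorings.
\<close>

lemma step_iff_pointwise:
  assumes "run_slice (i, e) w = Some w'" "length xs = length w" "length ys = length w'"
  shows "step un ov (i, e) w xs ys \<longleftrightarrow>
    (\<forall>p<i. xs ! p = ys ! p) \<and>
    (\<forall>p. i \<le> p \<longrightarrow> p + in_width e < length w \<longrightarrow> xs ! (p + in_width e) = ys ! (p + out_width e)) \<and>
    (\<forall>b. e = Cup b \<longrightarrow> ys ! i = ys ! (i + 1)) \<and>
    (e = Cap \<longrightarrow> xs ! i = xs ! (i + 1)) \<and>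
    (e = Virt \<longrightarrow> xs ! i = ys ! (i + 1) \<and> xs ! (i + 1) = ys ! i) \<and>
    (\<forall>c. e = Cross c \<longrightarrow>
       crossing_rel un ov c (w ! i) (w ! (i + 1)) (xs ! i) (xs ! (i + 1)) (ys ! i) (ys ! (i + 1))) \<and>
    (\<forall>m. e = Mark m \<longrightarrow> xs ! i = xs ! (i + 1) \<and> xs ! (i + 1) = ys ! i \<and> ys ! i = ys ! (i + 1))"
proof -
  have two: "ys = xs[i := p, i + 1 := q] \<longleftrightarrow> (\<forall>j<i. xs ! j = ys ! j) \<and>
      (\<forall>j. i \<le> j \<longrightarrow> j + 2 < length w \<longrightarrow> xs ! (j + 2) = ys ! (j + 2)) \<and> ys ! i = p \<and> ys ! (i + 1) = q"
    (is "_ \<longleftrightarrow> ?R")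
    if "i + 1 < length w" "length w' = length w" for p q
  proof
    assume ?R
    show "ys = xs[i := p, i + 1 := q]"
    proof (rule nth_equalityI)
      fix j assume "j < length ys"
      moreover have "j < i \<or> j = i \<or> j = i + 1 \<or> (\<exists>k\<ge>i. j = k + 2)" by presburger
      ultimately show "ys ! j = xs[i := p, i + 1 := q] ! j"
        using \<open>?R\<close> that assms by (auto simp: nth_list_update)
    qed (use assms that in simp)
  qed (use assms that in \<open>auto simp: nth_list_update\<close>)
  show ?thesis
  proof (cases e)
    case (Cup b)
    hence i: "i \<le> length xs" and len: "length ys = length xs + 2" using assms by (auto split: if_splits)
    have "(\<exists>x. ys = take i xs @ [x, x] @ drop i xs) \<longleftrightarrow> (\<forall>p<i. xs ! p = ys ! p) \<and>
      (\<forall>p. i \<le> p \<longrightarrow> p < length w \<longrightarrow> xs ! p = ys ! (p + 2)) \<and> ys ! i = ys ! (i + 1)" (is "?l \<longleftrightarrow> ?R")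
    proof
      assume ?l thus ?R using i assms(2) by (auto simp: nth_append)
    next
      assume R: ?R
      have "ys = take i xs @ [ys ! i, ys ! i] @ drop i xs"
      proof (rule nth_equalityI)
        fix j assume "j < length ys"
        moreover have "j < i \<or> j = i \<or> j = i + 1 \<or> (\<exists>k\<ge>i. j = k + 2)" by presburger
        ultimately show "ys ! j = (take i xs @ [ys ! i, ys ! i] @ drop i xs) ! j"
          using R i len assms(2) by (auto simp: nth_append)
      qed (use i len in simp)
      thus ?l by blast
    qed
    thus ?thesis using Cup by simp
  next
    case Cap
    hence i: "i + 1 < length xs" and len: "length xs = length ys + 2" using assms by (auto split: if_splits)
    have "ys = take i xs @ drop (i + 2) xs \<longleftrightarrow> (\<forall>p<i. xs ! p = ys ! p) \<and>
      (\<forall>p. i \<le> p \<longrightarrow> p + 2 < length w \<longrightarrow> xs ! (p + 2) = ys ! p)" (is "?l \<longleftrightarrow> ?R")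
    proof
      assume ?l thus ?R using i assms(2) by (auto simp: nth_append add.commute)
    next
      assume R: ?R
      show ?l
      proof (rule nth_equalityI)
        fix j assume "j < length ys"
        thus "ys ! j = (take i xs @ drop (i + 2) xs) ! j"
          using R i len assms(2) by (cases "j < i") (auto simp: nth_append add.commute)
      qed (use i len in simp)
    qed
    thus ?thesis using Cap by auto
  next
    case (Cross c)
    hence "i + 1 < length w" "length w' = length w" using assms by (auto split: if_splits)
    note two[OF this]
    thus ?thesis using Cross by auto
  next
    case Virt
    hence "i + 1 < length w" "length w' = length w" using assms by (auto split: if_splits)
    note two[OF this]
    thus ?thesis using Virt by auto
  next
    case (Mark m)
    hence i: "i + 1 < length w" "length w' = length w" using assms by (auto split: if_splits)
    have eq: "ys = xs \<longleftrightarrow> (\<forall>j<i. xs ! j = ys ! j) \<and>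
      (\<forall>j. i \<le> j \<longrightarrow> j + 2 < length w \<longrightarrow> xs ! (j + 2) = ys ! (j + 2)) \<and>
      ys ! i = xs ! i \<and> ys ! (i + 1) = xs ! (i + 1)"
      using two[OF i, of "xs ! i" "xs ! (i + 1)"] unfolding list_update_id .
    show ?thesis unfolding Mark step.simps eq by auto
  qed
qed

lemma colored_run_iff_steps:
  assumes "run D w = Some w'"
  shows "colored_run X un ov D w xs css ys \<longleftrightarrow>
    length css = length D \<and> ys = last (xs # css) \<and>
    (\<forall>l<length D. set (css ! l) \<subseteq> X \<and>
       step un ov (D ! l) (the (run (take l D) w)) ((xs # css) ! l) (css ! l))"
  using assms
proof (induction D arbitrary: w xs css)
  case (Cons x D)
  obtain w1 where w1: "run_slice x w = Some w1" "run D w1 = Some w'"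
    using Cons.prems by (auto split: bind_splits)
  show ?case
  proof (cases css)
    case (Cons zs cs)
    show ?thesis
      using Cons.IH[OF w1(2), of zs cs] w1(1) by (auto simp: Cons All_less_Suc2)
  qed simp
qed auto

text \<open>
  The intermediate form between colorings of semiarcs and runs: a color for each point where a strand meets a
  level.
\<close>

definition point_coloring where
  "point_coloring X un ov D c \<longleftrightarrow>
     (\<forall>a\<in>points D. c a \<in> X) \<and> (\<forall>(a, b)\<in>joined D. c a = c b) \<and>
     (\<forall>l i k. l < length D \<longrightarrow> D ! l = (i, Cross k) \<longrightarrow>
        crossing_rel un ov k (level D l ! i) (level D l ! (i + 1))
          (c (l, i)) (c (l, i + 1)) (c (l + 1, i)) (c (l + 1, i + 1))) \<and>
     (\<forall>l i m. l < length D \<longrightarrow> D ! l = (i, Mark m) \<longrightarrow>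
        c (l, i) = c (l, i + 1) \<and> c (l, i + 1) = c (l + 1, i) \<and> c (l + 1, i) = c (l + 1, i + 1))"

lemma joinedI:
  assumes "l < length D" "D ! l = (i, e)"
  shows "p < i \<Longrightarrow> ((l, p), (l + 1, p)) \<in> joined D"
    and "i \<le> p \<Longrightarrow> p + in_width e < length (level D l) \<Longrightarrow>
      ((l, p + in_width e), (l + 1, p + out_width e)) \<in> joined D"
    and "e = Cup b \<Longrightarrow> ((l + 1, i), (l + 1, i + 1)) \<in> joined D"
    and "e = Cap \<Longrightarrow> ((l, i), (l, i + 1)) \<in> joined D"
    and "e = Virt \<Longrightarrow> ((l, i), (l + 1, i + 1)) \<in> joined D"
    and "e = Virt \<Longrightarrow> ((l, i + 1), (l + 1, i)) \<in> joined D"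
proof -
  show "((l, p), (l + 1, p)) \<in> joined D" if "p < i"
    unfolding joined_def by (intro UnI1, intro CollectI exI conjI, rule refl, use assms that in simp_all)
  show "((l, p + in_width e), (l + 1, p + out_width e)) \<in> joined D" if "i \<le> p" "p + in_width e < length (level D l)"
    unfolding joined_def by (rule UnI1, rule UnI1, rule UnI1, rule UnI1, rule UnI2, intro CollectI exI conjI, rule refl, use assms that in simp_all)
  show "((l + 1, i), (l + 1, i + 1)) \<in> joined D" if "e = Cup b"
    unfolding joined_def by (rule UnI1, rule UnI1, rule UnI1, rule UnI2, intro CollectI exI conjI, rule refl, use assms that in simp_all)
  show "((l, i), (l, i + 1)) \<in> joined D" if "e = Cap"
    unfolding joined_def by (rule UnI1, rule UnI1, rule UnI2, intro CollectI exI conjI, rule refl, use assms that in simp_all)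
  show "((l, i), (l + 1, i + 1)) \<in> joined D" if "e = Virt"
    unfolding joined_def by (rule UnI1, rule UnI2, intro CollectI exI conjI, rule refl, use assms that in simp_all)
  show "((l, i + 1), (l + 1, i)) \<in> joined D" if "e = Virt"
    unfolding joined_def by (rule UnI2, intro CollectI exI conjI, rule refl, use assms that in simp_all)
qed

lemma point_coloring_iff_levels:
  "point_coloring X un ov D c \<longleftrightarrow> (\<forall>a\<in>points D. c a \<in> X) \<and>
    (\<forall>l i e. l < length D \<longrightarrow> D ! l = (i, e) \<longrightarrow>
    (\<forall>p<i. c (l, p) = c (l + 1, p)) \<and>
    (\<forall>p. i \<le> p \<longrightarrow> p + in_width e < length (level D l) \<longrightarrow>
       c (l, p + in_width e) = c (l + 1, p + out_width e)) \<and>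
    (\<forall>b. e = Cup b \<longrightarrow> c (l + 1, i) = c (l + 1, i + 1)) \<and>
    (e = Cap \<longrightarrow> c (l, i) = c (l, i + 1)) \<and>
    (e = Virt \<longrightarrow> c (l, i) = c (l + 1, i + 1) \<and> c (l, i + 1) = c (l + 1, i)) \<and>
    (\<forall>k. e = Cross k \<longrightarrow> crossing_rel un ov k (level D l ! i) (level D l ! (i + 1))
          (c (l, i)) (c (l, i + 1)) (c (l + 1, i)) (c (l + 1, i + 1))) \<and>
    (\<forall>m. e = Mark m \<longrightarrow>
        c (l, i) = c (l, i + 1) \<and> c (l, i + 1) = c (l + 1, i) \<and> c (l + 1, i) = c (l + 1, i + 1)))"
  (is "_ \<longleftrightarrow> ?R")
proof
  assume *: "point_coloring X un ov D c"
  hence j: "c a = c b" if "(a, b) \<in> joined D" for a b using that unfolding point_coloring_def by blast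
  show ?R
  proof (intro conjI allI impI ballI, goal_cases)
    case 1 thus ?case using * unfolding point_coloring_def by blast
  next
    case (2 l i e p) show ?case by (rule j, rule joinedI(1)) (use 2 in auto)
  next
    case (3 l i e p) show ?case by (rule j, rule joinedI(2)) (use 3 in auto)
  next
    case (4 l i e b) show ?case by (rule j, rule joinedI(3)) (use 4 in auto)
  next
    case (5 l i e) show ?case by (rule j, rule joinedI(4)) (use 5 in auto)
  next
    case (6 l i e) show ?case by (rule j, rule joinedI(5)) (use 6 in auto)
  next
    case (7 l i e) show ?case by (rule j, rule joinedI(6)) (use 7 in auto)
  next
    case (8 l i e k) thus ?case using * unfolding point_coloring_def by simp
  next
    case (9 l i e m) thus ?case using * unfolding point_coloring_def by simp
  next
    case (10 l i e m) thus ?case using * unfolding point_coloring_def by simp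
  next
    case (11 l i e m) thus ?case using * unfolding point_coloring_def by simp
  qed
next
  assume R: ?R
  note at = R[THEN conjunct2, THEN spec, THEN spec, THEN spec, THEN mp, THEN mp]
  have "c a = c b" if "(a, b) \<in> joined D" for a b
    using that unfolding joined_def
  proof (elim UnE CollectE exE conjE, goal_cases)
    case (1 l p)
    thus ?case using at[of l "fst (D ! l)" "snd (D ! l)"] by simp
  next
    case (2 l p i e)
    thus ?case using at[of l i e] by simp
  next
    case (3 l i b)
    thus ?case using at[of l i "Cup b"] by simp
  next
    case (4 l i)
    thus ?case using at[of l i Cap] by simp
  next
    case (5 l i)
    thus ?case using at[of l i Virt] by simp
  next
    case (6 l i)
    thus ?case using at[of l i Virt] by simp
  qed
  moreover have "crossing_rel un ov k (level D l ! i) (level D l ! (i + 1))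
          (c (l, i)) (c (l, i + 1)) (c (l + 1, i)) (c (l + 1, i + 1))"
    if "l < length D" "D ! l = (i, Cross k)" for l i k
    using at[OF that] by simp
  moreover have "c (l, i) = c (l, i + 1) \<and> c (l, i + 1) = c (l + 1, i) \<and> c (l + 1, i) = c (l + 1, i + 1)"
    if "l < length D" "D ! l = (i, Mark m)" for l i m
    using at[OF that] by simp
  ultimately show "point_coloring X un ov D c"
    using R[THEN conjunct1] unfolding point_coloring_def by blast
qed

lemma level_0: "level D 0 = []"
  by (simp add: level_def)

lemma oriented_prefix:
  assumes "oriented_diagram D" "l \<le> length D"
  shows "run (take l D) [] = Some (level D l)"
proof -
  have "run (take l D @ drop l D) [] = Some []" using assms by (simp add: oriented_diagram_def)
  thus ?thesis unfolding run_append level_def by (auto split: bind_splits)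
qed

lemma oriented_step:
  assumes "oriented_diagram D" "l < length D"
  shows "run_slice (D ! l) (level D l) = Some (level D (l + 1))"
proof -
  have "run (take (l + 1) D) [] = Some (level D (l + 1))"
    by (rule oriented_prefix) (use assms in auto)
  moreover have "take (l + 1) D = take l D @ [D ! l]" using assms by (simp add: take_Suc_conv_app_nth)
  ultimately show ?thesis using oriented_prefix[OF assms(1), of l] assms(2)
    by (simp add: run_append split: bind_splits)
qed

lemma level_last: "oriented_diagram D \<Longrightarrow> level D (length D) = []"
  by (simp add: level_def oriented_diagram_def)

lemma run_slice_width: "run_slice (i, e) w = Some w' \<Longrightarrow> i + in_width e \<le> length w"
  by (cases e) (auto split: if_splits)

text \<open>
  Points outside the diagram cannot connect points of it, because the joining relation stays inside when the
  diagram is oriented.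
\<close>

lemma joined_points:
  assumes D: "oriented_diagram D" and "(a, b) \<in> joined D"
  shows "a \<in> points D \<and> b \<in> points D"
proof -
  have *: "i + in_width e \<le> length (level D l) \<and>
      length (level D (l + 1)) = length (level D l) + out_width e - in_width e"
    if "l < length D" "D ! l = (i, e)" for l i e
    using oriented_step[OF D that(1)] that(2) run_slice_width run_slice_length by metis
  show ?thesis
    using assms(2) unfolding joined_def
  proof (elim UnE CollectE exE conjE, goal_cases)
    case (1 l p)
    thus ?case using *[of l "fst (D ! l)" "snd (D ! l)"] by (auto simp: points_def)
  next
    case (2 l p i e)
    thus ?case using *[of l i e] by (auto simp: points_def)
  next
    case (3 l i b)
    thus ?case using *[of l i "Cup b"] by (auto simp: points_def)
  next
    case (4 l i)
    thus ?case using *[of l i Cap] by (auto simp: points_def)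
  next
    case (5 l i)
    thus ?case using *[of l i Virt] by (auto simp: points_def)
  next
    case (6 l i)
    thus ?case using *[of l i Virt] by (auto simp: points_def)
  qed
qed

lemma equiv_same_semiarc: "equiv (points D) (same_semiarc D)"
proof (rule equivI)
  have "sym ((joined D \<union> (joined D)\<inverse>)\<^sup>*)" by (rule sym_rtrancl) (auto intro: symI)
  thus "sym (same_semiarc D)" unfolding same_semiarc_def by (auto simp: sym_def)
  show "trans (same_semiarc D)" unfolding same_semiarc_def trans_def by (auto intro: rtrancl_trans)
qed (auto simp: same_semiarc_def refl_on_def)

lemma semiarc_of_mem: "a \<in> points D \<Longrightarrow> semiarc_of D a \<in> semiarcs D"
  unfolding semiarc_of_def semiarcs_def by (rule quotientI)

lemma semiarcs_eq: "semiarcs D = semiarc_of D ` points D"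
  unfolding semiarcs_def quotient_def semiarc_of_def by auto

lemma semiarc_of_joined:
  assumes "oriented_diagram D" "(a, b) \<in> joined D"
  shows "semiarc_of D a = semiarc_of D b"
proof -
  have "(a, b) \<in> same_semiarc D"
    using assms joined_points[OF assms] unfolding same_semiarc_def by auto
  thus ?thesis unfolding semiarc_of_def using equiv_class_eq[OF equiv_same_semiarc] by blast
qed

lemma crossing_ends_rel:
  "(case crossing_ends D l i k of (ul, ur, ol, orr) \<Rightarrow> v ur = un (v ul) (v ol) \<and> v orr = ov (v ol) (v ul)) \<longleftrightarrow>
   crossing_rel un ov k (level D l ! i) (level D l ! (i + 1))
     (v (semiarc_of D (l, i))) (v (semiarc_of D (l, i + 1)))
     (v (semiarc_of D (l + 1, i))) (v (semiarc_of D (l + 1, i + 1)))"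
  by (auto simp: crossing_ends_def crossing_rel_def Let_def)

lemma ball_Collect3:
  "(\<forall>x\<in>{F a b c | a b c. C a b c}. P x) \<longleftrightarrow> (\<forall>a b c. C a b c \<longrightarrow> P (F a b c))"
  by blast

lemma colorings_iff_point_coloring:
  assumes "oriented_diagram D"
  shows "v \<in> colorings X un ov D \<longleftrightarrow>
    v \<in> extensional (semiarcs D) \<and> point_coloring X un ov D (\<lambda>a. v (semiarc_of D a))"
proof -
  have 1: "v \<in> semiarcs D \<rightarrow>\<^sub>E X \<longleftrightarrow> v \<in> extensional (semiarcs D) \<and> (\<forall>a\<in>points D. v (semiarc_of D a) \<in> X)"
    unfolding PiE_def semiarcs_eq by auto
  have 2: "(\<forall>(ul, ur, ol, orr)\<in>crossings D. v ur = un (v ul) (v ol) \<and> v orr = ov (v ol) (v ul)) \<longleftrightarrow>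
     (\<forall>l i k. l < length D \<longrightarrow> D ! l = (i, Cross k) \<longrightarrow>
        crossing_rel un ov k (level D l ! i) (level D l ! (i + 1))
     (v (semiarc_of D (l, i))) (v (semiarc_of D (l, i + 1)))
     (v (semiarc_of D (l + 1, i))) (v (semiarc_of D (l + 1, i + 1))))"
    unfolding crossing_ends_rel[symmetric] crossings_def by (simp only: ball_Collect3 imp_conjL)
  have 3: "(\<forall>(e1, e2, e3, e4)\<in>marked_vertices D. v e1 = v e2 \<and> v e2 = v e3 \<and> v e3 = v e4) \<longleftrightarrow>
     (\<forall>l i m. l < length D \<longrightarrow> D ! l = (i, Mark m) \<longrightarrow>
     v (semiarc_of D (l, i)) = v (semiarc_of D (l, i + 1)) \<and>
     v (semiarc_of D (l, i + 1)) = v (semiarc_of D (l + 1, i)) \<and>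
     v (semiarc_of D (l + 1, i)) = v (semiarc_of D (l + 1, i + 1)))"
    unfolding marked_vertices_def by (simp only: ball_Collect3 imp_conjL prod.case)
  have 4: "\<forall>(a, b)\<in>joined D. v (semiarc_of D a) = v (semiarc_of D b)"
    using semiarc_of_joined[OF assms] by auto
  show ?thesis unfolding colorings_def point_coloring_def mem_Collect_eq 1 2 3 using 4 by blast
qed

definition level_colors :: "slice list \<Rightarrow> (point \<Rightarrow> 'a) \<Rightarrow> 'a list list" where
  "level_colors D c = map (\<lambda>l. map (\<lambda>p. c (l + 1, p)) [0..<length (level D (l + 1))]) [0..<length D]"

lemma level_colors_nth:
  "l < length D \<Longrightarrow> level_colors D c ! l = map (\<lambda>p. c (l + 1, p)) [0..<length (level D (l + 1))]"
  by (simp add: level_colors_def)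

lemma level_colors_nth':
  "l \<le> length D \<Longrightarrow> ([] # level_colors D c) ! l = map (\<lambda>p. c (l, p)) [0..<length (level D l)]"
  by (cases l) (auto simp: level_colors_nth level_0)

lemma closed_run_iff_point_coloring:
  assumes D: "oriented_diagram D"
  shows "level_colors D c \<in> closed_runs X un ov D \<longleftrightarrow> point_coloring X un ov D c"
proof -
  have len: "length (level_colors D c) = length D" by (simp add: level_colors_def)
  have last: "last ([] # level_colors D c) = []"
    using level_colors_nth'[of "length D" D c] level_last[OF D] len
    by (simp add: last_conv_nth nth_Cons' split: if_splits)
  have mem: "(\<forall>l<length D. set (level_colors D c ! l) \<subseteq> X) \<longleftrightarrow> (\<forall>a\<in>points D. c a \<in> X)" (is "?l \<longleftrightarrow> ?r")
  proof
    assume l: ?l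
    show ?r
    proof
      fix a assume "a \<in> points D"
      then obtain k p where a: "a = (k, p)" "k \<le> length D" "p < length (level D k)"
        by (auto simp: points_def)
      then obtain l where "k = l + 1" by (cases k) (auto simp: level_0)
      thus "c a \<in> X" using l[rule_format, of l] a by (auto simp: level_colors_nth)
    qed
  next
    assume ?r thus ?l by (auto simp: level_colors_nth points_def)
  qed
  have nth: "level_colors D c ! l ! p = c (l + 1, p)" "([] # level_colors D c) ! l ! q = c (l, q)"
    if "l < length D" "p < length (level D (l + 1))" "q < length (level D l)" for l p q
    using that by (simp_all add: level_colors_nth level_colors_nth')
  have step: "step un ov (i, e) (level D l) (([] # level_colors D c) ! l) (level_colors D c ! l) \<longleftrightarrow>
    (\<forall>p<i. c (l, p) = c (l + 1, p)) \<and>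
    (\<forall>p. i \<le> p \<longrightarrow> p + in_width e < length (level D l) \<longrightarrow>
       c (l, p + in_width e) = c (l + 1, p + out_width e)) \<and>
    (\<forall>b. e = Cup b \<longrightarrow> c (l + 1, i) = c (l + 1, i + 1)) \<and>
    (e = Cap \<longrightarrow> c (l, i) = c (l, i + 1)) \<and>
    (e = Virt \<longrightarrow> c (l, i) = c (l + 1, i + 1) \<and> c (l, i + 1) = c (l + 1, i)) \<and>
    (\<forall>k. e = Cross k \<longrightarrow> crossing_rel un ov k (level D l ! i) (level D l ! (i + 1))
          (c (l, i)) (c (l, i + 1)) (c (l + 1, i)) (c (l + 1, i + 1))) \<and>
    (\<forall>m. e = Mark m \<longrightarrow>
        c (l, i) = c (l, i + 1) \<and> c (l, i + 1) = c (l + 1, i) \<and> c (l + 1, i) = c (l + 1, i + 1))"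
    if l: "l < length D" "D ! l = (i, e)" for l i e
  proof -
    have r: "run_slice (i, e) (level D l) = Some (level D (l + 1))"
      using oriented_step[OF D l(1)] l(2) by simp
    have w: "i + in_width e \<le> length (level D l)"
      "length (level D (l + 1)) = length (level D l) + out_width e - in_width e"
      using run_slice_width[OF r] run_slice_length[OF r] by simp_all
    show ?thesis
      unfolding level_colors_nth[OF l(1)] level_colors_nth'[OF less_imp_le[OF l(1)]]
      by (subst step_iff_pointwise[OF r]; (intro conj_cong all_cong1 imp_cong refl)?)
        (use w in \<open>auto simp del: upt_Suc\<close>)
  qed
  have "level_colors D c \<in> closed_runs X un ov D \<longleftrightarrow> (\<forall>a\<in>points D. c a \<in> X) \<and>
     (\<forall>l<length D. step un ov (D ! l) (level D l) (([] # level_colors D c) ! l) (level_colors D c ! l))"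
    unfolding closed_runs_def mem_Collect_eq mem[symmetric]
      colored_run_iff_steps[OF D[unfolded oriented_diagram_def], folded level_def]
    using last len by auto
  also have "\<dots> \<longleftrightarrow> (\<forall>a\<in>points D. c a \<in> X) \<and> (\<forall>l i e. l < length D \<longrightarrow> D ! l = (i, e) \<longrightarrow>
     step un ov (i, e) (level D l) (([] # level_colors D c) ! l) (level_colors D c ! l))"
    (is "?P \<and> (\<forall>l<length D. ?Q l (D ! l)) \<longleftrightarrow> _")
  proof -
    have "?Q l (D ! l) \<longleftrightarrow> (\<forall>i e. D ! l = (i, e) \<longrightarrow> ?Q l (i, e))" for l
      by (cases "D ! l") simp
    thus ?thesis by blast
  qed
  also have "\<dots> \<longleftrightarrow> point_coloring X un ov D c"
    unfolding point_coloring_iff_levels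
    by (intro conj_cong refl all_cong1 imp_cong step)
  finally show ?thesis .
qed

lemma colored_run_level_lengths:
  assumes "colored_run X un ov D w xs css ys" "run D w = Some w'" "length xs = length w" "l < length D"
  shows "length (css ! l) = length (the (run (take (l + 1) D) w))"
  using assms
proof (induction D arbitrary: w xs css l)
  case (Cons x D)
  obtain w1 where w1: "run_slice x w = Some w1" "run D w1 = Some w'"
    using Cons.prems by (auto split: bind_splits)
  obtain zs cs where 1: "css = zs # cs" "step un ov x w xs zs" "colored_run X un ov D w1 zs cs ys"
    using Cons.prems(1) w1 by auto
  have len: "length zs = length w1" using step_length[OF 1(2) w1(1)] Cons.prems by simp
  show ?case
  proof (cases l)
    case 0
    thus ?thesis using 1 len w1 by simp
  next
    case (Suc k)
    thus ?thesis using Cons.IH[OF 1(3) w1(2) len, of k] Cons.prems 1 w1 by simp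
  qed
qed simp

definition coloring_run :: "slice list \<Rightarrow> (semiarc \<Rightarrow> 'a) \<Rightarrow> 'a list list" where
  "coloring_run D v = level_colors D (\<lambda>a. v (semiarc_of D a))"

lemma colorings_iff_closed_run:
  assumes "oriented_diagram D"
  shows "v \<in> colorings X un ov D \<longleftrightarrow>
    v \<in> extensional (semiarcs D) \<and> coloring_run D v \<in> closed_runs X un ov D"
  unfolding coloring_run_def closed_run_iff_point_coloring[OF assms]
  using colorings_iff_point_coloring[OF assms] .

lemma level_colors_points:
  assumes "level_colors D c = level_colors D c'" "a \<in> points D"
  shows "c a = c' a"
proof -
  obtain l p where a: "a = (l, p)" "l \<le> length D" "p < length (level D l)"
    using assms(2) by (auto simp: points_def)
  have "map (\<lambda>p. c (l, p)) [0..<length (level D l)] = map (\<lambda>p. c' (l, p)) [0..<length (level D l)]"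
    using assms(1) level_colors_nth'[OF a(2), of c] level_colors_nth'[OF a(2), of c'] by simp
  from arg_cong[OF this, of "\<lambda>xs. xs ! p"] show ?thesis using a by simp
qed

lemma coloring_run_inj:
  assumes "coloring_run D v = coloring_run D v'"
    "v \<in> extensional (semiarcs D)" "v' \<in> extensional (semiarcs D)"
  shows "v = v'"
proof (rule extensionalityI[OF assms(2,3)])
  fix e assume "e \<in> semiarcs D"
  then obtain a where "a \<in> points D" "e = semiarc_of D a" unfolding semiarcs_eq by blast
  thus "v e = v' e" using level_colors_points[OF assms(1)[unfolded coloring_run_def]] by simp
qed

text \<open>
  A function that is constant along joined points is constant on the classes of the generated
  equivalence relation, that is, on semiarcs.
\<close>

lemma point_coloring_descends:
  assumes D: "oriented_diagram D" and c: "point_coloring X un ov D c"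
  shows "\<exists>v\<in>extensional (semiarcs D). \<forall>a\<in>points D. v (semiarc_of D a) = c a"
proof -
  have const: "c a = c b" if "(a, b) \<in> (joined D \<union> (joined D)\<inverse>)\<^sup>*" for a b
    using that
  proof induction
    case (step y z)
    moreover have "c y = c z" using step(2) c unfolding point_coloring_def by auto
    ultimately show ?case by simp
  qed simp
  have "c a = c b" if "a \<in> points D" "b \<in> points D" "semiarc_of D a = semiarc_of D b" for a b
    using eq_equiv_class[OF that(3)[unfolded semiarc_of_def] equiv_same_semiarc that(2)] const
    unfolding same_semiarc_def by blast
  hence "inv_into (points D) (semiarc_of D) (semiarc_of D a) = b \<Longrightarrow> c b = c a" if "a \<in> points D" for a b
    using that f_inv_into_f[of "semiarc_of D a" "semiarc_of D" "points D"]
      inv_into_into[of "semiarc_of D a" "semiarc_of D" "points D"] by blast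
  thus ?thesis
    by (intro bexI[of _ "restrict (\<lambda>e. c (inv_into (points D) (semiarc_of D) e)) (semiarcs D)"])
      (auto simp: semiarc_of_mem)
qed

lemma coloring_of_closed_run:
  assumes D: "oriented_diagram D" and css: "css \<in> closed_runs X un ov D"
  shows "\<exists>v\<in>colorings X un ov D. coloring_run D v = css"
proof -
  define c :: "point \<Rightarrow> _" where "c = (\<lambda>(l, p). ([] # css) ! l ! p)"
  have run: "colored_run X un ov D [] [] css []" "run D [] = Some []"
    using css D unfolding closed_runs_def oriented_diagram_def by auto
  have len: "length css = length D" using colored_run_length[OF run] by simp
  have lens: "length (css ! l) = length (level D (l + 1))" if "l < length D" for l
    using colored_run_level_lengths[OF run _ that] unfolding level_def by simp
  have css_eq: "level_colors D c = css"
  proof (rule nth_equalityI)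
    fix l assume "l < length (level_colors D c)"
    hence l: "l < length D" by (simp add: level_colors_def)
    show "level_colors D c ! l = css ! l"
      unfolding level_colors_nth[OF l] by (rule nth_equalityI) (use lens[OF l] in \<open>auto simp: c_def\<close>)
  qed (simp add: level_colors_def len)
  hence c: "point_coloring X un ov D c" using closed_run_iff_point_coloring[OF D] css by metis
  obtain v where v: "v \<in> extensional (semiarcs D)" "\<And>a. a \<in> points D \<Longrightarrow> v (semiarc_of D a) = c a"
    using point_coloring_descends[OF D c] by blast
  have "coloring_run D v = css"
    unfolding coloring_run_def css_eq[symmetric] level_colors_def
    by (auto simp: points_def v(2))
  thus ?thesis using v(1) css colorings_iff_closed_run[OF D] by blast
qed

lemma coloring_of_unique_run:
  assumes D: "oriented_diagram D" and "\<exists>!css. css \<in> closed_runs X un ov D \<and> P css"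
  shows "\<exists>!v. v \<in> colorings X un ov D \<and> P (coloring_run D v)"
proof -
  from assms(2) obtain css where css: "css \<in> closed_runs X un ov D" "P css"
    and unique: "\<And>c. c \<in> closed_runs X un ov D \<Longrightarrow> P c \<Longrightarrow> c = css" by blast
  obtain v where v: "v \<in> colorings X un ov D" "coloring_run D v = css"
    using coloring_of_closed_run[OF D css(1)] by blast
  show ?thesis
  proof (rule ex1I[of _ v])
    show "v \<in> colorings X un ov D \<and> P (coloring_run D v)" using v css by simp
  next
    fix u assume u: "u \<in> colorings X un ov D \<and> P (coloring_run D u)"
    hence ext: "u \<in> extensional (semiarcs D)" "v \<in> extensional (semiarcs D)"
      and run: "coloring_run D u \<in> closed_runs X un ov D"
      using v(1) colorings_iff_closed_run[OF D] by blast+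
    have "coloring_run D u = coloring_run D v" using unique[OF run] u v(2) by simp
    thus "u = v" using coloring_run_inj ext by blast
  qed
qed

text \<open>
  Recoloring along a map between two different types, such as the one that forgets beads.
\<close>

definition map_coloring :: "slice list \<Rightarrow> ('a \<Rightarrow> 'b) \<Rightarrow> (semiarc \<Rightarrow> 'a) \<Rightarrow> semiarc \<Rightarrow> 'b" where
  "map_coloring D h v = compose (semiarcs D) h v"

lemma recolor_eq_map_coloring: "recolor D h v = map_coloring D h v"
  by (simp add: recolor_def map_coloring_def)

lemma coloring_run_map_coloring:
  "coloring_run D (map_coloring D h v) = map (map h) (coloring_run D v)"
proof -
  have "map_coloring D h v (semiarc_of D a) = h (v (semiarc_of D a))" if "a \<in> points D" for a
    using semiarc_of_mem[OF that] by (simp add: map_coloring_def compose_def)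
  thus ?thesis unfolding coloring_run_def level_colors_def by (auto simp: points_def)
qed

lemma map_coloring_mem:
  assumes D: "oriented_diagram D" and h: "biquandle_hom X un ov X' un' ov' h"
    and v: "v \<in> colorings X un ov D"
  shows "map_coloring D h v \<in> colorings X' un' ov' D"
proof -
  have "colored_run X un ov D [] [] (coloring_run D v) []"
    using v colorings_iff_closed_run[OF D] unfolding closed_runs_def by blast
  from colored_run_map[OF h this] D
  have "coloring_run D (map_coloring D h v) \<in> closed_runs X' un' ov' D"
    unfolding coloring_run_map_coloring closed_runs_def oriented_diagram_def by simp
  thus ?thesis unfolding colorings_iff_closed_run[OF D] by (simp add: map_coloring_def)
qed

section \<open>Natural isomorphism of coloring functors\<close>

text \<open>
  The functors sending a biquandle to its colorings of \<open>D\<close> and of \<open>D'\<close> are isomorphic. All biquandles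
  live on subsets of one type, which has to be chosen large enough in the application.
\<close>

definition naturally_isomorphic :: "'a itself \<Rightarrow> slice list \<Rightarrow> slice list \<Rightarrow> bool" where
  "naturally_isomorphic _ D D' \<longleftrightarrow> oriented_diagram D \<and> oriented_diagram D' \<and>
     (\<exists>B. \<forall>(X :: 'a set) un ov. biquandle X un ov \<longrightarrow>
        bij_betw (B X un ov) (colorings X un ov D) (colorings X un ov D') \<and>
        (\<forall>(X' :: 'a set) un' ov' h. biquandle X' un' ov' \<longrightarrow> biquandle_hom X un ov X' un' ov' h \<longrightarrow>
           (\<forall>v\<in>colorings X un ov D.
              B X' un' ov' (map_coloring D h v) = map_coloring D' h (B X un ov v))))"

lemma naturally_isomorphic_refl:
  "oriented_diagram D \<Longrightarrow> naturally_isomorphic T D D"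
  unfolding naturally_isomorphic_def by (intro conjI exI[of _ "\<lambda>_ _ _ v. v"]) (auto simp: bij_betw_def)

lemma naturally_isomorphic_sym:
  assumes "naturally_isomorphic (T :: 'a itself) D D'"
  shows "naturally_isomorphic T D' D"
proof -
  from assms obtain B where D: "oriented_diagram D" "oriented_diagram D'"
    and bij: "\<And>(X :: 'a set) un ov. biquandle X un ov \<Longrightarrow>
       bij_betw (B X un ov) (colorings X un ov D) (colorings X un ov D')"
    and nat: "\<And>(X :: 'a set) un ov (X' :: 'a set) un' ov' h v. biquandle X un ov \<Longrightarrow> biquandle X' un' ov' \<Longrightarrow>
      biquandle_hom X un ov X' un' ov' h \<Longrightarrow> v \<in> colorings X un ov D \<Longrightarrow>
      B X' un' ov' (map_coloring D h v) = map_coloring D' h (B X un ov v)"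
    unfolding naturally_isomorphic_def by blast
  let ?B = "\<lambda>X un ov. inv_into (colorings X un ov D) (B X un ov)"
  show ?thesis unfolding naturally_isomorphic_def
  proof (intro conjI exI[of _ ?B] D allI impI ballI)
    fix X :: "'a set" and un ov assume X: "biquandle X un ov"
    show "bij_betw (?B X un ov) (colorings X un ov D') (colorings X un ov D)"
      by (rule bij_betw_inv_into[OF bij[OF X]])
    fix X' :: "'a set" and un' ov' h v'
    assume X': "biquandle X' un' ov'" and h: "biquandle_hom X un ov X' un' ov' h"
      and v': "v' \<in> colorings X un ov D'"
    define v where "v = ?B X un ov v'"
    have v: "v \<in> colorings X un ov D" "B X un ov v = v'"
      using bij_betw_inv_into_right[OF bij[OF X] v'] bij_betwE[OF bij_betw_inv_into[OF bij[OF X]]] v'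
      by (auto simp: v_def)
    have "?B X' un' ov' (map_coloring D' h v') = ?B X' un' ov' (B X' un' ov' (map_coloring D h v))"
      using nat[OF X X' h v(1)] v(2) by simp
    also have "\<dots> = map_coloring D h v"
      by (rule bij_betw_inv_into_left[OF bij[OF X'] map_coloring_mem[OF D(1) h v(1)]])
    finally show "?B X' un' ov' (map_coloring D' h v') = map_coloring D h (?B X un ov v')"
      by (simp add: v_def)
  qed
qed

lemma naturally_isomorphic_trans:
  assumes "naturally_isomorphic (T :: 'a itself) D D'" "naturally_isomorphic T D' D''"
  shows "naturally_isomorphic T D D''"
proof -
  from assms(1) obtain B where D: "oriented_diagram D" "oriented_diagram D'"
    and bij: "\<And>(X :: 'a set) un ov. biquandle X un ov \<Longrightarrow>
       bij_betw (B X un ov) (colorings X un ov D) (colorings X un ov D')"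
    and nat: "\<And>(X :: 'a set) un ov (X' :: 'a set) un' ov' h v. biquandle X un ov \<Longrightarrow> biquandle X' un' ov' \<Longrightarrow>
      biquandle_hom X un ov X' un' ov' h \<Longrightarrow> v \<in> colorings X un ov D \<Longrightarrow>
      B X' un' ov' (map_coloring D h v) = map_coloring D' h (B X un ov v)"
    unfolding naturally_isomorphic_def by blast
  from assms(2) obtain B' where D'': "oriented_diagram D''"
    and bij': "\<And>(X :: 'a set) un ov. biquandle X un ov \<Longrightarrow>
       bij_betw (B' X un ov) (colorings X un ov D') (colorings X un ov D'')"
    and nat': "\<And>(X :: 'a set) un ov (X' :: 'a set) un' ov' h v. biquandle X un ov \<Longrightarrow> biquandle X' un' ov' \<Longrightarrow>
      biquandle_hom X un ov X' un' ov' h \<Longrightarrow> v \<in> colorings X un ov D' \<Longrightarrow>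
      B' X' un' ov' (map_coloring D' h v) = map_coloring D'' h (B' X un ov v)"
    unfolding naturally_isomorphic_def by blast
  show ?thesis unfolding naturally_isomorphic_def
  proof (intro conjI exI[of _ "\<lambda>X un ov. B' X un ov \<circ> B X un ov"] D D'' allI impI ballI)
    fix X :: "'a set" and un ov assume X: "biquandle X un ov"
    show "bij_betw (B' X un ov \<circ> B X un ov) (colorings X un ov D) (colorings X un ov D'')"
      by (rule bij_betw_trans[OF bij[OF X] bij'[OF X]])
    fix X' :: "'a set" and un' ov' h v
    assume X': "biquandle X' un' ov'" and h: "biquandle_hom X un ov X' un' ov' h"
      and v: "v \<in> colorings X un ov D"
    show "(B' X' un' ov' \<circ> B X' un' ov') (map_coloring D h v) = map_coloring D'' h ((B' X un ov \<circ> B X un ov) v)"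
      using nat[OF X X' h v] nat'[OF X X' h] bij_betwE[OF bij[OF X]] v by simp
  qed
qed

text \<open>
  A relation that is a bijection for each biquandle and is preserved by arbitrary recoloring of levels yields
  a natural isomorphism, with the related coloring as the image.
\<close>

lemma naturally_isomorphicI:
  assumes D: "oriented_diagram D" "oriented_diagram D'"
    and left: "\<And>(X :: 'a set) un ov css. biquandle X un ov \<Longrightarrow> css \<in> closed_runs X un ov D \<Longrightarrow>
      \<exists>!css'. css' \<in> closed_runs X un ov D' \<and> \<rho> css css'"
    and right: "\<And>(X :: 'a set) un ov css'. biquandle X un ov \<Longrightarrow> css' \<in> closed_runs X un ov D' \<Longrightarrow>
      \<exists>!css. css \<in> closed_runs X un ov D \<and> \<rho> css css'"
    and map: "\<And>css css' h. \<rho> css css' \<Longrightarrow> \<rho> (map (map h) css) (map (map h) css')"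
  shows "naturally_isomorphic TYPE('a) D D'"
proof -
  let ?\<rho> = "\<lambda>v v'. \<rho> (coloring_run D v) (coloring_run D' v')"
  note Diff = colorings_iff_closed_run[OF D(1)] and Diff' = colorings_iff_closed_run[OF D(2)]
  have ex: "\<exists>!v'. v' \<in> colorings X un ov D' \<and> ?\<rho> v v'"
    if X: "biquandle X un ov" and v: "v \<in> colorings X un ov D" for X :: "'a set" and un ov v
    using coloring_of_unique_run[OF D(2) left[OF X]] v Diff by blast
  have ex': "\<exists>!v. v \<in> colorings X un ov D \<and> ?\<rho> v v'"
    if X: "biquandle X un ov" and v': "v' \<in> colorings X un ov D'" for X :: "'a set" and un ov v'
    using coloring_of_unique_run[OF D(1) right[OF X]] v' Diff' by blast
  define B where "B = (\<lambda>(X :: 'a set) un ov v. THE v'. v' \<in> colorings X un ov D' \<and> ?\<rho> v v')"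
  have B: "B X un ov v \<in> colorings X un ov D'" "?\<rho> v (B X un ov v)"
    and B_eq: "\<And>v'. v' \<in> colorings X un ov D' \<Longrightarrow> ?\<rho> v v' \<Longrightarrow> B X un ov v = v'"
    if "biquandle X un ov" "v \<in> colorings X un ov D" for X :: "'a set" and un ov v
    using theI'[OF ex[OF that]] the1_equality[OF ex[OF that]] unfolding B_def by blast+
  show ?thesis unfolding naturally_isomorphic_def
  proof (intro conjI exI[of _ B] D allI impI ballI)
    fix X :: "'a set" and un ov assume X: "biquandle X un ov"
    show "bij_betw (B X un ov) (colorings X un ov D) (colorings X un ov D')"
      unfolding bij_betw_def
    proof (intro conjI inj_onI equalityI subsetI)
      fix u v assume "u \<in> colorings X un ov D" "v \<in> colorings X un ov D" "B X un ov u = B X un ov v"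
      thus "u = v" using ex'[OF X B(1)[OF X, of u]] B(2)[OF X, of u] B(2)[OF X, of v] by metis
    next
      fix v' assume "v' \<in> B X un ov ` colorings X un ov D"
      thus "v' \<in> colorings X un ov D'" using B[OF X] by blast
    next
      fix v' assume v': "v' \<in> colorings X un ov D'"
      from ex'[OF X v'] obtain v where v: "v \<in> colorings X un ov D" "?\<rho> v v'" by blast
      thus "v' \<in> B X un ov ` colorings X un ov D" using B_eq[OF X v(1) v' v(2)] by blast
    qed
    fix X' :: "'a set" and un' ov' h v
    assume X': "biquandle X' un' ov'" and h: "biquandle_hom X un ov X' un' ov' h"
      and v: "v \<in> colorings X un ov D"
    show "B X' un' ov' (map_coloring D h v) = map_coloring D' h (B X un ov v)"
    proof (rule B_eq[OF X'])
      show "map_coloring D h v \<in> colorings X' un' ov' D" by (rule map_coloring_mem[OF D(1) h v])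
      show "map_coloring D' h (B X un ov v) \<in> colorings X' un' ov' D'"
        by (rule map_coloring_mem[OF D(2) h B(1)[OF X v]])
      show "?\<rho> (map_coloring D h v) (map_coloring D' h (B X un ov v))"
        unfolding coloring_run_map_coloring by (rule map[OF B(2)[OF X v]])
    qed
  qed
qed

definition diagram_move where
  "diagram_move L R \<longleftrightarrow> isotopy_move L R \<or> reidemeister_move L R \<or> virtual_move L R \<or> yoshikawa_move L R"

lemma local_change_naturally_isomorphic:
  assumes "local_change mv D D'" "\<And>L R. mv L R \<Longrightarrow> diagram_move L R"
  shows "naturally_isomorphic TYPE('a) D D'"
proof -
  from assms obtain A L R B n w w' where 1: "diagram_move L R" "D = A @ shift n L @ B" "D' = A @ shift n R @ B"
    and runs: "run A [] = Some w" "run (shift n L) w = Some w'" "run (shift n R) w = Some w'" "run B w' = Some []"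
    unfolding local_change_def by blast
  have D: "oriented_diagram D" "oriented_diagram D'"
    using runs by (simp_all add: 1 oriented_diagram_def run_append)
  show ?thesis
  proof (rule naturally_isomorphicI[OF D])
    fix X :: "'a set" and un ov css assume "biquandle X un ov"
    then interpret biquandle_on X un ov by unfold_locales
    obtain m where eq: "locally_equivalent m L R"
      using 1(1) isotopy_locally_equivalent reidemeister_locally_equivalent
        virtual_locally_equivalent yoshikawa_locally_equivalent unfolding diagram_move_def by blast
    show "css \<in> closed_runs X un ov D \<Longrightarrow>
        \<exists>!css'. css' \<in> closed_runs X un ov D' \<and> agree_outside (length A) (length B) css css'"
      "css \<in> closed_runs X un ov D' \<Longrightarrow>
        \<exists>!css'. css' \<in> closed_runs X un ov D \<and> agree_outside (length A) (length B) css' css"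
      using local_change_closed_runs[OF eq runs] unfolding 1 by blast+
  qed (rule agree_outside_map)
qed

lemma related_by_naturally_isomorphic:
  assumes "related_by K mv D D'" "\<And>L R. mv L R \<Longrightarrow> diagram_move L R" "\<And>E. K E \<Longrightarrow> oriented_diagram E"
  shows "naturally_isomorphic TYPE('a) D D'"
proof -
  have "equivclp (\<lambda>E E'. K E \<and> K E' \<and> local_change mv E E') D D'" "K D"
    using assms(1) unfolding related_by_def by auto
  thus ?thesis
  proof (induction rule: equivclp_induct)
    case base
    thus ?case using naturally_isomorphic_refl assms(3) by blast
  next
    case (step y z)
    hence "naturally_isomorphic TYPE('a) y z"
      using local_change_naturally_isomorphic[OF _ assms(2)] naturally_isomorphic_sym by blast
    thus ?case using naturally_isomorphic_trans step by blast
  qed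
qed

lemma link_equiv_naturally_isomorphic:
  assumes "classical_link_equiv D D' \<or> virtual_link_equiv D D' \<or> surface_link_equiv D D'"
  shows "naturally_isomorphic TYPE('a) D D'"
  using assms
proof (elim disjE)
  assume "classical_link_equiv D D'"
  thus ?thesis unfolding classical_link_equiv_def
    by (rule related_by_naturally_isomorphic) (auto simp: diagram_move_def classical_diagram_def)
next
  assume "virtual_link_equiv D D'"
  thus ?thesis unfolding virtual_link_equiv_def
    by (rule related_by_naturally_isomorphic) (auto simp: diagram_move_def virtual_diagram_def)
next
  assume "surface_link_equiv D D'"
  hence "related_by marked_graph_diagram
       (\<lambda>L R. isotopy_move L R \<or> reidemeister_move L R \<or> yoshikawa_move L R) D D'"
    unfolding surface_link_equiv_def by blast
  thus ?thesis
    by (rule related_by_naturally_isomorphic) (auto simp: diagram_move_def marked_graph_diagram_def)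
qed

section \<open>Colors with beads\<close>

text \<open>
  Colors with beads. A bead is a function \<open>'i \<Rightarrow> 'k\<close>, that is, a family of elements of the ring, treated
  coordinatewise; several coordinates are needed to express additivity by homomorphisms.
\<close>

definition bead_un where
  "bead_un un t s = (\<lambda>(x, f) (y, g). (un x y, \<lambda>i. t x y * f i + s x y * g i))"

definition bead_ov where
  "bead_ov ov r = (\<lambda>(y, g) (x, f). (ov y x, \<lambda>i. r x y * g i))"

lemma bead_un_apply [simp]:
  "bead_un un t s (x, f) (y, g) = (un x y, \<lambda>i. t x y * f i + s x y * g i)"
  by (simp add: bead_un_def)

lemma bead_ov_apply [simp]: "bead_ov ov r (y, g) (x, f) = (ov y x, \<lambda>i. r x y * g i)"
  by (simp add: bead_ov_def)

definition bead_submodule :: "('i \<Rightarrow> 'k::{comm_ring, comm_monoid_mult}) set \<Rightarrow> bool" where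
  "bead_submodule A \<longleftrightarrow> (\<lambda>_. 0) \<in> A \<and> (\<forall>f\<in>A. \<forall>g\<in>A. (\<lambda>i. f i + g i) \<in> A) \<and>
     (\<forall>a. \<forall>f\<in>A. (\<lambda>i. a * f i) \<in> A)"

lemma bead_submodule_add: "bead_submodule A \<Longrightarrow> f \<in> A \<Longrightarrow> g \<in> A \<Longrightarrow> (\<lambda>i. f i + g i) \<in> A"
  and bead_submodule_scale: "bead_submodule A \<Longrightarrow> f \<in> A \<Longrightarrow> (\<lambda>i. a * f i) \<in> A"
  by (simp_all add: bead_submodule_def)

lemma bead_submodule_diff:
  assumes "bead_submodule A" "f \<in> A" "g \<in> A"
  shows "(\<lambda>i. f i - g i) \<in> A"
  using bead_submodule_add[OF assms(1,2) bead_submodule_scale[OF assms(1,3), of "- 1"]] by simp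

lemma ring_unit_cancel:
  fixes u :: "'k::{comm_ring, comm_monoid_mult}"
  assumes "is_ring_unit u" "u * a = u * b"
  shows "a = b"
proof -
  obtain w where "u * w = 1" using assms(1) unfolding is_ring_unit_def by blast
  hence "c = w * (u * c)" for c by (metis mult.assoc mult.commute mult_1)
  thus ?thesis using assms(2) by metis
qed

lemma bij_betwI_ex:
  assumes "\<And>x. x \<in> A \<Longrightarrow> f x \<in> B" "\<And>x y. x \<in> A \<Longrightarrow> y \<in> A \<Longrightarrow> f x = f y \<Longrightarrow> x = y"
    and "\<And>y. y \<in> B \<Longrightarrow> \<exists>x\<in>A. y = f x"
  shows "bij_betw f A B"
  unfolding bij_betw_def inj_on_def using assms by blast

lemma biquandle_module_exchange:
  assumes "biquandle_module X un ov t s r" "x \<in> X" "y \<in> X" "z \<in> X"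
  shows "r (ov y x) (ov z x) * r x z = r (un x y) (ov z y) * r y z"
    "r (un x z) (un y z) * t y z = t (ov y x) (ov z x) * r x y"
    "r (un x z) (un y z) * s y z = s (ov y x) (ov z x) * r x z"
    "t (un x z) (un y z) * t x z = t (un x y) (ov z y) * t x y"
    "s (un x z) (un y z) * t y z = t (un x y) (ov z y) * s x y"
    "t (un x z) (un y z) * s x z + s (un x z) (un y z) * s y z = s (un x y) (ov z y) * r y z"
  using assms(1)[unfolded biquandle_module_def, THEN conjunct2, THEN conjunct2,
      THEN bspec, THEN bspec, THEN bspec, OF assms(2-4)] by simp_all

text \<open>
  The axioms of a biquandle module are the axioms of a biquandle for colors with beads: the
  exchange laws hold coefficient by coefficient, and invertibility amounts to \<open>t\<close> and \<open>r\<close> being units.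
\<close>

theorem biquandle_with_beads:
  fixes t s r :: "'a \<Rightarrow> 'a \<Rightarrow> 'k::{comm_ring, comm_monoid_mult}" and A :: "('i \<Rightarrow> 'k) set"
  assumes "biquandle X un ov" and mod: "biquandle_module X un ov t s r" and A: "bead_submodule A"
  shows "biquandle (X \<times> A) (bead_un un t s) (bead_ov ov r)"
proof -
  interpret biquandle_on X un ov by unfold_locales (rule assms(1))
  have unit: "is_ring_unit (t x y)" "is_ring_unit (r x y)" if "x \<in> X" "y \<in> X" for x y
    using mod that unfolding biquandle_module_def by blast+
  have inverse: "\<exists>f\<in>A. \<forall>i. u * f i = g i" if u: "is_ring_unit u" and g: "g \<in> A" for u g
  proof -
    obtain w where w: "u * w = 1" using u unfolding is_ring_unit_def by blast
    have "(\<lambda>i. w * g i) \<in> A" by (rule bead_submodule_scale[OF A g])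
    moreover have "u * (w * g i) = g i" for i using w by (simp add: mult.assoc[symmetric])
    ultimately show ?thesis by (intro bexI[of _ "\<lambda>i. w * g i"]) simp_all
  qed
  have add: "(\<lambda>i. f i + g i) \<in> A" if "f \<in> A" "g \<in> A" for f g
    by (rule bead_submodule_add[OF A that])
  have scale: "(\<lambda>i. a * f i) \<in> A" if "f \<in> A" for a f
    by (rule bead_submodule_scale[OF A that])
  have cancel: "f = g" if "is_ring_unit u" "\<And>i. u * f i = u * g i" for u f and g :: "'i \<Rightarrow> 'k"
    using ring_unit_cancel that by (intro ext) blast
  have bij_ov: "bij_betw (\<lambda>p. bead_ov ov r p q) (X \<times> A) (X \<times> A)"
    and bij_un: "bij_betw (\<lambda>p. bead_un un t s p q) (X \<times> A) (X \<times> A)" if q: "q \<in> X \<times> A" for q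
  proof -
    obtain y g where q: "q = (y, g)" "y \<in> X" "g \<in> A" using q by blast
    show "bij_betw (\<lambda>p. bead_ov ov r p q) (X \<times> A) (X \<times> A)"
    proof (rule bij_betwI_ex)
      fix p p' assume "p \<in> X \<times> A" "p' \<in> X \<times> A" and pp': "bead_ov ov r p q = bead_ov ov r p' q"
      then obtain x f x' f' where p: "p = (x, f)" "p' = (x', f')" "x \<in> X" "x' \<in> X" by blast
      have e: "ov x y = ov x' y" "\<And>i. r y x * f i = r y x' * f' i"
        using pp' p q by (auto simp: fun_eq_iff)
      have x: "x = x'" using ov_inj e(1) p q by blast
      have "f = f'" by (rule cancel[OF unit(2)[of y x]]) (use e(2) x p q in auto)
      thus "p = p'" using p x by simp
    next
      fix p assume "p \<in> X \<times> A"
      then obtain x f where p: "p = (x, f)" "x \<in> X" "f \<in> A" by blast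
      obtain x' where x': "x' \<in> X" "x = ov x' y" using ov_surj p q by blast
      obtain f' where "f' \<in> A" "\<And>i. r y x' * f' i = f i" using inverse[OF unit(2)] x' p q by blast
      thus "\<exists>p'\<in>X \<times> A. p = bead_ov ov r p' q"
        using x' p q by (intro bexI[of _ "(x', f')"]) auto
    qed (use q ov_closed scale in auto)
    show "bij_betw (\<lambda>p. bead_un un t s p q) (X \<times> A) (X \<times> A)"
    proof (rule bij_betwI_ex)
      fix p p' assume "p \<in> X \<times> A" "p' \<in> X \<times> A" and pp': "bead_un un t s p q = bead_un un t s p' q"
      then obtain x f x' f' where p: "p = (x, f)" "p' = (x', f')" "x \<in> X" "x' \<in> X" by blast
      have e: "un x y = un x' y" "\<And>i. t x y * f i + s x y * g i = t x' y * f' i + s x' y * g i"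
        using pp' p q by (auto simp: fun_eq_iff)
      have x: "x = x'" using un_inj e(1) p q by blast
      have "f = f'" by (rule cancel[OF unit(1)[of x y]]) (use e(2) x p q in auto)
      thus "p = p'" using p x by simp
    next
      fix p assume "p \<in> X \<times> A"
      then obtain x f where p: "p = (x, f)" "x \<in> X" "f \<in> A" by blast
      obtain x' where x': "x' \<in> X" "x = un x' y" using un_surj p q by blast
      have "(\<lambda>i. f i - s x' y * g i) \<in> A" using bead_submodule_diff[OF A p(3) scale[OF q(3)]] .
      then obtain f' where "f' \<in> A" "\<And>i. t x' y * f' i = f i - s x' y * g i"
        using inverse[OF unit(1)] x' q by blast
      thus "\<exists>p'\<in>X \<times> A. p = bead_un un t s p' q"
        using x' p q by (intro bexI[of _ "(x', f')"]) auto
    qed (use q un_closed scale add in auto)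
  qed
  have bij_switch: "bij_betw (\<lambda>(p, q). (bead_ov ov r q p, bead_un un t s p q))
      ((X \<times> A) \<times> (X \<times> A)) ((X \<times> A) \<times> (X \<times> A))"
  proof (rule bij_betwI_ex)
    fix a b assume "a \<in> (X \<times> A) \<times> (X \<times> A)" "b \<in> (X \<times> A) \<times> (X \<times> A)"
    then obtain x f y g x' f' y' g' where ab: "a = ((x, f), (y, g))" "b = ((x', f'), (y', g'))"
      "x \<in> X" "f \<in> A" "y \<in> X" "g \<in> A" "x' \<in> X" "f' \<in> A" "y' \<in> X" "g' \<in> A" by blast
    assume "(case a of (p, q) \<Rightarrow> (bead_ov ov r q p, bead_un un t s p q)) =
      (case b of (p, q) \<Rightarrow> (bead_ov ov r q p, bead_un un t s p q))"
    hence e: "ov y x = ov y' x'" "un x y = un x' y'" "\<And>i. r x y * g i = r x' y' * g' i"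
      "\<And>i. t x y * f i + s x y * g i = t x' y' * f' i + s x' y' * g' i"
      using ab by (auto simp: fun_eq_iff)
    have xy: "x = x'" "y = y'" using switch_inj e ab by blast+
    have g: "g = g'" by (rule cancel[OF unit(2)[of x y]]) (use e(3) xy ab in auto)
    have "f = f'" by (rule cancel[OF unit(1)[of x y]]) (use e(4) xy g ab in auto)
    thus "a = b" using ab xy g by simp
  next
    fix b assume "b \<in> (X \<times> A) \<times> (X \<times> A)"
    then obtain y g x f where b: "b = ((y, g), (x, f))" "x \<in> X" "f \<in> A" "y \<in> X" "g \<in> A" by blast
    obtain x' y' where xy: "x' \<in> X" "y' \<in> X" "x = un x' y'" "y = ov y' x'"
      using switch_surj b by blast
    obtain g' where g: "g' \<in> A" "\<And>i. r x' y' * g' i = g i" using inverse[OF unit(2)] xy b by blast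
    have "(\<lambda>i. f i - s x' y' * g' i) \<in> A" using bead_submodule_diff[OF A b(3) scale[OF g(1)]] .
    then obtain f' where "f' \<in> A" "\<And>i. t x' y' * f' i = f i - s x' y' * g' i"
      using inverse[OF unit(1)] xy by blast
    thus "\<exists>a\<in>(X \<times> A) \<times> (X \<times> A). b = (case a of (p, q) \<Rightarrow> (bead_ov ov r q p, bead_un un t s p q))"
      using xy g b by (intro bexI[of _ "((x', f'), (y', g'))"]) auto
  qed (use un_closed ov_closed scale add in auto)
  have exchange: "bead_un un t s (bead_un un t s p q) (bead_un un t s p' q) =
        bead_un un t s (bead_un un t s p p') (bead_ov ov r q p') \<and>
      bead_ov ov r (bead_un un t s p q) (bead_un un t s p' q) =
        bead_un un t s (bead_ov ov r p p') (bead_ov ov r q p') \<and>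
      bead_ov ov r (bead_ov ov r p q) (bead_ov ov r p' q) =
        bead_ov ov r (bead_ov ov r p p') (bead_un un t s q p')"
    if mem: "p \<in> X \<times> A" "q \<in> X \<times> A" "p' \<in> X \<times> A" for p q p'
  proof -
    obtain x f y g z h where e: "p = (x, f)" "q = (y, g)" "p' = (z, h)" "x \<in> X" "y \<in> X" "z \<in> X"
      using mem by blast
    have m: "t (un x y) (un z y) * t x y = t (un x z) (ov y z) * t x z"
      "s (un x y) (un z y) * t z y = t (un x z) (ov y z) * s x z"
      "t (un x y) (un z y) * s x y + s (un x y) (un z y) * s z y = s (un x z) (ov y z) * r z y"
      "r (un z y) (un x y) * t x y = t (ov x z) (ov y z) * r z x"
      "r (un z y) (un x y) * s x y = s (ov x z) (ov y z) * r z y"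
      "r (ov z y) (ov x y) * r y x = r (un y z) (ov x z) * r z x"
      using biquandle_module_exchange[OF mod e(4,6,5)] biquandle_module_exchange[OF mod e(6,4,5)]
        biquandle_module_exchange[OF mod e(5,6,4)] by simp_all
    have m': "t (un x y) (un z y) * (t x y * a) = t (un x z) (ov y z) * (t x z * a)"
      "s (un x y) (un z y) * (t z y * a) = t (un x z) (ov y z) * (s x z * a)"
      "t (un x y) (un z y) * (s x y * a) + s (un x y) (un z y) * (s z y * a) =
         s (un x z) (ov y z) * (r z y * a)"
      "r (un z y) (un x y) * (t x y * a) = t (ov x z) (ov y z) * (r z x * a)"
      "r (un z y) (un x y) * (s x y * a) = s (ov x z) (ov y z) * (r z y * a)"
      "r (ov z y) (ov x y) * (r y x * a) = r (un y z) (ov x z) * (r z x * a)" for a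
      by (simp_all only: mult.assoc[symmetric] distrib_right[symmetric] m)
    have "t (un x y) (un z y) * (t x y * f i + s x y * g i) +
          s (un x y) (un z y) * (t z y * h i + s z y * g i) =
        t (un x z) (ov y z) * (t x z * f i + s x z * h i) + s (un x z) (ov y z) * (r z y * g i)" for i
      using m'(1)[of "f i"] m'(2)[of "h i"] m'(3)[of "g i"] by (simp add: distrib_left add.assoc add.left_commute)
    moreover have "r (un z y) (un x y) * (t x y * f i + s x y * g i) =
        t (ov x z) (ov y z) * (r z x * f i) + s (ov x z) (ov y z) * (r z y * g i)" for i
      using m'(4,5) by (simp add: distrib_left)
    ultimately show ?thesis
      using e m'(6) exchange1[of x y z] exchange2[of x y z] exchange3[of x y z] by simp
  qed
  have diag: "bead_un un t s p p = bead_ov ov r p p" if mem: "p \<in> X \<times> A" for p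
  proof -
    obtain x f where p: "p = (x, f)" "x \<in> X" using mem by blast
    have "t x x + s x x = r x x"
      using mod[unfolded biquandle_module_def, THEN conjunct1] p(2) by blast
    hence "t x x * f i + s x x * f i = r x x * f i" for i
      by (simp add: distrib_right[symmetric])
    thus ?thesis using p diagonal by simp
  qed
  have closed: "bead_un un t s p q \<in> X \<times> A" "bead_ov ov r p q \<in> X \<times> A"
    if "p \<in> X \<times> A" "q \<in> X \<times> A" for p q
    using that un_closed ov_closed scale add by auto
  show ?thesis
    unfolding biquandle_def
    by (intro conjI ballI closed diag bij_ov bij_un bij_switch) (simp_all only: exchange)
qed

lemma biquandle_module_subset:
  "biquandle_module X un ov t s r \<Longrightarrow> Y \<subseteq> X \<Longrightarrow> biquandle_module Y un ov t s r"
  unfolding biquandle_module_def by (simp add: subset_iff)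

text \<open>
  The image subbiquandle is an intersection of subbiquandles. By finiteness it suffices that it is closed
  under the operations.
\<close>

lemma finite_subbiquandle:
  assumes "biquandle X un ov" "finite X" "Y \<subseteq> X"
    and closed: "\<And>x y. x \<in> Y \<Longrightarrow> y \<in> Y \<Longrightarrow> un x y \<in> Y \<and> ov x y \<in> Y"
  shows "biquandle Y un ov"
proof -
  interpret biquandle_on X un ov by unfold_locales (rule assms(1))
  have fin: "finite Y" using assms finite_subset by blast
  have bij: "bij_betw f Z Z" if "finite Z" "inj_on f Z" "f ` Z \<subseteq> Z" for f :: "'b \<Rightarrow> 'b" and Z
    using endo_inj_surj[OF that(1,3,2)] that(2) by (simp add: bij_betw_def)
  have sub: "x \<in> X" if "x \<in> Y" for x using that assms(3) by blast
  have bij_ov: "bij_betw (\<lambda>x. ov x y) Y Y" if "y \<in> Y" for y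
    by (rule bij[OF fin inj_onI]) (use that closed in \<open>auto intro: ov_inj sub\<close>)
  have bij_un: "bij_betw (\<lambda>x. un x y) Y Y" if "y \<in> Y" for y
    by (rule bij[OF fin inj_onI]) (use that closed in \<open>auto intro: un_inj sub\<close>)
  have bij_switch: "bij_betw (\<lambda>(x, y). (ov y x, un x y)) (Y \<times> Y) (Y \<times> Y)"
  proof (rule bij)
    show "inj_on (\<lambda>(x, y). (ov y x, un x y)) (Y \<times> Y)"
    proof (rule inj_onI)
      fix a b assume ab: "a \<in> Y \<times> Y" "b \<in> Y \<times> Y"
        "(case a of (x, y) \<Rightarrow> (ov y x, un x y)) = (case b of (x, y) \<Rightarrow> (ov y x, un x y))"
      thus "a = b" using switch_inj[of "fst a" "snd a" "fst b" "snd b"] sub by (auto split: prod.splits)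
    qed
  qed (use fin closed in auto)
  show ?thesis
    unfolding biquandle_def
    by (intro conjI ballI bij_ov bij_un bij_switch)
      (simp_all add: closed sub diagonal exchange1 exchange2 exchange3)
qed

lemma biquandle_image_subbiquandle:
  assumes X: "biquandle X un ov" "finite X" and v: "v ` semiarcs D \<subseteq> X"
  shows "biquandle (image_subbiquandle X un ov D v) un ov"
    and "image_subbiquandle X un ov D v \<subseteq> X"
    and "v ` semiarcs D \<subseteq> image_subbiquandle X un ov D v"
proof -
  show sub: "image_subbiquandle X un ov D v \<subseteq> X"
    unfolding image_subbiquandle_def using X v by blast
  show "v ` semiarcs D \<subseteq> image_subbiquandle X un ov D v"
    unfolding image_subbiquandle_def by blast
  show "biquandle (image_subbiquandle X un ov D v) un ov"
  proof (rule finite_subbiquandle[OF X sub])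
    fix x y assume xy: "x \<in> image_subbiquandle X un ov D v" "y \<in> image_subbiquandle X un ov D v"
    have "un x y \<in> Y \<and> ov x y \<in> Y" if "Y \<subseteq> X" "biquandle Y un ov" "v ` semiarcs D \<subseteq> Y" for Y
    proof -
      have "x \<in> Y" "y \<in> Y" using xy that unfolding image_subbiquandle_def by blast+
      thus ?thesis using that(2) unfolding biquandle_def by blast
    qed
    thus "un x y \<in> image_subbiquandle X un ov D v \<and> ov x y \<in> image_subbiquandle X un ov D v"
      unfolding image_subbiquandle_def by blast
  qed
qed

section \<open>Bead colorings and the quiver representation\<close>

lemma four_valent_semiarcs:
  assumes D: "oriented_diagram D" and l: "l < length D" "D ! l = (i, e)" "four_valent e"
  shows "semiarc_of D (l, i) \<in> semiarcs D" "semiarc_of D (l, i + 1) \<in> semiarcs D"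
    "semiarc_of D (l + 1, i) \<in> semiarcs D" "semiarc_of D (l + 1, i + 1) \<in> semiarcs D"
proof -
  have "run_slice (i, e) (level D l) = Some (level D (l + 1))" using oriented_step[OF D l(1)] l(2) by simp
  hence "i + 2 \<le> length (level D l)" "length (level D (l + 1)) = length (level D l)"
    using run_slice_width run_slice_length l(3) unfolding four_valent_def by fastforce+
  thus "semiarc_of D (l, i) \<in> semiarcs D" "semiarc_of D (l, i + 1) \<in> semiarcs D"
    "semiarc_of D (l + 1, i) \<in> semiarcs D" "semiarc_of D (l + 1, i + 1) \<in> semiarcs D"
    using l(1) by (auto intro!: semiarc_of_mem simp: points_def)
qed

lemma crossings_semiarcs:
  assumes D: "oriented_diagram D" and "(ul, ur, ol, orr) \<in> crossings D"
  shows "ul \<in> semiarcs D \<and> ur \<in> semiarcs D \<and> ol \<in> semiarcs D \<and> orr \<in> semiarcs D"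
proof -
  from assms(2) obtain l i c where "l < length D" "D ! l = (i, Cross c)"
    "(ul, ur, ol, orr) = crossing_ends D l i c" unfolding crossings_def by auto
  with four_valent_semiarcs[OF D, of l i "Cross c"] show ?thesis
    by (simp add: four_valent_def crossing_ends_def Let_def split: if_splits)
qed

lemma marked_vertices_semiarcs:
  assumes D: "oriented_diagram D" and "(e1, e2, e3, e4) \<in> marked_vertices D"
  shows "e1 \<in> semiarcs D \<and> e2 \<in> semiarcs D \<and> e3 \<in> semiarcs D \<and> e4 \<in> semiarcs D"
proof -
  from assms(2) obtain l i m where "l < length D" "D ! l = (i, Mark m)"
    "e1 = semiarc_of D (l, i)" "e2 = semiarc_of D (l, i + 1)"
    "e3 = semiarc_of D (l + 1, i)" "e4 = semiarc_of D (l + 1, i + 1)"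
    unfolding marked_vertices_def by blast
  with four_valent_semiarcs[OF D, of l i "Mark m"] show ?thesis by (simp add: four_valent_def)
qed

lemma ball4_conj_all:
  assumes "\<And>a b c d. (a, b, c, d) \<in> S \<Longrightarrow> P a b c d \<longleftrightarrow> Q a b c d \<and> (\<forall>i. R i a b c d)"
  shows "(\<forall>(a, b, c, d)\<in>S. P a b c d) \<longleftrightarrow>
    (\<forall>(a, b, c, d)\<in>S. Q a b c d) \<and> (\<forall>i. \<forall>(a, b, c, d)\<in>S. R i a b c d)"
  using assms by (auto 4 3)

text \<open>
  Bead colorings over \<open>v\<close> are the lifts of \<open>v\<close> to colors with beads.
\<close>

theorem colorings_with_beads:
  fixes F :: "semiarc \<Rightarrow> 'i \<Rightarrow> 'k::{comm_ring, comm_monoid_mult}"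
  assumes D: "oriented_diagram D" and v: "v \<in> extensional (semiarcs D)"
  shows "restrict (\<lambda>e. (v e, F e)) (semiarcs D)
      \<in> colorings (X \<times> A) (bead_un un t s) (bead_ov ov r) D \<longleftrightarrow>
    v \<in> colorings X un ov D \<and> (\<forall>e\<in>semiarcs D. F e \<in> A) \<and>
    (\<forall>i. (\<lambda>e. if e \<in> semiarcs D then F e i else 0) \<in> bead_colorings t s r D v)"
proof -
  let ?p = "restrict (\<lambda>e. (v e, F e)) (semiarcs D)"
  let ?f = "\<lambda>i e. if e \<in> semiarcs D then F e i else 0"
  have in_range: "?p \<in> semiarcs D \<rightarrow>\<^sub>E X \<times> A \<longleftrightarrow> v \<in> semiarcs D \<rightarrow>\<^sub>E X \<and> (\<forall>e\<in>semiarcs D. F e \<in> A)"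
    using v by (auto simp: PiE_def Pi_iff)
  have "?p ur = bead_un un t s (?p ul) (?p ol) \<and> ?p orr = bead_ov ov r (?p ol) (?p ul) \<longleftrightarrow>
      (v ur = un (v ul) (v ol) \<and> v orr = ov (v ol) (v ul)) \<and>
      (\<forall>i. ?f i ur = t (v ul) (v ol) * ?f i ul + s (v ul) (v ol) * ?f i ol \<and>
            ?f i orr = r (v ul) (v ol) * ?f i ol)"
    if "(ul, ur, ol, orr) \<in> crossings D" for ul ur ol orr
    using crossings_semiarcs[OF D that] by (auto simp: fun_eq_iff)
  from ball4_conj_all[OF this] have crossings: "(\<forall>(ul, ur, ol, orr)\<in>crossings D.
        ?p ur = bead_un un t s (?p ul) (?p ol) \<and> ?p orr = bead_ov ov r (?p ol) (?p ul)) \<longleftrightarrow>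
      (\<forall>(ul, ur, ol, orr)\<in>crossings D. v ur = un (v ul) (v ol) \<and> v orr = ov (v ol) (v ul)) \<and>
      (\<forall>i. \<forall>(ul, ur, ol, orr)\<in>crossings D.
            ?f i ur = t (v ul) (v ol) * ?f i ul + s (v ul) (v ol) * ?f i ol \<and>
            ?f i orr = r (v ul) (v ol) * ?f i ol)"
    .
  have "?p e1 = ?p e2 \<and> ?p e2 = ?p e3 \<and> ?p e3 = ?p e4 \<longleftrightarrow>
      (v e1 = v e2 \<and> v e2 = v e3 \<and> v e3 = v e4) \<and>
      (\<forall>i. ?f i e1 = ?f i e2 \<and> ?f i e2 = ?f i e3 \<and> ?f i e3 = ?f i e4)"
    if "(e1, e2, e3, e4) \<in> marked_vertices D" for e1 e2 e3 e4
    using marked_vertices_semiarcs[OF D that] by (auto simp: fun_eq_iff)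
  from ball4_conj_all[OF this] have vertices: "(\<forall>(e1, e2, e3, e4)\<in>marked_vertices D. ?p e1 = ?p e2 \<and> ?p e2 = ?p e3 \<and> ?p e3 = ?p e4) \<longleftrightarrow>
      (\<forall>(e1, e2, e3, e4)\<in>marked_vertices D. v e1 = v e2 \<and> v e2 = v e3 \<and> v e3 = v e4) \<and>
      (\<forall>i. \<forall>(e1, e2, e3, e4)\<in>marked_vertices D. ?f i e1 = ?f i e2 \<and> ?f i e2 = ?f i e3 \<and> ?f i e3 = ?f i e4)"
    .
  have outside: "(\<forall>i e. e \<notin> semiarcs D \<longrightarrow> ?f i e = 0) \<longleftrightarrow> True" by simp
  show ?thesis
    unfolding colorings_def bead_colorings_def mem_Collect_eq in_range crossings vertices
      all_conj_distrib
    by (simp only: outside simp_thms conj_ac)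
qed

lemma map_coloring_apply: "e \<in> semiarcs D \<Longrightarrow> map_coloring D h v e = h (v e)"
  by (simp add: map_coloring_def compose_def)

lemma map_coloring_extensional: "map_coloring D h v \<in> extensional (semiarcs D)"
  by (simp add: map_coloring_def)

lemma map_coloring_comp: "map_coloring D h (map_coloring D g v) = map_coloring D (h \<circ> g) v"
  by (auto simp: map_coloring_def compose_def)

lemma map_coloring_cong:
  assumes "\<And>e. e \<in> semiarcs D \<Longrightarrow> h (v e) = g (u e)"
  shows "map_coloring D h v = map_coloring D g u"
  using assms by (auto simp: map_coloring_def compose_def)

lemma map_coloring_identity:
  assumes "v \<in> extensional (semiarcs D)" "\<And>e. e \<in> semiarcs D \<Longrightarrow> h (v e) = v e"
  shows "map_coloring D h v = v"
  by (rule extensionalityI[OF map_coloring_extensional assms(1)]) (simp add: map_coloring_apply assms(2))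

lemma colorings_extensional: "v \<in> colorings X un ov D \<Longrightarrow> v \<in> extensional (semiarcs D)"
  and colorings_values: "v \<in> colorings X un ov D \<Longrightarrow> e \<in> semiarcs D \<Longrightarrow> v e \<in> X"
  by (auto simp: colorings_def PiE_def)

lemma colorings_subset:
  assumes "v \<in> colorings X un ov D" "v ` semiarcs D \<subseteq> Y"
  shows "v \<in> colorings Y un ov D"
  using assms by (auto simp: colorings_def PiE_def)

lemma biquandle_hom_inclusion: "Y \<subseteq> X \<Longrightarrow> biquandle_hom Y un ov X un ov (\<lambda>x. x)"
  by (auto simp: biquandle_hom_def)

text \<open>
  Linear maps of coordinates satisfy the conditions with \<open>\<sigma>\<close> the identity, endomorphisms that preserve the
  coefficients satisfy them with \<open>\<phi>\<close> the identity.
\<close>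

lemma biquandle_hom_beads:
  assumes "biquandle_hom X un ov X' un ov \<sigma>" "\<And>f. f \<in> A \<Longrightarrow> \<phi> f \<in> A'"
    and "\<And>x y f g. x \<in> X \<Longrightarrow> y \<in> X \<Longrightarrow> f \<in> A \<Longrightarrow> g \<in> A \<Longrightarrow>
      \<phi> (\<lambda>i. t x y * f i + s x y * g i) = (\<lambda>i. t (\<sigma> x) (\<sigma> y) * \<phi> f i + s (\<sigma> x) (\<sigma> y) * \<phi> g i)"
    and "\<And>x y g. x \<in> X \<Longrightarrow> y \<in> X \<Longrightarrow> g \<in> A \<Longrightarrow>
      \<phi> (\<lambda>i. r x y * g i) = (\<lambda>i. r (\<sigma> x) (\<sigma> y) * \<phi> g i)"
  shows "biquandle_hom (X \<times> A) (bead_un un t s) (bead_ov ov r) (X' \<times> A') (bead_un un t s) (bead_ov ov r)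
    (\<lambda>(x, f). (\<sigma> x, \<phi> f))"
  using assms by (auto simp: biquandle_hom_def)

theorem proposition2:
  fixes X :: "'a set"
    and un ov :: "'a \<Rightarrow> 'a \<Rightarrow> 'a"
    and t s r :: "'a \<Rightarrow> 'a \<Rightarrow> 'k::{comm_ring, comm_monoid_mult}"
    and S :: "('a \<Rightarrow> 'a) set"
    and D D' :: "slice list"
  assumes "finite X"
    and "biquandle X un ov"
    and "biquandle_module X un ov t s r"
    and "S \<subseteq> biquandle_End X un ov"
    and "classical_link_equiv D D' \<or> virtual_link_equiv D D' \<or> surface_link_equiv D D'"
  shows "\<exists>\<beta> \<theta>.
    bij_betw \<beta> (colorings X un ov D) (colorings X un ov D') \<and>
    (\<forall>v\<in>colorings X un ov D. \<forall>\<sigma>\<in>S. \<beta> (recolor D \<sigma> v) = recolor D' \<sigma> (\<beta> v)) \<and>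
    (\<forall>v\<in>colorings X un ov D.
       module_iso (bead_colorings t s r D v) (bead_colorings t s r D' (\<beta> v)) (\<theta> v)) \<and>
    (\<forall>v\<in>colorings X un ov D. \<forall>\<sigma>\<in>S. \<forall>f\<in>bead_colorings t s r D v.
       \<theta> (recolor D \<sigma> v) (arrow_map X un ov t s r D v \<sigma> f) =
       arrow_map X un ov t s r D' (\<beta> v) \<sigma> (\<theta> v f))"
proof -
  \<comment> \<open>two coordinates for beads: bead colorings use the constant families \<open>K\<close>, and \<open>Z\<close> stands for no beads\<close>
  define U :: "'a \<times> (bool \<Rightarrow> 'k) \<Rightarrow> 'a \<times> (bool \<Rightarrow> 'k) \<Rightarrow> 'a \<times> (bool \<Rightarrow> 'k)"
    where "U = bead_un un t s"
  define V :: "'a \<times> (bool \<Rightarrow> 'k) \<Rightarrow> 'a \<times> (bool \<Rightarrow> 'k) \<Rightarrow> 'a \<times> (bool \<Rightarrow> 'k)"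
    where "V = bead_ov ov r"
  define Z :: "(bool \<Rightarrow> 'k) set" where "Z = {\<lambda>_. 0}"
  define K :: "(bool \<Rightarrow> 'k) set" where "K = range (\<lambda>a _. a)"
  note UV = U_def V_def
  have mods: "bead_submodule Z" "bead_submodule K" "bead_submodule (UNIV :: (bool \<Rightarrow> 'k) set)"
    by (auto simp: bead_submodule_def Z_def K_def)
  have bq: "biquandle (Y \<times> A) U V" if "biquandle Y un ov" "Y \<subseteq> X" "bead_submodule A" for Y A
    unfolding UV by (rule biquandle_with_beads[OF that(1) biquandle_module_subset[OF assms(3) that(2)] that(3)])
  note bqX = bq[OF assms(2) subset_refl]
  have "naturally_isomorphic TYPE('a \<times> (bool \<Rightarrow> 'k)) D D'"
    by (rule link_equiv_naturally_isomorphic[OF assms(5)])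
  then obtain B where D: "oriented_diagram D" "oriented_diagram D'"
    and bij: "\<And>(Y :: ('a \<times> (bool \<Rightarrow> 'k)) set) un ov. biquandle Y un ov \<Longrightarrow>
       bij_betw (B Y un ov) (colorings Y un ov D) (colorings Y un ov D')"
    and nat: "\<And>(Y :: ('a \<times> (bool \<Rightarrow> 'k)) set) un ov (Y' :: ('a \<times> (bool \<Rightarrow> 'k)) set) un' ov' h v.
      biquandle Y un ov \<Longrightarrow> biquandle Y' un' ov' \<Longrightarrow>
      biquandle_hom Y un ov Y' un' ov' h \<Longrightarrow> v \<in> colorings Y un ov D \<Longrightarrow>
      B Y' un' ov' (map_coloring D h v) = map_coloring D' h (B Y un ov v)"
    unfolding naturally_isomorphic_def by blast
  have B_mem: "B Y U V v \<in> colorings Y U V D'" if "biquandle Y U V" "v \<in> colorings Y U V D" for Y v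
    using bij_betwE[OF bij[OF that(1)]] that(2) by blast
  have B_sub: "B Y' U V v = B Y U V v"
    if "biquandle Y U V" "biquandle Y' U V" "Y \<subseteq> Y'" "v \<in> colorings Y U V D" for Y Y' v
  proof -
    have "B Y' U V (map_coloring D (\<lambda>x. x) v) = map_coloring D' (\<lambda>x. x) (B Y U V v)"
      by (rule nat[OF that(1,2) biquandle_hom_inclusion[OF that(3)] that(4)])
    thus ?thesis
      using map_coloring_identity[OF colorings_extensional[OF that(4)]]
        map_coloring_identity[OF colorings_extensional[OF B_mem[OF that(1,4)]]] by simp
  qed

  \<comment> \<open>colorings without beads are treated as colorings with zero beads; \<open>\<beta>\<close> is natural for inclusions of subbiquandles\<close>
  define lift :: "'a \<Rightarrow> 'a \<times> (bool \<Rightarrow> 'k)" where "lift = (\<lambda>x. (x, \<lambda>_. 0))"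
  define \<beta> where "\<beta> = (\<lambda>v. map_coloring D' fst (B (X \<times> Z) U V (map_coloring D lift v)))"
  have lift_hom: "biquandle_hom Y un ov (Y \<times> Z) U V lift" for Y
    by (auto simp: biquandle_hom_def lift_def Z_def UV)
  have fst_hom: "biquandle_hom (Y \<times> A) U V Y un ov fst" for Y A
    by (auto simp: biquandle_hom_def UV)
  have lift_fst: "map_coloring E lift (map_coloring E fst u) = u" if "u \<in> colorings (Y \<times> Z) U V E" for E u Y
    unfolding map_coloring_comp
    by (rule map_coloring_identity[OF colorings_extensional[OF that]])
      (use colorings_values[OF that] in \<open>auto simp: lift_def Z_def mem_Times_iff prod_eq_iff\<close>)
  have fst_lift: "map_coloring E fst (map_coloring E lift v) = v" if "v \<in> colorings Y un ov E" for E v Y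
    unfolding map_coloring_comp
    by (rule map_coloring_identity[OF colorings_extensional[OF that]]) (simp add: lift_def)
  have bij_lift: "bij_betw (map_coloring E lift) (colorings Y un ov E) (colorings (Y \<times> Z) U V E)"
    and bij_fst: "bij_betw (map_coloring E fst) (colorings (Y \<times> Z) U V E) (colorings Y un ov E)"
    if "oriented_diagram E" for E Y
  proof -
    note maps = map_coloring_mem[OF that lift_hom[of Y]] map_coloring_mem[OF that fst_hom[of Y Z]]
    show "bij_betw (map_coloring E lift) (colorings Y un ov E) (colorings (Y \<times> Z) U V E)"
      by (rule bij_betwI[of _ _ _ "map_coloring E fst"])
        (simp_all add: Pi_iff maps lift_fst[where Y = Y] fst_lift[where Y = Y])
    show "bij_betw (map_coloring E fst) (colorings (Y \<times> Z) U V E) (colorings Y un ov E)"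
      by (rule bij_betwI[of _ _ _ "map_coloring E lift"])
        (simp_all add: Pi_iff maps lift_fst[where Y = Y] fst_lift[where Y = Y])
  qed
  have bij_\<beta>: "bij_betw \<beta> (colorings X un ov D) (colorings X un ov D')"
    using bij_betw_trans[OF bij_lift[OF D(1)] bij_betw_trans[OF bij[OF bqX[OF mods(1)]] bij_fst[OF D(2)]]]
    by (simp add: \<beta>_def comp_def)
  have \<beta>_sub: "\<beta> v \<in> colorings Y un ov D' \<longleftrightarrow> v \<in> colorings Y un ov D"
    if Y: "biquandle Y un ov" "Y \<subseteq> X" and v: "v \<in> colorings X un ov D" for Y v
  proof -
    have b: "biquandle (Y \<times> Z) U V" "biquandle (X \<times> Z) U V" "Y \<times> Z \<subseteq> X \<times> Z"
      using bq[OF Y] bqX mods Y by auto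
    have eq: "\<beta> u = map_coloring D' fst (B (Y \<times> Z) U V (map_coloring D lift u))"
      if "u \<in> colorings Y un ov D" for u
      unfolding \<beta>_def using B_sub[OF b] map_coloring_mem[OF D(1) lift_hom that] by simp
    have bijY: "bij_betw \<beta> (colorings Y un ov D) (colorings Y un ov D')"
      using bij_betw_trans[OF bij_lift[OF D(1)] bij_betw_trans[OF bij[OF b(1)] bij_fst[OF D(2)]]]
      by (rule bij_betw_cong[THEN iffD1, rotated]) (simp add: eq)
    have sub: "u \<in> colorings X un ov D" if "u \<in> colorings Y un ov D" for u
      by (rule colorings_subset[OF that]) (use colorings_values[OF that] Y(2) in auto)
    show ?thesis
    proof
      assume "\<beta> v \<in> colorings Y un ov D'"
      then obtain u where "u \<in> colorings Y un ov D" "\<beta> u = \<beta> v"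
        using bijY unfolding bij_betw_def by (metis imageE)
      thus "v \<in> colorings Y un ov D"
        using sub v bij_\<beta> unfolding bij_betw_def inj_on_def by metis
    next
      assume "v \<in> colorings Y un ov D"
      thus "\<beta> v \<in> colorings Y un ov D'" using bij_betwE[OF bijY] by blast
    qed
  qed

  \<comment> \<open>the lift of \<open>v\<close> given by a bead coloring \<open>f\<close>; \<open>\<theta>\<close> reads off the beads of its image\<close>
  define pair :: "slice list \<Rightarrow> (semiarc \<Rightarrow> 'a) \<Rightarrow> (semiarc \<Rightarrow> 'k) \<Rightarrow> semiarc \<Rightarrow> 'a \<times> (bool \<Rightarrow> 'k)" where
    "pair = (\<lambda>E v f. restrict (\<lambda>e. (v e, \<lambda>_. f e)) (semiarcs E))"
  have pair_mem: "pair E v f \<in> colorings (Y \<times> K) U V E"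
    if E: "oriented_diagram E" and v: "v \<in> colorings Y un ov E" and f: "f \<in> bead_colorings t s r E v"
    for E v f Y
  proof -
    have "(\<lambda>e. if e \<in> semiarcs E then f e else 0) = f"
      using f unfolding bead_colorings_def by (auto simp: fun_eq_iff)
    thus ?thesis unfolding pair_def UV
      by (subst colorings_with_beads[OF E colorings_extensional[OF v]]) (use v f in \<open>auto simp: K_def\<close>)
  qed
  have unpair: "\<exists>f\<in>bead_colorings t s r E (map_coloring E fst u). u = pair E (map_coloring E fst u) f"
    if E: "oriented_diagram E" and u: "u \<in> colorings (X \<times> K) U V E" for E u
  proof -
    define f where "f = (\<lambda>e. if e \<in> semiarcs E then snd (u e) True else 0)"
    define w where "w = map_coloring E fst u"
    have w: "w \<in> extensional (semiarcs E)" by (simp add: w_def map_coloring_extensional)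
    have val: "(w e, \<lambda>_. f e) = u e" if e: "e \<in> semiarcs E" for e
    proof -
      obtain x a where "u e = (x, \<lambda>_. a)" using colorings_values[OF u e] by (auto simp: K_def)
      thus ?thesis using e by (simp add: w_def map_coloring_apply f_def)
    qed
    have u_eq: "u = pair E w f"
      by (rule extensionalityI[OF colorings_extensional[OF u]]) (simp_all add: pair_def val)
    have "(\<lambda>e. if e \<in> semiarcs E then f e else 0) = f" by (auto simp: f_def)
    hence "f \<in> bead_colorings t s r E w"
      using u unfolding u_eq pair_def UV colorings_with_beads[OF E w] by simp
    thus ?thesis using u_eq unfolding w_def by blast
  qed
  define \<theta> where
    "\<theta> = (\<lambda>v f e. if e \<in> semiarcs D' then snd (B (X \<times> K) U V (pair D v f) e) True else 0)"
  note bK = bqX[OF mods(2)]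
  have B_pair: "B (X \<times> K) U V (pair D v f) = pair D' (\<beta> v) (\<theta> v f)"
    and \<theta>_mem: "\<theta> v f \<in> bead_colorings t s r D' (\<beta> v)"
    if v: "v \<in> colorings X un ov D" and f: "f \<in> bead_colorings t s r D v" for v f
  proof -
    let ?u = "pair D v f"
    have u: "?u \<in> colorings (X \<times> K) U V D" by (rule pair_mem[OF D(1) v f])
    let ?h = "\<lambda>(x :: 'a, f :: bool \<Rightarrow> 'k). (x, (\<lambda>_. 0) :: bool \<Rightarrow> 'k)"
    have hom: "biquandle_hom (X \<times> K) U V (X \<times> Z) U V ?h"
      by (auto simp: biquandle_hom_def UV Z_def)
    have "map_coloring D ?h ?u = map_coloring D lift v"
      by (rule map_coloring_cong) (simp add: pair_def lift_def)
    hence "B (X \<times> Z) U V (map_coloring D lift v) = map_coloring D' ?h (B (X \<times> K) U V ?u)"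
      using nat[OF bK bqX[OF mods(1)] hom u] by simp
    hence \<beta>: "\<beta> v = map_coloring D' fst (B (X \<times> K) U V ?u)"
      by (auto simp: \<beta>_def map_coloring_comp split_def intro!: map_coloring_cong)
    obtain g where g: "g \<in> bead_colorings t s r D' (\<beta> v)" "B (X \<times> K) U V ?u = pair D' (\<beta> v) g"
      using unpair[OF D(2) B_mem[OF bK u]] unfolding \<beta>[symmetric] by blast
    have "\<theta> v f = g"
      using g(1) unfolding \<theta>_def g(2) by (auto simp: pair_def bead_colorings_def fun_eq_iff)
    thus "B (X \<times> K) U V ?u = pair D' (\<beta> v) (\<theta> v f)" "\<theta> v f \<in> bead_colorings t s r D' (\<beta> v)"
      using g by auto
  qed
  have \<theta>_eqI: "\<theta> v f = g"
    if "B (X \<times> K) U V (pair D v f) = pair D' w g" "g \<in> bead_colorings t s r D' w'" for v f w g w'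
    using that unfolding \<theta>_def by (auto simp: pair_def bead_colorings_def fun_eq_iff)
  have pair_inj: "f = g" if "pair E v f = pair E v' g" "f \<in> bead_colorings t s r E v" "g \<in> bead_colorings t s r E v'"
    for E v v' f g
  proof
    fix e
    show "f e = g e"
    proof (cases "e \<in> semiarcs E")
      case True
      thus ?thesis using fun_cong[OF that(1), of e] by (auto simp: pair_def fun_eq_iff)
    next
      case False
      thus ?thesis using that(2,3) by (simp add: bead_colorings_def)
    qed
  qed
  have fst_pair: "map_coloring E fst (pair E v f) = v" if "v \<in> extensional (semiarcs E)" for E v f
    by (rule extensionalityI[OF map_coloring_extensional that]) (simp add: map_coloring_apply pair_def)
  have bij_\<theta>: "bij_betw (\<theta> v) (bead_colorings t s r D v) (bead_colorings t s r D' (\<beta> v))"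
    if v: "v \<in> colorings X un ov D" for v
  proof (rule bij_betwI_ex)
    fix f g assume f: "f \<in> bead_colorings t s r D v" and g: "g \<in> bead_colorings t s r D v"
      and "\<theta> v f = \<theta> v g"
    hence "B (X \<times> K) U V (pair D v f) = B (X \<times> K) U V (pair D v g)" using B_pair[OF v] by simp
    hence "pair D v f = pair D v g"
      by (rule inj_onD[OF bij_betw_imp_inj_on[OF bij[OF bK]]]) (rule pair_mem[OF D(1) v f] pair_mem[OF D(1) v g])+
    thus "f = g" using pair_inj f g by blast
  next
    fix g assume g: "g \<in> bead_colorings t s r D' (\<beta> v)"
    have \<beta>v: "\<beta> v \<in> colorings X un ov D'" using bij_betwE[OF bij_\<beta>] v by blast
    have "pair D' (\<beta> v) g \<in> B (X \<times> K) U V ` colorings (X \<times> K) U V D"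
      unfolding bij_betw_imp_surj_on[OF bij[OF bK]] by (rule pair_mem[OF D(2) \<beta>v g])
    then obtain u where Bu: "pair D' (\<beta> v) g = B (X \<times> K) U V u"
      and u: "u \<in> colorings (X \<times> K) U V D" by (rule imageE)
    obtain f where f: "f \<in> bead_colorings t s r D (map_coloring D fst u)" "u = pair D (map_coloring D fst u) f"
      using unpair[OF D(1) u] by blast
    have w: "map_coloring D fst u \<in> colorings X un ov D" by (rule map_coloring_mem[OF D(1) fst_hom u])
    have "pair D' (\<beta> (map_coloring D fst u)) (\<theta> (map_coloring D fst u) f) = pair D' (\<beta> v) g"
      using B_pair[OF w f(1)] unfolding Bu f(2)[symmetric] by simp
    from arg_cong[OF this, of "map_coloring D' fst"] have "\<beta> (map_coloring D fst u) = \<beta> v"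
      using fst_pair[OF colorings_extensional[OF \<beta>v]]
        fst_pair[OF colorings_extensional[OF bij_betwE[OF bij_\<beta>, rule_format, OF w]]] by simp
    hence v_eq: "map_coloring D fst u = v" by (rule inj_onD[OF bij_betw_imp_inj_on[OF bij_\<beta>] _ w v])
    have "B (X \<times> K) U V (pair D v f) = pair D' (\<beta> v) g" using Bu f(2) unfolding v_eq by simp
    hence "\<theta> v f = g" by (rule \<theta>_eqI[OF _ g])
    thus "\<exists>f\<in>bead_colorings t s r D v. g = \<theta> v f" using f(1) unfolding v_eq by blast
  qed (rule \<theta>_mem[OF v])

  \<comment> \<open>a pair of bead colorings is one coloring with two-coordinate beads, and each linear map of coordinates induces a homomorphism\<close>
  have \<theta>_linear: "\<theta> v (\<lambda>e. \<phi> (\<lambda>i. F i e)) = (\<lambda>e. \<phi> (\<lambda>i. \<theta> v (F i) e))"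
    if v: "v \<in> colorings X un ov D" and F: "\<And>i. F i \<in> bead_colorings t s r D v"
      and \<phi>: "\<And>f g. \<phi> (\<lambda>i. f i + g i) = \<phi> f + \<phi> g" "\<And>a f. \<phi> (\<lambda>i. a * f i) = a * \<phi> f"
    for v F and \<phi> :: "(bool \<Rightarrow> 'k) \<Rightarrow> 'k"
  proof -
    note bU = bqX[OF mods(3)]
    let ?u = "restrict (\<lambda>e. (v e, \<lambda>i. F i e)) (semiarcs D)"
    have "(\<lambda>e. if e \<in> semiarcs D then F i e else 0) = F i" for i
      using F[of i] unfolding bead_colorings_def by (auto simp: fun_eq_iff)
    hence u: "?u \<in> colorings (X \<times> UNIV) U V D"
      unfolding UV by (subst colorings_with_beads[OF D(1) colorings_extensional[OF v]]) (use v F in simp)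
    have project: "pair D' (\<beta> v) (\<theta> v (\<lambda>e. \<psi> (\<lambda>i. F i e))) =
        map_coloring D' (\<lambda>(x, f). (x, \<lambda>_. \<psi> f)) (B (X \<times> UNIV) U V ?u)"
      if \<psi>: "\<And>f g. \<psi> (\<lambda>i. f i + g i) = \<psi> f + \<psi> g" "\<And>a f. \<psi> (\<lambda>i. a * f i) = a * \<psi> f"
      for \<psi> :: "(bool \<Rightarrow> 'k) \<Rightarrow> 'k"
    proof -
      let ?h = "\<lambda>(x :: 'a, f). (x, \<lambda>_ :: bool. \<psi> f)"
      have hom: "biquandle_hom (X \<times> UNIV) U V (X \<times> K) U V ?h"
        unfolding UV
        by (rule biquandle_hom_beads[OF biquandle_hom_inclusion[OF subset_refl]]) (auto simp: K_def \<psi>)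
      have rec: "map_coloring D ?h ?u = pair D v (\<lambda>e. \<psi> (\<lambda>i. F i e))"
        unfolding pair_def
        by (rule extensionalityI[OF map_coloring_extensional, of _ _ _ _]) (simp_all add: map_coloring_apply)
      have \<psi>0: "\<psi> (\<lambda>_. 0) = 0" using \<psi>(2)[of 0 "\<lambda>_. 0"] by simp
      have "pair D v (\<lambda>e. \<psi> (\<lambda>i. F i e)) \<in> colorings (X \<times> K) U V D"
        using map_coloring_mem[OF D(1) hom u] unfolding rec .
      moreover have "(\<lambda>e. if e \<in> semiarcs D then \<psi> (\<lambda>i. F i e) else 0) = (\<lambda>e. \<psi> (\<lambda>i. F i e))"
        using F \<psi>0 unfolding bead_colorings_def by (auto simp: fun_eq_iff)
      ultimately have mem: "(\<lambda>e. \<psi> (\<lambda>i. F i e)) \<in> bead_colorings t s r D v"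
        unfolding pair_def UV colorings_with_beads[OF D(1) colorings_extensional[OF v]] by simp
      show "pair D' (\<beta> v) (\<theta> v (\<lambda>e. \<psi> (\<lambda>i. F i e))) =
          map_coloring D' (\<lambda>(x, f). (x, \<lambda>_. \<psi> f)) (B (X \<times> UNIV) U V ?u)"
        using nat[OF bU bK hom u] B_pair[OF v mem] unfolding rec by simp
    qed
    have \<theta>_value: "\<theta> v (\<lambda>e. \<psi> (\<lambda>i. F i e)) e = \<psi> (snd (B (X \<times> UNIV) U V ?u e))"
      if "e \<in> semiarcs D'" and \<psi>: "\<And>f g. \<psi> (\<lambda>i. f i + g i) = \<psi> f + \<psi> g" "\<And>a f. \<psi> (\<lambda>i. a * f i) = a * \<psi> f"
      for e and \<psi> :: "(bool \<Rightarrow> 'k) \<Rightarrow> 'k"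
      using fun_cong[OF project[of \<psi>, OF \<psi>], of e] that(1)
      by (auto simp: pair_def map_coloring_apply fun_eq_iff split: prod.splits)
    have coordinate: "\<theta> v (F i) e = snd (B (X \<times> UNIV) U V ?u e) i" if "e \<in> semiarcs D'" for e i
      using \<theta>_value[OF that, of "\<lambda>f. f i"] by simp
    have \<phi>0: "\<phi> (\<lambda>_. 0) = 0" using \<phi>(2)[of 0 "\<lambda>_. 0"] by simp
    show ?thesis
    proof
      fix e
      show "\<theta> v (\<lambda>e. \<phi> (\<lambda>i. F i e)) e = \<phi> (\<lambda>i. \<theta> v (F i) e)"
      proof (cases "e \<in> semiarcs D'")
        case True
        thus ?thesis using \<theta>_value[OF True, of \<phi>, OF \<phi>] by (simp add: coordinate)
      next
        case False
        thus ?thesis by (simp add: \<theta>_def \<phi>0)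
      qed
    qed
  qed
  have \<theta>_add: "\<theta> v (\<lambda>e. f e + g e) = (\<lambda>e. \<theta> v f e + \<theta> v g e)"
    if "v \<in> colorings X un ov D" "f \<in> bead_colorings t s r D v" "g \<in> bead_colorings t s r D v" for v f g
    using \<theta>_linear[OF that(1), of "\<lambda>i. if i then f else g" "\<lambda>h. h True + h False"] that(2,3)
    by (simp add: distrib_left add.assoc add.left_commute)
  have \<theta>_scale: "\<theta> v (\<lambda>e. a * f e) = (\<lambda>e. a * \<theta> v f e)"
    if "v \<in> colorings X un ov D" "f \<in> bead_colorings t s r D v" for v f a
    using \<theta>_linear[OF that(1), of "\<lambda>i. f" "\<lambda>h. a * h True"] that(2)
    by (simp add: distrib_left mult.left_commute)
  have zero_mem: "(\<lambda>_. 0) \<in> bead_colorings t s r E v" for E v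
    by (auto simp: bead_colorings_def)
  have \<theta>_zero: "\<theta> v (\<lambda>_. 0) = (\<lambda>_. 0)" if "v \<in> colorings X un ov D" for v
    using \<theta>_scale[OF that zero_mem, of 0] by simp

  have \<sigma>_hom: "biquandle_hom X un ov X un ov \<sigma>" if "\<sigma> \<in> S" for \<sigma>
    using that assms(4) by (auto simp: biquandle_End_def biquandle_hom_def)
  have \<beta>_nat: "\<beta> (map_coloring D \<sigma> v) = map_coloring D' \<sigma> (\<beta> v)" if v: "v \<in> colorings X un ov D" and \<sigma>: "\<sigma> \<in> S" for v \<sigma>
  proof -
    let ?h = "\<lambda>(x :: 'a, f :: bool \<Rightarrow> 'k). (\<sigma> x, (\<lambda>_. 0) :: bool \<Rightarrow> 'k)"
    have hom: "biquandle_hom (X \<times> Z) U V (X \<times> Z) U V ?h"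
      using \<sigma>_hom[OF \<sigma>] by (auto simp: biquandle_hom_def UV Z_def)
    have u: "map_coloring D lift v \<in> colorings (X \<times> Z) U V D" by (rule map_coloring_mem[OF D(1) lift_hom v])
    have "map_coloring D lift (map_coloring D \<sigma> v) = map_coloring D ?h (map_coloring D lift v)"
      unfolding map_coloring_comp by (rule map_coloring_cong) (simp add: lift_def)
    thus ?thesis
      unfolding \<beta>_def using nat[OF bqX[OF mods(1)] bqX[OF mods(1)] hom u]
      by (auto simp: map_coloring_comp split_def intro!: map_coloring_cong)
  qed
  \<comment> \<open>a subbiquandle contains the colors of \<open>v\<close> iff \<open>v\<close> is a coloring by it, and \<open>\<beta>\<close> respects this\<close>
  have image_eq: "image_subbiquandle X un ov D' (\<beta> v) = image_subbiquandle X un ov D v"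
    if v: "v \<in> colorings X un ov D" for v
  proof -
    have \<beta>v: "\<beta> v \<in> colorings X un ov D'" using bij_betwE[OF bij_\<beta>] v by blast
    have mem: "u \<in> colorings Y un ov E \<longleftrightarrow> u ` semiarcs E \<subseteq> Y" if "u \<in> colorings X un ov E" for u E Y
      using that colorings_subset[OF that] colorings_values by blast
    have eq: "\<beta> v ` semiarcs D' \<subseteq> Y \<longleftrightarrow> v ` semiarcs D \<subseteq> Y" if "Y \<subseteq> X" "biquandle Y un ov" for Y
      using \<beta>_sub[OF that(2,1) v] mem[OF v] mem[OF \<beta>v] by simp
    show ?thesis unfolding image_subbiquandle_def
      by (intro arg_cong[of _ _ Inter] Collect_cong conj_cong refl eq)
  qed
  have arrow: "\<theta> (map_coloring D \<sigma> v) (arrow_map X un ov t s r D v \<sigma> f) =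
      arrow_map X un ov t s r D' (\<beta> v) \<sigma> (\<theta> v f)"
    if v: "v \<in> colorings X un ov D" and \<sigma>: "\<sigma> \<in> S" and f: "f \<in> bead_colorings t s r D v" for v \<sigma> f
  proof -
    let ?I = "image_subbiquandle X un ov D v"
    let ?same = "\<forall>x\<in>?I. \<forall>y\<in>?I. t x y = t (\<sigma> x) (\<sigma> y) \<and> s x y = s (\<sigma> x) (\<sigma> y) \<and> r x y = r (\<sigma> x) (\<sigma> y)"
    have \<sigma>v: "map_coloring D \<sigma> v \<in> colorings X un ov D" by (rule map_coloring_mem[OF D(1) \<sigma>_hom[OF \<sigma>] v])
    show ?thesis
    proof (cases ?same)
      case False
      show ?thesis unfolding arrow_map_def image_eq[OF v] if_not_P[OF False] by (rule \<theta>_zero[OF \<sigma>v])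
    next
      case True
      have vX: "v ` semiarcs D \<subseteq> X" using colorings_values[OF v] by blast
      note I = biquandle_image_subbiquandle[OF assms(2,1) vX]
      have vI: "v \<in> colorings ?I un ov D" by (rule colorings_subset[OF v I(3)])
      have bI: "biquandle (?I \<times> K) U V" by (rule bq[OF I(1,2) mods(2)])
      have sub: "?I \<times> K \<subseteq> X \<times> K" using I(2) by blast
      \<comment> \<open>since \<open>\<sigma>\<close> preserves the coefficients on the image subbiquandle, it extends there to colors with beads\<close>
      let ?h = "\<lambda>(x, f :: bool \<Rightarrow> 'k). (\<sigma> x, f)"
      have u: "pair D v f \<in> colorings (?I \<times> K) U V D" by (rule pair_mem[OF D(1) vI f])
      have \<sigma>I: "biquandle_hom ?I un ov X un ov \<sigma>"
        using \<sigma>_hom[OF \<sigma>] I(2) unfolding biquandle_hom_def by blast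
      have hom: "biquandle_hom (?I \<times> K) U V (X \<times> K) U V ?h"
        unfolding UV by (rule biquandle_hom_beads[OF \<sigma>I]) (use True in auto)
      have rec: "map_coloring E ?h (pair E w g) = pair E (map_coloring E \<sigma> w) g" for E w g
        unfolding pair_def
        by (rule extensionalityI[OF map_coloring_extensional, of _ _ _ _]) (simp_all add: map_coloring_apply)
      have "B (X \<times> K) U V (pair D (map_coloring D \<sigma> v) f) = pair D' (map_coloring D' \<sigma> (\<beta> v)) (\<theta> v f)"
        using nat[OF bI bK hom u] unfolding B_sub[OF bI bK sub u, symmetric] B_pair[OF v f] rec .
      hence "\<theta> (map_coloring D \<sigma> v) f = \<theta> v f" by (rule \<theta>_eqI[OF _ \<theta>_mem[OF v f]])
      thus ?thesis unfolding arrow_map_def image_eq[OF v] if_P[OF True] .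
    qed
  qed
  show ?thesis
    unfolding recolor_eq_map_coloring
    by (intro exI[of _ \<beta>] exI[of _ \<theta>] conjI ballI)
      (simp_all add: bij_\<beta> \<beta>_nat arrow module_iso_def bij_\<theta> \<theta>_add \<theta>_scale)
qed

end
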